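(* Let $\psi$ be a function which takes nonnegative values on $\Delta:=(0,+\infty)$, is analytic in a neighbourhood of $\Delta$ in the complex plane, and satisfies $\psi''(z)>0$ for all $z\in\Delta$. Let $\psi_*$ be the convex conjugate of $\psi$, given by $\psi_*(z):=z\,v(z)-\psi(v(z))$ for $z\in\psi'(\Delta)$, where $v:=(\psi')^{-1}:\psi'(\Delta)\to\Delta$ is the functional inverse of $\psi'$. Suppose the statistical uncertainty about the input $W$ of the system $F$ is described by the class $\mathfrak{G}_{\psi,d}$ of shaping filters $\Gamma$ defined in the context. Then for any $d\geqslant 0$, the worst-case output variance admits the upper bound $$\sup_{\Gamma\in\mathfrak{G}_{\psi,d}}\mathbf{E}(|Z(t)|^2)\ \leqslant\ \inf_{\sigma>0}\Big(\frac{1}{\sigma}\big(J_{\psi_*}(\sqrt{\sigma}F)+d\big)\Big).$$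
   Context: Setting. $f\in L^2(\mathbb{R}_+,\mathbb{R}^{p\times m})$ is the impulse response of a linear causal time-invariant system with transfer function $F(s)=\int_0^\infty e^{-st}f(t)\,dt$ for $\mathrm{Re}\,s>0$, with boundary value $\widehat F(\omega):=F(i\omega)=\int_0^\infty e^{-i\omega t}f(t)\,dt$, and $F$ is not identically zero. The output is $Z(t)=\int_{-\infty}^t f(t-\tau)\,dW(\tau)$, where the input $W$ is an $\mathbb{R}^m$-valued Gaussian process with stationary increments, produced from a standard Wiener process in $\mathbb{R}^m$ by a shaping filter with transfer function $\Gamma\in\mathcal{H}_\infty^{m\times m}$ (bounded holomorphic $\mathbb{C}^{m\times m}$-valued functions in the open right half-plane). The input spectral density is $\Sigma(\omega)=\Gamma(i\omega)\Gamma(i\omega)^*$, and it is assumed that $\det\Gamma(i\omega)\neq0$ for almost all $\omega\in\mathbb{R}$. The variance of the stationary output is $$\mathbf{E}(|Z(t)|^2)=\|F\Gamma\|_2^2=\frac1{2\pi}\int_{\mathbb{R}}\mathrm{Tr}\big(\widehat F(\omega)\Sigma(\omega)\widehat F(\omega)^*\big)\,d\omega .$$ Covariance-analytic functionals. For a function $\phi$ and a transfer function $F$, $J_\phi(F):=\frac1{2\pi}\int_{\mathbb{R}}\mathrm{Tr}\,\phi\big(\widehat F(\omega)\widehat F(\omega)^*\big)\,d\omega$, where $\phi$ is evaluated at a Hermitian matrix through its eigenvalues. In particular, $J_\psi(\Gamma)=\frac1{2\pi}\int_{\mathbb{R}}\mathrm{Tr}\,\psi(\Sigma(\omega))\,d\omega$.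 In evaluating $J_{\psi_*}(\sqrt\sigma F)$, the quantity $\mathrm{Tr}\,\psi_*(L)$ is set equal to $+\infty$ for any Hermitian matrix $L$ having an eigenvalue outside the open interval $\psi'(\Delta)$. Uncertainty class: $\mathfrak{G}_{\psi,d}:=\{\Gamma\in\mathcal{H}_\infty^{m\times m}:\ J_\psi(\Gamma)\leqslant d\}$ (where every $\Gamma$ in the class is assumed to satisfy $\det\Gamma(i\omega)\ne0$ for almost all $\omega\in\mathbb{R}$). The supremum over an empty class is $-\infty$, so that nothing is claimed in that case. *)

theory Defs
  imports "HOL-Probability.Probability"
begin

section \<open>Matrices and functions of Hermitian matrices\<close>

definition hadj :: "complex^'n^'m \<Rightarrow> complex^'m^'n" where
  "hadj A = (\<chi> i j. cnj (A $ j $ i))"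

definition unitary :: "complex^'n^'n \<Rightarrow> bool" where
  "unitary U \<longleftrightarrow> U ** hadj U = mat 1 \<and> hadj U ** U = mat 1"

definition real_diag :: "('n \<Rightarrow> real) \<Rightarrow> complex^'n^'n" where
  "real_diag l = (\<chi> i j. if i = j then complex_of_real (l i) else 0)"

text \<open>For Hermitian \<open>H\<close> a unitary diagonalisation exists, and its diagonal is determined up to a
  permutation, so that \<open>trace_fun \<phi> H\<close>, the trace of \<open>\<phi>(H)\<close>, does not depend on the choice.
  The value \<open>\<infinity>\<close> of \<open>\<phi>\<close> stands for points outside its domain; as \<open>\<phi>\<close> will never be \<open>-\<infinity>\<close>, the trace
  is \<open>\<infinity>\<close> iff some eigenvalue lies outside the domain.\<close>

definition eigvals :: "complex^'n^'n \<Rightarrow> 'n \<Rightarrow> real" where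
  "eigvals H = (SOME l. \<exists>U. unitary U \<and> H = U ** real_diag l ** hadj U)"

definition trace_fun :: "(real \<Rightarrow> ereal) \<Rightarrow> complex^'n^'n \<Rightarrow> ereal" where
  "trace_fun \<phi> H = (\<Sum>i\<in>UNIV. \<phi> (eigvals H i))"


section \<open>Transfer functions and covariance-analytic functionals\<close>

definition laplace :: "(real \<Rightarrow> complex^'m^'p) \<Rightarrow> complex \<Rightarrow> complex^'m^'p" where
  "laplace g s = (\<chi> i j. LBINT t:{0..}. exp (- s * complex_of_real t) * g t $ i $ j)"

definition hardy_inf :: "(complex \<Rightarrow> complex^'m^'p) \<Rightarrow> bool" where
  "hardy_inf G \<longleftrightarrow>
     (\<forall>i j. (\<lambda>s. G s $ i $ j) holomorphic_on {s. 0 < Re s}) \<and> bounded (G ` {s. 0 < Re s})"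

text \<open>The boundary function \<open>\<omega> \<mapsto> G(i\<omega>)\<close> is determined almost everywhere, as a horizontal limit. By
  Fatou's theorem it exists for the Hardy class functions considered here (bounded holomorphic
  functions, and Laplace transforms of square integrable functions); in the latter case it is
  the Fourier transform \<open>\<integral> exp(-i\<omega>t) f(t) dt\<close> in the sense of Plancherel.\<close>

definition has_boundary_value ::
  "(complex \<Rightarrow> complex^'m^'p) \<Rightarrow> (real \<Rightarrow> complex^'m^'p) \<Rightarrow> bool" where
  "has_boundary_value G Ghat \<longleftrightarrow>
     (AE \<omega> in lborel. ((\<lambda>x. G (Complex x \<omega>)) \<longlongrightarrow> Ghat \<omega>) (at_right 0))"

text \<open>Lebesgue integral over the real line of an extended real function as the difference of the
  integrals of its positive and negative parts, where \<open>\<infinity> - \<infinity> = \<infinity>\<close>.\<close>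

definition ereal_integral :: "(real \<Rightarrow> ereal) \<Rightarrow> ereal" where
  "ereal_integral h =
     enn2ereal (\<integral>\<^sup>+\<omega>. e2ennreal (h \<omega>) \<partial>lborel) - enn2ereal (\<integral>\<^sup>+\<omega>. e2ennreal (- h \<omega>) \<partial>lborel)"

text \<open>The functional \<open>J\<^sub>\<phi>\<close>, as a function of the boundary value of the transfer function.\<close>

definition cov_functional :: "(real \<Rightarrow> ereal) \<Rightarrow> (real \<Rightarrow> complex^'m^'p) \<Rightarrow> ereal" where
  "cov_functional \<phi> Fhat =
     ereal (1 / (2 * pi)) * ereal_integral (\<lambda>\<omega>. trace_fun \<phi> (Fhat \<omega> ** hadj (Fhat \<omega>)))"

definition convex_conj :: "(real \<Rightarrow> real) \<Rightarrow> real \<Rightarrow> ereal" where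
  "convex_conj \<psi> z =
     (if z \<in> deriv \<psi> ` {0<..}
      then (let v = inv_into {0<..} (deriv \<psi>) in ereal (z * v z - \<psi> (v z)))
      else \<infinity>)"

definition uncertainty_class ::
  "(real \<Rightarrow> real) \<Rightarrow> real \<Rightarrow> (complex \<Rightarrow> complex^'m^'m) set" where
  "uncertainty_class \<psi> d =
     {\<Gamma>. hardy_inf \<Gamma> \<and>
          (\<exists>\<Gamma>hat. has_boundary_value \<Gamma> \<Gamma>hat \<and> (AE \<omega> in lborel. det (\<Gamma>hat \<omega>) \<noteq> 0) \<and>
                  cov_functional (\<lambda>x. ereal (\<psi> x)) \<Gamma>hat \<le> ereal d)}"


section \<open>Wiener process, shaping filters and system outputs\<close>

definition standard_wiener :: "'a measure \<Rightarrow> (real \<Rightarrow> 'a \<Rightarrow> real^'m) \<Rightarrow> bool" where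
  "standard_wiener M V \<longleftrightarrow>
     prob_space M \<and>
     (\<forall>t. V t \<in> borel_measurable M) \<and>
     (AE x in M. V 0 x = 0) \<and>
     (AE x in M. continuous_on UNIV (\<lambda>t. V t x)) \<and>
     (\<forall>s t i. s < t \<longrightarrow>
        distributed M lborel (\<lambda>x. V t x $ i - V s x $ i)
          (\<lambda>y. ennreal (normal_density 0 (sqrt (t - s)) y))) \<and>
     (\<forall>ts. sorted_wrt (<) ts \<longrightarrow>
        prob_space.indep_vars M (\<lambda>_. borel)
          (\<lambda>(j, i) x. V (ts ! Suc j) x $ i - V (ts ! j) x $ i)
          ({..<length ts - 1} \<times> UNIV))"

text \<open>A list of triples \<open>(a, b, A)\<close> with \<open>a \<le> b\<close> represents the matrix-valued step function which is
  the sum of the functions equal to \<open>A\<close> on \<open>(a, b]\<close> and to \<open>0\<close> elsewhere.\<close>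

type_synonym ('m, 'p) steps = "(real \<times> real \<times> (complex^'m^'p)) list"

definition step_fun :: "('m::finite, 'p::finite) steps \<Rightarrow> real \<Rightarrow> complex^'m^'p" where
  "step_fun S \<tau> = (\<Sum>(a, b, A)\<leftarrow>S. indicat_real {a<..b} \<tau> *\<^sub>R A)"

definition step_integral ::
  "(real \<Rightarrow> 'a \<Rightarrow> complex^'m) \<Rightarrow> ('m::finite, 'p::finite) steps \<Rightarrow> 'a \<Rightarrow> complex^'p" where
  "step_integral U S x = (\<Sum>(a, b, A)\<leftarrow>S. A *v (U b x - U a x))"

text \<open>\<open>X\<close> is (a version of) the mean square stochastic integral of the deterministic, square
  integrable function \<open>g\<close> with respect to \<open>U\<close>. For the processes used here (a standard Wiener
  process and its images under filters with bounded transfer functions) the mean square norm of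
  \<open>step_integral U S\<close> is bounded by a multiple of the \<open>L\<^sup>2\<close> norm of \<open>step_fun S\<close>, so that \<open>X\<close> does
  not depend on the approximating sequence, up to null sets.\<close>

definition has_stoch_integral ::
  "'a measure \<Rightarrow> (real \<Rightarrow> 'a \<Rightarrow> complex^'m) \<Rightarrow> (real \<Rightarrow> complex^'m^'p) \<Rightarrow> ('a \<Rightarrow> complex^'p) \<Rightarrow> bool"
where
  "has_stoch_integral M U g X \<longleftrightarrow>
     g \<in> borel_measurable lborel \<and> integrable lborel (\<lambda>\<tau>. (norm (g \<tau>))\<^sup>2) \<and>
     X \<in> borel_measurable M \<and>
     (\<exists>S :: nat \<Rightarrow> ('m, 'p) steps.
        (\<forall>n. \<forall>(a, b, A)\<in>set (S n). a \<le> b) \<and>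
        (\<lambda>n. \<integral>\<^sup>+\<tau>. ennreal ((norm (step_fun (S n) \<tau> - g \<tau>))\<^sup>2) \<partial>lborel) \<longlonglongrightarrow> 0 \<and>
        (\<lambda>n. \<integral>\<^sup>+x. ennreal ((norm (step_integral U (S n) x - X x))\<^sup>2) \<partial>M) \<longlonglongrightarrow> 0)"

text \<open>The step response \<open>k\<close> is the integral of the impulse response of the filter, its Laplace
  transform being \<open>\<Gamma>(s)/s\<close>. Unlike the impulse response, it is a function for every bounded
  holomorphic \<open>\<Gamma>\<close>.\<close>

definition step_response :: "(complex \<Rightarrow> complex^'m^'p) \<Rightarrow> (real \<Rightarrow> complex^'m^'p) \<Rightarrow> bool" where
  "step_response \<Gamma> k \<longleftrightarrow>
     k \<in> borel_measurable borel \<and> (\<forall>t<0. k t = 0) \<and>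
     (\<forall>s. 0 < Re s \<longrightarrow>
        (\<forall>i j. set_integrable lborel {0..} (\<lambda>t. exp (- s * complex_of_real t) * k t $ i $ j)) \<and>
        laplace k s = map_matrix (\<lambda>z. z / s) (\<Gamma> s))"

text \<open>The response \<open>W\<close> of the filter \<open>\<Gamma>\<close> to the Wiener process \<open>V\<close>: formally, \<open>dW/dt\<close> is the
  convolution of the impulse response with the white noise \<open>dV/dt\<close>, integrated over \<open>[s, t]\<close>.
  No symmetry \<open>\<Gamma>(cnj s) = cnj (\<Gamma>(s))\<close> is imposed; under this symmetry, the increments of \<open>W\<close>
  are real almost surely.\<close>

definition shaped_process ::
  "'a measure \<Rightarrow> (real \<Rightarrow> 'a \<Rightarrow> real^'m) \<Rightarrow> (complex \<Rightarrow> complex^'m^'m) \<Rightarrow>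
   (real \<Rightarrow> 'a \<Rightarrow> complex^'m) \<Rightarrow> bool" where
  "shaped_process M V \<Gamma> W \<longleftrightarrow>
     (\<exists>k. step_response \<Gamma> k \<and>
          (\<forall>s t. s \<le> t \<longrightarrow>
             has_stoch_integral M (\<lambda>\<tau> x. \<chi> i. complex_of_real (V \<tau> x $ i))
               (\<lambda>\<tau>. k (t - \<tau>) - k (s - \<tau>)) (\<lambda>x. W t x - W s x)))"

definition system_output ::
  "'a measure \<Rightarrow> (real \<Rightarrow> real^'m^'p) \<Rightarrow> (real \<Rightarrow> 'a \<Rightarrow> complex^'m) \<Rightarrow>
   (real \<Rightarrow> 'a \<Rightarrow> complex^'p) \<Rightarrow> bool" where
  "system_output M f W Z \<longleftrightarrow>
     (\<forall>t. has_stoch_integral M W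
            (\<lambda>\<tau>. if \<tau> \<le> t then map_matrix complex_of_real (f (t - \<tau>)) else 0) (Z t))"

end

theory Submission
  imports Defs "HOL-Complex_Analysis.Complex_Analysis"
begin

unbundle no fps_syntax

text \<open>The step functions approximating the impulse response are filtered into kernels which are
  integrated against the Wiener process itself. The isometry for Wiener integrals, Plancherel's
  theorem on the lines \<open>Re s = x\<close> and the limit \<open>x \<rightarrow> 0\<close> bound the output variance by
  \<open>1 / (2 \<pi>)\<close> times the integral of \<open>\<parallel>F \<Gamma>\<parallel>\<^sup>2\<close> over the imaginary axis; only inequalities are
  needed. Pointwise, in eigenbases of \<open>\<Gamma> \<Gamma>\<^sup>*\<close> and \<open>\<sigma> F F\<^sup>*\<close>, the quantity \<open>\<sigma> \<parallel>F \<Gamma>\<parallel>\<^sup>2\<close> is a doubly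
  substochastic average of products of eigenvalues, and the Fenchel--Young inequality bounds it by
  the sum of the traces of \<open>\<psi>(\<Gamma> \<Gamma>\<^sup>*)\<close> and \<open>\<psi>\<^sub>*(\<sigma> F F\<^sup>*)\<close>.\<close>

section \<open>Hermitian matrices and traces\<close>

text \<open>The increments of \<open>W\<close> are correlated, so integrals against \<open>W\<close>
  have no isometry of their own; this is why they are rewritten as integrals against
  \<open>V\<close>. The rewriting uses the step response, because the impulse response of a bounded
  filter need not be a function. The step response in turn need not be integrable, whence the
  weights \<open>exp (x * \<tau>)\<close> and the detour through the lines \<open>Re s = x\<close>.
  These weights grow with \<tau>, and causality, which makes the kernels vanish for large \<tau>, is
  what allows x to tend to 0.

  On the matrix side, the weights are only substochastic, since \<open>F\<close> may be rectangular
  and rank deficient. Missing weight can be filled up only if both \<open>\<psi>\<close> and its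
  conjugate are nonnegative at the eigenvalues. For the conjugate this is not assumed: it follows
  from the finiteness of the functional of \<open>\<psi>\<close>.

  The parameter \<sigma> is the scaling freedom in Young's inequality: one factor is scaled by
  \<sigma> and the result is divided by it.\<close>

lemma hadj_nth [simp]: "hadj A $ i $ j = cnj (A $ j $ i)"
  by (simp add: hadj_def)

lemma hadj_hadj [simp]: "hadj (hadj A) = A"
  by (simp add: vec_eq_iff)

lemma hadj_mult: "hadj (A ** B) = hadj B ** hadj A"
  by (simp add: vec_eq_iff matrix_matrix_mult_def mult.commute)

lemma hadj_mat_1 [simp]: "hadj (mat 1) = mat 1"
  by (simp add: vec_eq_iff mat_def)

text \<open>The nested Euclidean norm of a vector of vectors is the Frobenius norm; for the product
  of the two transfer functions its square is the integrand of the output variance.\<close>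

lemma norm_matrix_sq:
  fixes A :: "complex^'m^'p"
  shows "(norm A)\<^sup>2 = (\<Sum>i\<in>UNIV. \<Sum>j\<in>UNIV. (cmod (A $ i $ j))\<^sup>2)"
  by (simp add: norm_vec_def L2_set_def sum_nonneg)

lemma mult_hadj_nth:
  fixes A :: "complex^'m^'p"
  shows "(A ** hadj A) $ i $ i = complex_of_real (\<Sum>j\<in>UNIV. (cmod (A $ i $ j))\<^sup>2)"
  by (simp add: matrix_matrix_mult_def flip: complex_norm_square)

section \<open>Unitary matrices and rotations in coordinate planes\<close>

lemma unitary_mat_1: "unitary (mat 1)"
  by (simp add: unitary_def)

lemma unitary_mult:
  fixes U V :: "complex^'n^'n"
  assumes "unitary U" "unitary V"
  shows "unitary (U ** V)"
proof -
  have "U ** V ** hadj (U ** V) = U ** (V ** hadj V) ** hadj U"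
    by (simp add: hadj_mult matrix_mul_assoc)
  moreover have "hadj (U ** V) ** (U ** V) = hadj V ** (hadj U ** U) ** V"
    by (simp add: hadj_mult matrix_mul_assoc)
  ultimately show ?thesis
    using assms by (simp add: unitary_def)
qed

lemma unitary_hadj: "unitary U \<Longrightarrow> unitary (hadj U)"
  by (simp add: unitary_def)

lemma unitary_row_sum:
  fixes U :: "complex^'n^'n"
  assumes "unitary U"
  shows "(\<Sum>j\<in>UNIV. (cmod (U $ i $ j))\<^sup>2) = 1"
proof -
  have "(U ** hadj U) $ i $ i = 1"
    using assms by (simp add: unitary_def mat_def)
  then show ?thesis
    unfolding mult_hadj_nth of_real_eq_1_iff .
qed

lemma unitary_column_sum:
  fixes U :: "complex^'n^'n"
  assumes "unitary U"
  shows "(\<Sum>i\<in>UNIV. (cmod (U $ i $ j))\<^sup>2) = 1"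
  using unitary_row_sum[OF unitary_hadj[OF assms], of j] by simp

lemma continuous_on_matrix_mult [continuous_intros]:
  fixes f :: "'a::topological_space \<Rightarrow> complex^'m^'p" and g :: "'a \<Rightarrow> complex^'k^'m"
  shows "continuous_on S f \<Longrightarrow> continuous_on S g \<Longrightarrow> continuous_on S (\<lambda>x. f x ** g x)"
  unfolding matrix_matrix_mult_def by (intro continuous_intros)

lemma continuous_on_hadj [continuous_intros]:
  "continuous_on S f \<Longrightarrow> continuous_on S (\<lambda>x. hadj (f x))"
  unfolding hadj_def by (intro continuous_intros) 

text \<open>All rows are unit vectors, so the group lies on a sphere. Compactness supplies the
  maximiser in the diagonalisation below.\<close>

lemma compact_unitary: "compact {U :: complex^'n^'n. unitary U}"
proof -
  have "norm U \<le> sqrt (real CARD('n))" if "unitary U" for U :: "complex^'n^'n"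
  proof -
    have "(norm U)\<^sup>2 = real CARD('n)"
      by (simp add: norm_matrix_sq unitary_row_sum[OF that])
    then show ?thesis
      by (simp add: real_le_rsqrt)
  qed
  then have "bounded {U :: complex^'n^'n. unitary U}"
    by (auto simp: bounded_iff)
  moreover have "closed {U :: complex^'n^'n. unitary U}"
    unfolding unitary_def by (intro closed_Collect_conj closed_Collect_eq continuous_intros)
  ultimately show ?thesis
    by (simp add: compact_eq_bounded_closed)
qed

text \<open>The unitary which agrees with the identity except on the coordinates \<open>i\<close> and \<open>j\<close>, where its
  columns are \<open>(a, b)\<close> and \<open>(- cnj b, a)\<close>.\<close>

definition plane_rotation :: "'n \<Rightarrow> 'n \<Rightarrow> real \<Rightarrow> complex \<Rightarrow> complex^'n^'n" where
  "plane_rotation i j a b = (\<chi> k l.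
     if l = i then (if k = i then of_real a else 0) + (if k = j then b else 0)
     else if l = j then (if k = i then - cnj b else 0) + (if k = j then of_real a else 0)
     else if k = l then 1 else 0)"

text \<open>Multiplying a row \<open>g\<close> by the rotation changes only its entries
  \<open>i\<close> and \<open>j\<close>. Both the unitarity of the rotation and its effect on a
  diagonal reduce to this formula.\<close>

lemma sum_plane_rotation:
  fixes i j :: "'n::finite"
  assumes "i \<noteq> j"
  shows "(\<Sum>k\<in>UNIV. g k * plane_rotation i j a b $ k $ l) =
    (if l = i then g i * of_real a + g j * b
     else if l = j then - g i * cnj b + g j * of_real a else g l)"
  using assms
  by (simp add: plane_rotation_def distrib_left sum.distrib sum_negf if_distrib[of "(*) _"] cong: if_cong)

lemma unitary_plane_rotation:
  fixes i j :: "'n::finite"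
  assumes "i \<noteq> j" "a\<^sup>2 + (cmod b)\<^sup>2 = 1"
  shows "unitary (plane_rotation i j a b)"
proof -
  let ?R = "plane_rotation i j a b"
  have "(cmod b)\<^sup>2 = 1 - a * a"
    using assms(2) by (simp add: power2_eq_square)
  then have ab: "b * cnj b = 1 - of_real a * of_real a"
    by (simp flip: complex_norm_square)
  then have ba: "cnj b * b = 1 - of_real a * of_real a"
    by (simp add: mult.commute)
  have "(hadj ?R ** ?R) $ k $ l = mat 1 $ k $ l" for k l
  proof -
    have "(hadj ?R ** ?R) $ k $ l = (\<Sum>q\<in>UNIV. cnj (?R $ q $ k) * ?R $ q $ l)"
      by (simp add: matrix_matrix_mult_def)
    also have "\<dots> = mat 1 $ k $ l"
      unfolding sum_plane_rotation[OF assms(1)]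
      using assms(1) assms(1)[symmetric]
      by (cases "k = i"; cases "k = j"; cases "l = i"; cases "l = j")
        (simp_all add: plane_rotation_def mat_def ab ba)
    finally show ?thesis .
  qed
  then have "hadj ?R ** ?R = mat 1"
    by (simp add: vec_eq_iff)
  then show ?thesis
    using matrix_left_right_inverse unitary_def by blast
qed

text \<open>The trace is invariant, so what the entry \<open>i\<close> gains the entry
  \<open>j\<close> loses. The gain \<open>e\<close> has a part linear in \<open>b\<close>, which
  dominates for small \<open>b\<close> and can be made positive by the phase of \<open>b\<close>
  whenever the entry of \<open>B\<close> at \<open>i\<close>, \<open>j\<close> is nonzero.\<close>

lemma plane_rotation_diagonal:
  fixes B :: "complex^'n^'n"
  assumes "i \<noteq> j" and H: "hadj B = B" and a: "a\<^sup>2 + (cmod b)\<^sup>2 = 1"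
  defines "R \<equiv> plane_rotation i j a b"
  defines "e \<equiv> (cmod b)\<^sup>2 * (Re (B $ j $ j) - Re (B $ i $ i)) + 2 * a * Re (b * B $ i $ j)"
  shows "Re ((hadj R ** B ** R) $ k $ k) =
    Re (B $ k $ k) + (if k = i then e else if k = j then - e else 0)"
proof -
  have Bji: "B $ j $ i = cnj (B $ i $ j)"
    by (metis H hadj_nth)
  have a': "a * a = 1 - (cmod b)\<^sup>2"
    using a by (simp add: power2_eq_square algebra_simps)
  have b': "(cmod b)\<^sup>2 = Re b * Re b + Im b * Im b"
    by (simp only: cmod_power2) (simp add: power2_eq_square)
  have eq: "(hadj R ** B) $ k $ l = cnj (\<Sum>q\<in>UNIV. cnj (B $ q $ l) * R $ q $ k)" for l
    by (simp add: matrix_matrix_mult_def mult.commute)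
  have im: "Im (B $ l $ l) = 0" for l
    by (metis H hadj_nth cnj.simps(2) neg_equal_zero)
  define x y where "x = Re (B $ i $ j)" and "y = Im (B $ i $ j)"
  have Bij: "B $ i $ j = Complex x y" "B $ j $ i = Complex x (- y)"
    by (simp_all add: x_def y_def Bji complex_eq_iff)
  have "Re ((hadj R ** B ** R) $ k $ k) = Re (\<Sum>l\<in>UNIV. (hadj R ** B) $ k $ l * R $ l $ k)"
    by (subst matrix_matrix_mult_def) simp
  also have "\<dots> = (if k = i then a * a * Re (B $ i $ i) + (cmod b)\<^sup>2 * Re (B $ j $ j) + 2 * a * Re (b * B $ i $ j)
     else if k = j then a * a * Re (B $ j $ j) + (cmod b)\<^sup>2 * Re (B $ i $ i) - 2 * a * Re (b * B $ i $ j)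
     else Re (B $ k $ k))"
    unfolding eq unfolding R_def sum_plane_rotation[OF assms(1)]
    using assms(1) assms(1)[symmetric]
    by (cases "k = i"; cases "k = j"; simp) (simp_all add: im Bij b' algebra_simps)
  also have "\<dots> = Re (B $ k $ k) + (if k = i then e else if k = j then - e else 0)"
    unfolding a' e_def by (simp add: algebra_simps)
  finally show ?thesis .
qed


theorem hermitian_diagonalisation:
  fixes H :: "complex^'n^'n"
  assumes H: "hadj H = H"
  shows "\<exists>l U. unitary U \<and> H = U ** real_diag l ** hadj U"
proof -
  \<comment> \<open>The weights have to be distinct: a rotation moves an amount from one diagonal
    entry to another, which equal weights would not notice.\<close>
  obtain c :: "'n \<Rightarrow> nat" where c: "inj c"
    using finite_imp_inj_to_nat_seg[OF finite_class.finite_UNIV] by metis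
  \<comment> \<open>At a maximiser of this weighted trace over the compact unitary group, \<open>U\<^sup>* H U\<close> is diagonal,
    since a small rotation in a plane with nonzero off-diagonal entry would increase it.\<close>
  define \<Phi> where "\<Phi> U = (\<Sum>k\<in>UNIV. real (c k) * Re ((hadj U ** H ** U) $ k $ k))" for U :: "complex^'n^'n"
  have "continuous_on {U. unitary U} \<Phi>"
    unfolding \<Phi>_def by (intro continuous_intros)
  then obtain U where U: "unitary U" and max: "\<And>V. unitary V \<Longrightarrow> \<Phi> V \<le> \<Phi> U"
    using continuous_attains_sup[OF compact_unitary, of \<Phi>] unitary_mat_1 by blast
  define B where "B = hadj U ** H ** U"
  have B: "hadj B = B"
    by (simp add: B_def hadj_mult H matrix_mul_assoc)
  have zero: "B $ i $ j = 0" if ij: "c j < c i" for i j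
  proof (rule ccontr)
    assume nz: "B $ i $ j \<noteq> 0"
    have [simp]: "i \<noteq> j" using ij by auto
    define b where "b = cmod (B $ i $ j)"
    define D where "D = Re (B $ j $ j) - Re (B $ i $ i)"
    \<comment> \<open>\<open>x\<close> will be the modulus of the rotation parameter. The gain is
      \<open>x\<close> times this expression, whose limit \<open>2 * b\<close> is positive, so that
      a small \<open>x\<close> gives a positive gain.\<close>
    have "((\<lambda>x. x * D + 2 * sqrt (1 - x\<^sup>2) * b) \<longlongrightarrow> 0 * D + 2 * sqrt (1 - 0\<^sup>2) * b) (at_right 0)"
      by (intro tendsto_intros)
    moreover have "0 * D + 2 * sqrt (1 - 0\<^sup>2) * b > 0"
      using nz by (simp add: b_def)
    ultimately have "\<forall>\<^sub>F x in at_right 0. 0 < x * D + 2 * sqrt (1 - x\<^sup>2) * b"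
      by (rule order_tendstoD(1))
    moreover have "\<forall>\<^sub>F x::real in at_right 0. 0 < x \<and> x < 1"
      by (simp add: eventually_at_right_less eventually_at_right_field eventually_conj_iff gt_ex)
        (metis zero_less_one)
    ultimately obtain x where x: "0 < x" "x < 1" "0 < x * D + 2 * sqrt (1 - x\<^sup>2) * b"
      using eventually_happens[OF eventually_conj] trivial_limit_at_right_real by blast
    \<comment> \<open>The phase of \<open>\<beta>\<close> cancels the phase of the off-diagonal
      entry, which makes the linear part of the gain real and positive.\<close>
    define \<beta> where "\<beta> = of_real x * cnj (B $ i $ j) / of_real b"
    have b0: "b > 0" using nz by (simp add: b_def)
    have \<beta>: "cmod \<beta> = x"
      using x b0 by (simp add: \<beta>_def norm_mult norm_divide) (simp add: b_def)
    have "\<beta> * B $ i $ j = of_real (x * b)"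
    proof -
      have "cnj (B $ i $ j) * B $ i $ j = of_real (b * b)"
        unfolding b_def by (metis complex_norm_square mult.commute power2_eq_square)
      then show ?thesis
        using b0 by (simp add: \<beta>_def divide_simps ac_simps)
    qed
    then have \<beta>B: "Re (\<beta> * B $ i $ j) = x * b" by (metis Re_complex_of_real)
    define a where "a = sqrt (1 - x\<^sup>2)"
    have a: "a\<^sup>2 + (cmod \<beta>)\<^sup>2 = 1"
      using x by (simp add: a_def \<beta> power_le_one)
    let ?R = "plane_rotation i j a \<beta>"
    define e where "e = x\<^sup>2 * D + 2 * a * (x * b)"
    have e: "e > 0"
      using mult_pos_pos[OF x(1,3)] by (simp add: e_def a_def algebra_simps power2_eq_square)
    have diag: "Re ((hadj ?R ** B ** ?R) $ k $ k) = Re (B $ k $ k) + (if k = i then e else if k = j then - e else 0)" for k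
      using plane_rotation_diagonal[OF \<open>i \<noteq> j\<close> B a, of k] unfolding \<beta> \<beta>B e_def D_def by simp
    have "\<Phi> (U ** ?R) = (\<Sum>k\<in>UNIV. real (c k) * Re ((hadj ?R ** B ** ?R) $ k $ k))"
      by (simp add: \<Phi>_def B_def hadj_mult matrix_mul_assoc)
    also have "\<dots> = (\<Sum>k\<in>UNIV. real (c k) * Re (B $ k $ k) +
        ((if k = i then real (c i) * e else 0) + (if k = j then - real (c j) * e else 0)))"
      unfolding diag by (intro sum.cong) (auto simp: algebra_simps)
    also have "\<dots> = \<Phi> U + (real (c i) - real (c j)) * e"
      by (simp add: sum.distrib \<Phi>_def B_def algebra_simps)
    also have "\<dots> > \<Phi> U"
      using e ij by simp
    finally show False
      using max[OF unitary_mult[OF U unitary_plane_rotation[OF \<open>i \<noteq> j\<close> a]]] by simp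
  qed
  \<comment> \<open>Of each pair of mirrored entries only one is covered by \<open>zero\<close>; the
    other is its conjugate.\<close>
  have offdiag: "B $ i $ j = 0" if "i \<noteq> j" for i j
  proof (cases "c j < c i")
    case False
    then have "c i < c j"
      using c that by (metis injD nat_neq_iff)
    then have "B $ j $ i = 0" by (rule zero)
    then show ?thesis by (metis B hadj_nth complex_cnj_zero)
  qed (rule zero)
  have im: "Im (B $ k $ k) = 0" for k
    by (metis B hadj_nth cnj.simps(2) neg_equal_zero)
  have "B = real_diag (\<lambda>k. Re (B $ k $ k))"
    using offdiag im by (simp add: vec_eq_iff real_diag_def complex_eq_iff)
  moreover have "H = U ** B ** hadj U"
  proof -
    have "U ** B ** hadj U = (U ** hadj U) ** H ** (U ** hadj U)"
      by (simp add: B_def matrix_mul_assoc)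
    then show ?thesis using U by (simp add: unitary_def)
  qed
  ultimately show ?thesis
    using U by metis
qed

section \<open>Eigenvalues of Gram matrices\<close>

lemma eigvals_diagonalise:
  fixes H :: "complex^'n^'n"
  assumes "hadj H = H"
  obtains U where "unitary U" "H = U ** real_diag (eigvals H) ** hadj U"
proof -
  have "\<exists>U. unitary U \<and> H = U ** real_diag (eigvals H) ** hadj U"
    unfolding eigvals_def by (rule someI_ex[OF hermitian_diagonalisation[OF assms]])
  then show ?thesis using that by blast
qed

lemma hadj_gram [simp]: "hadj (A ** hadj A) = A ** hadj A"
  by (simp add: hadj_mult)

text \<open>Half of a singular value decomposition: the rows of \<open>hadj U ** A\<close> are
  orthogonal and their squared lengths are the eigenvalues of the Gram matrix. Rectangular matrices
  of any rank are covered.\<close>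

lemma gram_diagonalise:
  fixes A :: "complex^'m^'p"
  obtains U where "unitary U" "(hadj U ** A) ** hadj (hadj U ** A) = real_diag (eigvals (A ** hadj A))"
    "A ** hadj A = U ** real_diag (eigvals (A ** hadj A)) ** hadj U"
proof -
  let ?D = "real_diag (eigvals (A ** hadj A))"
  obtain U where U: "unitary U" "A ** hadj A = U ** ?D ** hadj U"
    using eigvals_diagonalise[OF hadj_gram, of A] .
  have "(hadj U ** A) ** hadj (hadj U ** A) = hadj U ** (A ** hadj A) ** U"
    by (simp add: hadj_mult matrix_mul_assoc)
  also have "\<dots> = (hadj U ** U) ** ?D ** (hadj U ** U)"
    by (subst U(2)) (simp add: matrix_mul_assoc)
  also have "\<dots> = ?D"
    using U(1) by (simp add: unitary_def)
  finally show ?thesis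
    using that U by blast
qed

lemma gram_eigvals_eq:
  fixes B :: "complex^'m^'p"
  assumes "B ** hadj B = real_diag l"
  shows "l i = (\<Sum>j\<in>UNIV. (cmod (B $ i $ j))\<^sup>2)"
proof -
  have "complex_of_real (\<Sum>j\<in>UNIV. (cmod (B $ i $ j))\<^sup>2) = real_diag l $ i $ i"
    using mult_hadj_nth[of B i] assms by simp
  then show ?thesis
    unfolding real_diag_def by (simp del: of_real_sum)
qed

lemma gram_eigvals_nonneg:
  fixes A :: "complex^'m^'p"
  shows "0 \<le> eigvals (A ** hadj A) i"
proof -
  obtain U where "(hadj U ** A) ** hadj (hadj U ** A) = real_diag (eigvals (A ** hadj A))"
    using gram_diagonalise[of A] by blast
  then show ?thesis
    by (subst gram_eigvals_eq) (auto intro: sum_nonneg)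
qed

text \<open>A zero eigenvalue would be the squared length of a row of \<open>hadj U ** A\<close>,
  and a zero row contradicts the nonzero determinant.\<close>

lemma gram_eigvals_pos:
  fixes A :: "complex^'n^'n"
  assumes "det A \<noteq> 0"
  shows "0 < eigvals (A ** hadj A) i"
proof -
  obtain U where U: "unitary U" "(hadj U ** A) ** hadj (hadj U ** A) = real_diag (eigvals (A ** hadj A))"
    using gram_diagonalise[of A] by blast
  have "det (hadj U) * det U = 1"
    using U(1) by (metis unitary_def det_mul det_I)
  then have "det (hadj U ** A) \<noteq> 0"
    using assms by (auto simp: det_mul)
  then have "row i (hadj U ** A) \<noteq> 0"
    using det_zero_row by blast
  then obtain j where j: "(hadj U ** A) $ i $ j \<noteq> 0"
    by (auto simp: row_def vec_eq_iff)
  have "(\<Sum>j\<in>UNIV. (cmod ((hadj U ** A) $ i $ j))\<^sup>2) > 0"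
    by (rule sum_pos2[of _ j]) (use j in auto)
  then show ?thesis
    by (subst gram_eigvals_eq[OF U(2)])
qed

lemma norm_matrix_sq_gram:
  fixes A :: "complex^'m^'p"
  shows "(norm A)\<^sup>2 = (\<Sum>i\<in>UNIV. Re ((A ** hadj A) $ i $ i))"
  by (simp add: norm_matrix_sq mult_hadj_nth del: of_real_sum)

lemma norm_hadj: "norm (hadj A) = norm (A :: complex^'m^'p)"
proof -
  have "(norm (hadj A))\<^sup>2 = (norm A)\<^sup>2"
    unfolding norm_matrix_sq by (subst sum.swap) simp
  then show ?thesis by simp
qed

lemma norm_unitary_mult:
  fixes A :: "complex^'m^'n"
  assumes "unitary U"
  shows "norm (U ** A) = norm A"
proof -
  have "hadj (U ** A) ** hadj (hadj (U ** A)) = hadj A ** (hadj U ** U) ** A"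
    by (simp add: hadj_mult matrix_mul_assoc)
  then have "(norm (hadj (U ** A)))\<^sup>2 = (norm (hadj A))\<^sup>2"
    using assms unfolding norm_matrix_sq_gram by (simp add: unitary_def)
  then show ?thesis by (simp add: norm_hadj)
qed

section \<open>Trace inequalities\<close>

lemma hadj_real_diag [simp]: "hadj (real_diag l) = real_diag l"
  by (simp add: vec_eq_iff real_diag_def)

lemma mult_real_diag_nth:
  fixes B :: "complex^'n^'p"
  shows "(B ** real_diag l) $ i $ j = B $ i $ j * of_real (l j)"
  by (simp add: matrix_matrix_mult_def real_diag_def if_distrib[of "(*) _"] cong: if_cong)

lemma real_diag_mult: "real_diag a ** real_diag b = real_diag (\<lambda>i. a i * b i)"
  by (simp add: vec_eq_iff mult_real_diag_nth) (simp add: real_diag_def)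

lemma congruence_real_diag_nth:
  fixes B :: "complex^'n^'p"
  shows "(B ** real_diag l ** hadj B) $ i $ i = of_real (\<Sum>j\<in>UNIV. (cmod (B $ i $ j))\<^sup>2 * l j)"
proof -
  have "(B ** real_diag l ** hadj B) $ i $ i = (\<Sum>j\<in>UNIV. (B ** real_diag l) $ i $ j * cnj (B $ i $ j))"
    by (subst matrix_matrix_mult_def) simp
  also have "\<dots> = (\<Sum>j\<in>UNIV. (B $ i $ j * cnj (B $ i $ j)) * of_real (l j))"
    by (simp add: mult_real_diag_nth mult_ac)
  finally show ?thesis
    by (simp flip: complex_norm_square)
qed

text \<open>In the basis \<open>V\<close> the diagonal entries of the Gram matrix are averages of
  its eigenvalues, with the squared moduli of the entries of the unitary \<open>W\<close> as
  weights. Jensen's inequality uses that each row of weights has sum 1, the summation over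
  \<open>i\<close> that each column has.\<close>

lemma peierls:
  fixes A :: "complex^'m^'n" and \<psi> :: "real \<Rightarrow> real"
  assumes "convex_on {0<..} \<psi>" "unitary V" and pos: "\<And>i. 0 < eigvals (A ** hadj A) i"
  shows "(\<Sum>i\<in>UNIV. \<psi> (\<Sum>j\<in>UNIV. (cmod ((hadj V ** A) $ i $ j))\<^sup>2)) \<le> (\<Sum>i\<in>UNIV. \<psi> (eigvals (A ** hadj A) i))"
proof -
  define l where "l = eigvals (A ** hadj A)"
  obtain U where U: "unitary U" "A ** hadj A = U ** real_diag l ** hadj U"
    using gram_diagonalise[of A] unfolding l_def by metis
  define W where "W = hadj V ** U"
  have W: "unitary W"
    using assms(2) U(1) by (simp add: W_def unitary_mult unitary_hadj)
  have "(hadj V ** A) ** hadj (hadj V ** A) = hadj V ** (A ** hadj A) ** V"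
    by (simp add: hadj_mult matrix_mul_assoc)
  also have "\<dots> = W ** real_diag l ** hadj W"
    unfolding U(2) by (simp add: W_def hadj_mult matrix_mul_assoc)
  finally have eq: "(\<Sum>j\<in>UNIV. (cmod ((hadj V ** A) $ i $ j))\<^sup>2) = (\<Sum>j\<in>UNIV. (cmod (W $ i $ j))\<^sup>2 * l j)" for i
    using mult_hadj_nth[of "hadj V ** A" i] congruence_real_diag_nth[of W l i]
    by (simp del: of_real_sum)
  have "(\<Sum>i\<in>UNIV. \<psi> (\<Sum>j\<in>UNIV. (cmod (W $ i $ j))\<^sup>2 * l j)) \<le> (\<Sum>i\<in>UNIV. \<Sum>j\<in>UNIV. (cmod (W $ i $ j))\<^sup>2 * \<psi> (l j))"
    using convex_on_sum[OF finite_class.finite_UNIV _ assms(1) unitary_row_sum[OF W], where y = l] pos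
    by (intro sum_mono) (simp add: l_def)
  also have "\<dots> = (\<Sum>j\<in>UNIV. (\<Sum>i\<in>UNIV. (cmod (W $ i $ j))\<^sup>2) * \<psi> (l j))"
    by (subst sum.swap) (simp add: sum_distrib_right)
  finally show ?thesis
    unfolding eq by (simp add: unitary_column_sum[OF W] l_def)
qed

lemma continuous_det: "continuous_on S (det :: complex^'n^'n \<Rightarrow> complex)"
  unfolding det_def by (intro continuous_intros)

text \<open>Being a supremum of continuous functions by Peierls' inequality, the trace is lower
  semicontinuous.\<close>

lemma borel_measurable_trace_gram:
  fixes \<psi> :: "real \<Rightarrow> real"
  assumes cvx: "convex_on {0<..} \<psi>"
  shows "(\<lambda>A :: complex^'n^'n. if det A \<noteq> 0 then \<Sum>i\<in>UNIV. \<psi> (eigvals (A ** hadj A) i) else 0)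
    \<in> borel_measurable borel"
proof -
  define T where "T A = (\<Sum>i\<in>UNIV. \<psi> (eigvals (A ** hadj A) i))" for A :: "complex^'n^'n"
  have cont: "continuous_on {0<..} \<psi>"
    by (rule convex_on_continuous[OF _ cvx]) simp
  have det_open: "open {A :: complex^'n^'n. det A \<noteq> 0}"
    by (intro open_Collect_neq continuous_det continuous_on_const)
  have "open {A. det A \<noteq> 0 \<and> c < T A}" for c
    unfolding open_contains_ball
  proof clarify
    fix A :: "complex^'n^'n" assume A: "det A \<noteq> 0" "c < T A"
    obtain V where V: "unitary V" "(hadj V ** A) ** hadj (hadj V ** A) = real_diag (eigvals (A ** hadj A))"
      using gram_diagonalise[of A] by metis
    \<comment> \<open>\<open>V\<close> diagonalises the Gram matrix of the given \<open>A\<close>.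
      Hence the lower bound by Peierls' inequality, which is continuous in \<open>B\<close>, is an
      equality at \<open>A\<close>.\<close>
    define q where "q i B = (\<Sum>j\<in>UNIV. (cmod ((hadj V ** B) $ i $ j))\<^sup>2)" for i and B :: "complex^'n^'n"
    have qA: "q i A = eigvals (A ** hadj A) i" for i
      using gram_eigvals_eq[OF V(2)] by (simp add: q_def)
    have "isCont (q i) A" for i
    proof -
      have "continuous_on UNIV (q i)"
        unfolding q_def by (intro continuous_intros)
      then show ?thesis by (simp add: continuous_on_eq_continuous_at)
    qed
    then have "(q i \<longlongrightarrow> q i A) (at A)" for i
      by (simp add: isCont_def)
    moreover have "isCont \<psi> (q i A)" for i
      using cont gram_eigvals_pos[OF A(1), of i] unfolding qA
      by (simp add: continuous_on_eq_continuous_at)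
    ultimately have "((\<lambda>B. \<psi> (q i B)) \<longlongrightarrow> \<psi> (q i A)) (at A)" for i
      by (rule isCont_tendsto_compose[rotated])
    then have "((\<lambda>B. \<Sum>i\<in>UNIV. \<psi> (q i B)) \<longlongrightarrow> (\<Sum>i\<in>UNIV. \<psi> (q i A))) (at A)"
      by (intro tendsto_sum)
    moreover have "c < (\<Sum>i\<in>UNIV. \<psi> (q i A))"
      using A(2) by (simp add: T_def qA)
    ultimately have "\<forall>\<^sub>F B in at A. c < (\<Sum>i\<in>UNIV. \<psi> (q i B))"
      by (rule order_tendstoD)
    moreover have "\<forall>\<^sub>F B in at A. det B \<noteq> 0"
      using eventually_at_topological det_open A(1) by blast
    ultimately have "\<forall>\<^sub>F B in at A. det B \<noteq> 0 \<and> c < T B"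
    proof eventually_elim
      case (elim B)
      have "(\<Sum>i\<in>UNIV. \<psi> (q i B)) \<le> T B"
        unfolding q_def T_def by (intro peierls cvx V(1) gram_eigvals_pos elim)
      then show ?case using elim by simp
    qed
    then obtain e where e: "e > 0" "\<And>B. B \<noteq> A \<Longrightarrow> dist B A < e \<Longrightarrow> det B \<noteq> 0 \<and> c < T B"
      unfolding eventually_at by blast
    then have "B \<in> {A. det A \<noteq> 0 \<and> c < T A}" if "B \<in> ball A e" for B
      using A that by (cases "B = A") (auto simp: dist_commute)
    then show "\<exists>e>0. ball A e \<subseteq> {A. det A \<noteq> 0 \<and> c < T A}"
      using e by blast
  qed
  then have *: "{A. det A \<noteq> 0 \<and> c < T A} \<in> sets borel" for c
    by simp
  have det0: "{A :: complex^'n^'n. det A = 0} \<in> sets borel"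
    by (intro borel_closed closed_Collect_eq continuous_det continuous_on_const)
  \<comment> \<open>On singular matrices the function is 0, so they all lie in the superlevel set
    exactly when \<open>c\<close> is negative.\<close>
  have "{A. c < (if det A \<noteq> 0 then T A else 0)} =
      {A. det A \<noteq> 0 \<and> c < T A} \<union> (if c < 0 then {A. det A = 0} else {})" for c
    by auto
  then have "{A. c < (if det A \<noteq> 0 then T A else 0)} \<in> sets borel" for c
    using * det0 by auto
  then show ?thesis
    unfolding borel_measurable_iff_greater T_def by simp
qed

text \<open>The rows of \<open>B\<close> divided by their norms are orthonormal, so that the columns of the matrix of
  weights \<open>|B\<^sub>i\<^sub>j|\<^sup>2 / \<mu>\<^sub>i\<close> have sums at most \<open>1\<close> by Bessel's inequality; \<open>P\<close> is the orthogonal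
  projection onto the row space.\<close>

lemma orthogonal_rows_weighted_sum:
  fixes B :: "complex^'m^'p" and \<mu> r :: "'p \<Rightarrow> real" and l p :: "'m \<Rightarrow> real"
  assumes B: "B ** hadj B = real_diag \<mu>"
    and r: "\<And>i. 0 \<le> r i" and p: "\<And>j. 0 \<le> p j" and le: "\<And>i j. \<mu> i * l j \<le> p j + r i"
  shows "(\<Sum>i\<in>UNIV. \<Sum>j\<in>UNIV. (cmod (B $ i $ j))\<^sup>2 * l j) \<le> (\<Sum>j\<in>UNIV. p j) + (\<Sum>i\<in>UNIV. r i)"
proof -
  have \<mu>: "\<mu> i = (\<Sum>j\<in>UNIV. (cmod (B $ i $ j))\<^sup>2)" for i
    using gram_eigvals_eq[OF B] .
  have \<mu>0: "0 \<le> \<mu> i" for i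
    by (simp add: \<mu> sum_nonneg)
  \<comment> \<open>If \<open>\<mu> i = 0\<close>, the row \<open>i\<close> of \<open>B\<close>
    vanishes and division by zero gives the weight 0, so the factorisation \<open>w\<close> below
    holds in this case too.\<close>
  define w where "w i j = (cmod (B $ i $ j))\<^sup>2 / \<mu> i" for i j
  have w0: "0 \<le> w i j" for i j
    by (simp add: w_def \<mu>0)
  have w: "(cmod (B $ i $ j))\<^sup>2 = w i j * \<mu> i" for i j
  proof (cases "\<mu> i = 0")
    case True
    then have "(cmod (B $ i $ j))\<^sup>2 = 0"
      unfolding \<mu> by (subst (asm) sum_nonneg_eq_0_iff) auto
    then show ?thesis by (simp add: True)
  qed (simp add: w_def)
  have row: "(\<Sum>j\<in>UNIV. w i j) \<le> 1" for i
    by (simp add: w_def flip: sum_divide_distrib \<mu>)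
  \<comment> \<open>As 1 / 0 = 0, the diagonal factor is the pseudo-inverse of
    \<open>B ** hadj B\<close>, and \<open>P\<close> is idempotent even if some rows of
    \<open>B\<close> are zero.\<close>
  define P where "P = hadj B ** real_diag (\<lambda>i. 1 / \<mu> i) ** B"
  have hP: "hadj P = P"
    by (simp add: P_def hadj_mult matrix_mul_assoc)
  have "P ** hadj P = hadj B ** (real_diag (\<lambda>i. 1 / \<mu> i) ** (B ** hadj B) ** real_diag (\<lambda>i. 1 / \<mu> i)) ** B"
    unfolding hP by (simp add: P_def matrix_mul_assoc)
  also have "\<dots> = P"
    unfolding B real_diag_mult P_def
    by (intro arg_cong[where f = "\<lambda>D. hadj B ** real_diag D ** B"]) auto
  finally have PP: "P ** hadj P = P" .
  have Pjj: "P $ j $ j = of_real (\<Sum>i\<in>UNIV. w i j)" for j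
    using congruence_real_diag_nth[of "hadj B" "\<lambda>i. 1 / \<mu> i" j] by (simp add: P_def w_def)
  have col: "(\<Sum>i\<in>UNIV. w i j) \<le> 1" for j
  proof -
    let ?s = "\<Sum>i\<in>UNIV. w i j"
    \<comment> \<open>A diagonal entry of a Hermitian idempotent is the squared length of its row.
      It is therefore at least its own square, hence at most 1.\<close>
    have "?s = (\<Sum>k\<in>UNIV. (cmod (P $ j $ k))\<^sup>2)"
      using mult_hadj_nth[of P j] unfolding PP Pjj of_real_eq_iff .
    also have "\<dots> \<ge> (cmod (P $ j $ j))\<^sup>2"
      by (rule member_le_sum) auto
    finally have "?s\<^sup>2 \<le> ?s"
      unfolding Pjj norm_of_real by simp
    then show ?thesis
      using mult_strict_right_mono[of 1 ?s ?s] by (auto simp: power2_eq_square not_le[symmetric])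
  qed
  have "(\<Sum>i\<in>UNIV. \<Sum>j\<in>UNIV. (cmod (B $ i $ j))\<^sup>2 * l j) \<le> (\<Sum>i\<in>UNIV. \<Sum>j\<in>UNIV. w i j * (p j + r i))"
    unfolding w mult.assoc by (intro sum_mono mult_left_mono w0 le)
  also have "\<dots> = (\<Sum>i\<in>UNIV. \<Sum>j\<in>UNIV. w i j * p j) + (\<Sum>i\<in>UNIV. \<Sum>j\<in>UNIV. w i j * r i)"
    by (simp add: distrib_left sum.distrib)
  also have "(\<Sum>i\<in>UNIV. \<Sum>j\<in>UNIV. w i j * p j) = (\<Sum>j\<in>UNIV. (\<Sum>i\<in>UNIV. w i j) * p j)"
    by (subst sum.swap) (simp add: sum_distrib_right)
  also have "\<dots> \<le> (\<Sum>j\<in>UNIV. 1 * p j)"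
    by (intro sum_mono mult_right_mono col p)
  also have "(\<Sum>i\<in>UNIV. \<Sum>j\<in>UNIV. w i j * r i) = (\<Sum>i\<in>UNIV. (\<Sum>j\<in>UNIV. w i j) * r i)"
    by (simp add: sum_distrib_right)
  also have "\<dots> \<le> (\<Sum>i\<in>UNIV. 1 * r i)"
    by (intro sum_mono mult_right_mono row r)
  finally show ?thesis by simp
qed

text \<open>No commutation between the two Gram matrices is involved: Young's inequality is applied
  to each pair of eigenvalues. An eigenvalue outside the domain of \<open>\<phi>\<close> makes the
  right-hand side infinite, so that one may calculate with real numbers otherwise.\<close>

lemma norm_mult_sq_le_trace_fun:
  fixes A :: "complex^'n^'p" and G :: "complex^'n^'n" and \<psi> :: "real \<Rightarrow> real"
  assumes G: "det G \<noteq> 0"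
    and \<psi>: "\<And>x. 0 < x \<Longrightarrow> 0 \<le> \<psi> x" and \<phi>: "\<And>z. 0 \<le> z \<Longrightarrow> 0 \<le> \<phi> z"
    and young: "\<And>x z. 0 < x \<Longrightarrow> 0 \<le> z \<Longrightarrow> ereal (z * x) \<le> ereal (\<psi> x) + \<phi> z"
  shows "ereal ((norm (A ** G))\<^sup>2) \<le>
    trace_fun (\<lambda>x. ereal (\<psi> x)) (G ** hadj G) + trace_fun \<phi> (A ** hadj A)"
proof -
  define l where "l = eigvals (G ** hadj G)"
  define \<mu> where "\<mu> = eigvals (A ** hadj A)"
  have l: "0 < l j" for j
    by (simp add: l_def gram_eigvals_pos G)
  have \<mu>: "0 \<le> \<mu> i" for i
    by (simp add: \<mu>_def gram_eigvals_nonneg)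
  have tr\<psi>: "trace_fun (\<lambda>x. ereal (\<psi> x)) (G ** hadj G) = ereal (\<Sum>j\<in>UNIV. \<psi> (l j))"
    by (simp add: trace_fun_def l_def)
  show ?thesis
  proof (cases "\<exists>i. \<phi> (\<mu> i) = \<infinity>")
    case True
    then have "trace_fun \<phi> (A ** hadj A) = \<infinity>"
      by (auto simp: trace_fun_def sum_Pinfty \<mu>_def)
    then show ?thesis by (simp add: tr\<psi>)
  next
    case False
    define r where "r i = real_of_ereal (\<phi> (\<mu> i))" for i
    have r: "\<phi> (\<mu> i) = ereal (r i)" for i
      using False \<phi>[OF \<mu>[of i]] unfolding r_def by (cases "\<phi> (\<mu> i)") auto
    have r0: "0 \<le> r i" for i
      using \<phi>[OF \<mu>[of i]] by (simp add: r)
    obtain Q where Q: "unitary Q" "G ** hadj G = Q ** real_diag l ** hadj Q"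
      using gram_diagonalise[of G] unfolding l_def by metis
    obtain U where U: "unitary U" "(hadj U ** A) ** hadj (hadj U ** A) = real_diag \<mu>"
      using gram_diagonalise[of A] unfolding \<mu>_def by metis
    \<comment> \<open>The unitary \<open>Q\<close> on the right leaves the Gram matrix of
      \<open>hadj U ** A\<close> unchanged, so the rows stay orthogonal, and it makes the middle
      factor \<open>G ** hadj G\<close> diagonal.\<close>
    define B where "B = hadj U ** A ** Q"
    have "B ** hadj B = hadj U ** A ** (Q ** hadj Q) ** hadj (hadj U ** A)"
      by (simp add: B_def hadj_mult matrix_mul_assoc)
    then have B: "B ** hadj B = real_diag \<mu>"
      using Q(1) U(2) by (simp add: unitary_def)
    have "(hadj U ** (A ** G)) ** hadj (hadj U ** (A ** G)) = hadj U ** A ** (G ** hadj G) ** hadj (hadj U ** A)"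
      by (simp add: hadj_mult matrix_mul_assoc)
    also have "\<dots> = B ** real_diag l ** hadj B"
      unfolding Q(2) by (simp add: B_def hadj_mult matrix_mul_assoc)
    finally have "(norm (hadj U ** (A ** G)))\<^sup>2 = (\<Sum>i\<in>UNIV. \<Sum>j\<in>UNIV. (cmod (B $ i $ j))\<^sup>2 * l j)"
      by (simp add: norm_matrix_sq_gram congruence_real_diag_nth del: of_real_sum)
    also have "\<dots> \<le> (\<Sum>j\<in>UNIV. \<psi> (l j)) + (\<Sum>i\<in>UNIV. r i)"
      using young[OF l \<mu>] by (intro orthogonal_rows_weighted_sum[OF B r0] \<psi> l) (simp add: r)
    finally have "(norm (A ** G))\<^sup>2 \<le> (\<Sum>j\<in>UNIV. \<psi> (l j)) + (\<Sum>i\<in>UNIV. r i)"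
      unfolding norm_unitary_mult[OF unitary_hadj[OF U(1)]] .
    moreover have "trace_fun \<phi> (A ** hadj A) = ereal (\<Sum>i\<in>UNIV. r i)"
      by (simp add: trace_fun_def r flip: \<mu>_def)
    ultimately show ?thesis
      by (simp add: tr\<psi>)
  qed
qed

section \<open>Convex conjugates\<close>

lemma analytic_imp_real_derivative:
  assumes "\<Phi> analytic_on complex_of_real ` {0<..}" "0 < x"
  shows "((\<lambda>t. Re (\<Phi> (of_real t))) has_real_derivative Re (deriv \<Phi> (of_real x))) (at x)"
proof -
  have "(\<Phi> has_field_derivative deriv \<Phi> (of_real x)) (at (of_real x))"
    using assms by (auto intro!: analytic_on_imp_differentiable_at[THEN field_differentiable_derivI])
  then have "((\<lambda>t. \<Phi> (of_real t)) has_vector_derivative deriv \<Phi> (of_real x)) (at x)"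
    using has_vector_derivative_real_field by blast
  then show ?thesis
    unfolding has_real_derivative_iff_has_vector_derivative
    by (rule bounded_linear.has_vector_derivative[OF bounded_linear_Re])
qed

text \<open>On the positive axis the real derivatives of \<open>\<psi>\<close> are the real parts of
  the complex derivatives of its extension. This turns the values \<open>deriv\<close> into genuine
  derivatives of first and second order, as the convexity criterion requires.\<close>

lemma analytic_psi_convex:
  fixes \<psi> :: "real \<Rightarrow> real"
  assumes \<Psi>: "\<Psi> analytic_on complex_of_real ` {0<..}"
    and eq: "\<And>x. 0 < x \<Longrightarrow> \<Psi> (complex_of_real x) = complex_of_real (\<psi> x)"
    and pos: "\<And>x. 0 < x \<Longrightarrow> 0 < deriv (deriv \<psi>) x"
  shows "convex_on {0<..} \<psi>"
    and "\<And>x. 0 < x \<Longrightarrow> (\<psi> has_real_derivative deriv \<psi> x) (at x)"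
proof -
  have *: "(g has_real_derivative Re (deriv \<Phi> (of_real x))) (at x)"
    if "0 < x" "\<Phi> analytic_on complex_of_real ` {0<..}" "\<And>t. 0 < t \<Longrightarrow> g t = Re (\<Phi> (of_real t))" for g \<Phi> x
    using that by (intro has_field_derivative_transform_within_open[OF analytic_imp_real_derivative, of \<Phi> x "{0<..}"]) auto
  have 1: "(\<psi> has_real_derivative Re (deriv \<Psi> (of_real x))) (at x)" if "0 < x" for x
    using that by (intro * \<Psi>) (auto simp: eq)
  then have d1: "deriv \<psi> x = Re (deriv \<Psi> (of_real x))" if "0 < x" for x
    using that by (auto intro: DERIV_imp_deriv)
  show D1: "(\<psi> has_real_derivative deriv \<psi> x) (at x)" if "0 < x" for x
    using 1[OF that] by (simp add: d1 that)
  have 2: "(deriv \<psi> has_real_derivative Re (deriv (deriv \<Psi>) (of_real x))) (at x)" if "0 < x" for x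
    using that by (intro * analytic_deriv \<Psi>) (auto simp: d1)
  then have D2: "(deriv \<psi> has_real_derivative deriv (deriv \<psi>) x) (at x)" if "0 < x" for x
    using that by (metis DERIV_imp_deriv)
  show "convex_on {0<..} \<psi>"
    by (rule f''_ge0_imp_convex[where f' = "deriv \<psi>" and f'' = "deriv (deriv \<psi>)"])
      (use D1 D2 pos in \<open>auto intro: less_imp_le\<close>)
qed

text \<open>The convex function \<open>\<psi>\<close> lies above its tangent of slope
  \<open>z\<close>, and the intercept of this tangent is the negative of the conjugate at
  \<open>z\<close>. If no tangent has slope \<open>z\<close>, the right-hand side is
  infinite.\<close>

lemma convex_conj_young:
  assumes "convex_on {0<..} \<psi>" "\<And>x. 0 < x \<Longrightarrow> (\<psi> has_real_derivative deriv \<psi> x) (at x)" "0 < x"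
  shows "ereal (z * x) \<le> ereal (\<psi> x) + convex_conj \<psi> z"
proof (cases "z \<in> deriv \<psi> ` {0<..}")
  case True
  define v where "v = inv_into {0<..} (deriv \<psi>) z"
  have "v \<in> {0<..}"
    unfolding v_def by (rule inv_into_into[OF True])
  moreover have "deriv \<psi> v = z"
    unfolding v_def by (rule f_inv_into_f[OF True])
  ultimately have v: "0 < v" "deriv \<psi> v = z"
    by simp_all
  have "\<psi> x - \<psi> v \<ge> z * (x - v)"
  proof (rule convex_on_imp_above_tangent[OF assms(1)])
    show "(\<psi> has_real_derivative z) (at v within {0<..})"
      using assms(2)[OF v(1)] unfolding v(2) by (rule has_field_derivative_at_within)
  qed (use v assms(3) in \<open>simp_all add: interior_open\<close>)
  then show ?thesis
    using True by (simp add: convex_conj_def Let_def algebra_simps flip: v_def)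
qed (simp add: convex_conj_def)

text \<open>Young's inequality at a point \<open>x\<close> with \<open>\<psi> x < e\<close> bounds
  the conjugate below by \<open>- e\<close>, since \<open>z * x\<close> is nonnegative.\<close>

lemma convex_conj_nonneg:
  assumes "convex_on {0<..} \<psi>" "\<And>x. 0 < x \<Longrightarrow> (\<psi> has_real_derivative deriv \<psi> x) (at x)"
    and inf: "\<And>e. 0 < e \<Longrightarrow> \<exists>x>0. \<psi> x < e" and "0 \<le> z"
  shows "0 \<le> convex_conj \<psi> z"
proof (cases "convex_conj \<psi> z")
  case (real c)
  have "0 \<le> c + e" if "e > 0" for e
  proof -
    obtain x where x: "0 < x" "\<psi> x < e" using inf[OF \<open>e > 0\<close>] by blast
    have "z * x \<le> \<psi> x + c"
      using convex_conj_young[OF assms(1,2) x(1), of z] by (simp add: real)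
    moreover have "0 \<le> z * x" using x \<open>0 \<le> z\<close> by simp
    ultimately show ?thesis using x by linarith
  qed
  then show ?thesis
    unfolding real ereal_less_eq(5) by (rule field_le_epsilon)
qed (auto simp: convex_conj_def Let_def split: if_splits)

section \<open>Integrals of traces\<close>

text \<open>For a function \<open>b\<close> which is not known to be measurable, the integral is a lower integral. This
  avoids a proof that the trace of the convex conjugate is measurable.\<close>

lemma nn_integral_le_add_nonmeasurable:
  fixes a :: "'a \<Rightarrow> real"
  assumes [measurable]: "h \<in> borel_measurable M" "a \<in> borel_measurable M"
    and le: "AE x in M. h x \<le> ennreal (a x) + b x"
  shows "(\<integral>\<^sup>+x. h x \<partial>M) \<le> (\<integral>\<^sup>+x. ennreal (a x) \<partial>M) + (\<integral>\<^sup>+x. b x \<partial>M)"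
proof -
  \<comment> \<open>The truncated difference \<open>h x - ennreal (a x)\<close> is measurable and
    lies below \<open>b\<close>, so that \<open>b\<close> enters only through monotonicity, which
    holds for arbitrary functions.\<close>
  have "(\<integral>\<^sup>+x. h x \<partial>M) \<le> (\<integral>\<^sup>+x. ennreal (a x) + (h x - ennreal (a x)) \<partial>M)"
    by (intro nn_integral_mono) (metis ennreal_minus_le_iff order_refl)
  also have "\<dots> = (\<integral>\<^sup>+x. ennreal (a x) \<partial>M) + (\<integral>\<^sup>+x. h x - ennreal (a x) \<partial>M)"
    by (intro nn_integral_add) auto
  also have "(\<integral>\<^sup>+x. h x - ennreal (a x) \<partial>M) \<le> (\<integral>\<^sup>+x. b x \<partial>M)"
    using le by (intro nn_integral_mono_AE) (auto simp: ennreal_minus_le_iff)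
  finally show ?thesis by (simp add: add_left_mono)
qed

text \<open>The negative part has integral 0, so no difference of infinities arises.\<close>

lemma cov_functional_nonneg_eq:
  assumes "AE \<omega> in lborel. 0 \<le> trace_fun \<phi> (Fhat \<omega> ** hadj (Fhat \<omega>))"
  shows "cov_functional \<phi> Fhat = ereal (1 / (2 * pi)) *
    enn2ereal (\<integral>\<^sup>+\<omega>. e2ennreal (trace_fun \<phi> (Fhat \<omega> ** hadj (Fhat \<omega>))) \<partial>lborel)"
proof -
  have "(\<integral>\<^sup>+\<omega>. e2ennreal (- trace_fun \<phi> (Fhat \<omega> ** hadj (Fhat \<omega>))) \<partial>lborel) = (\<integral>\<^sup>+\<omega>. 0 \<partial>(lborel :: real measure))"
    using assms by (intro nn_integral_cong_AE) (auto simp: e2ennreal_neg)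
  then show ?thesis
    unfolding cov_functional_def ereal_integral_def by (simp add: zero_ennreal.rep_eq)
qed

section \<open>Mean square limits\<close>

text \<open>A triangle inequality for squared norms, by the inequality of means for
  \<open>sqrt \<delta> * a\<close> and \<open>b / sqrt \<delta>\<close>. The factor of the main term
  can be brought arbitrarily close to 1 at the expense of the factor of the error term.\<close>

lemma norm_sq_le_weighted:
  fixes x y :: "'b::real_normed_vector"
  assumes "0 < \<delta>"
  shows "(norm x)\<^sup>2 \<le> (1 + \<delta>) * (norm y)\<^sup>2 + (1 + 1 / \<delta>) * (norm (x - y))\<^sup>2"
proof -
  define a b where "a = norm y" and "b = norm (x - y)"
  have "0 \<le> (sqrt \<delta> * a - b / sqrt \<delta>)\<^sup>2" by simp
  also have "\<dots> = \<delta> * a\<^sup>2 + b\<^sup>2 / \<delta> - 2 * (a * b)"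
    using assms by (simp add: power2_diff power_mult_distrib power_divide)
  finally have ab: "2 * (a * b) \<le> \<delta> * a\<^sup>2 + b\<^sup>2 / \<delta>" by simp
  have "norm x \<le> a + b"
    unfolding a_def b_def using norm_triangle_sub[of x y] by simp
  then have "(norm x)\<^sup>2 \<le> (a + b)\<^sup>2"
    by (intro power_mono) auto
  also have "\<dots> \<le> (1 + \<delta>) * a\<^sup>2 + (1 + 1 / \<delta>) * b\<^sup>2"
    using ab by (simp add: power2_sum algebra_simps)
  finally show ?thesis by (simp add: a_def b_def)
qed

lemma nn_integral_norm_sq_le_weighted:
  fixes X Y :: "'a \<Rightarrow> 'b::{real_normed_vector, second_countable_topology}"
  assumes [measurable]: "X \<in> borel_measurable M" "Y \<in> borel_measurable M" and "0 < \<delta>"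
  shows "(\<integral>\<^sup>+x. ennreal ((norm (X x))\<^sup>2) \<partial>M) \<le>
    ennreal (1 + \<delta>) * (\<integral>\<^sup>+x. ennreal ((norm (Y x))\<^sup>2) \<partial>M) +
    ennreal (1 + 1 / \<delta>) * (\<integral>\<^sup>+x. ennreal ((norm (X x - Y x))\<^sup>2) \<partial>M)"
proof -
  have "(\<integral>\<^sup>+x. ennreal ((norm (X x))\<^sup>2) \<partial>M) \<le>
    (\<integral>\<^sup>+x. ennreal (1 + \<delta>) * ennreal ((norm (Y x))\<^sup>2) + ennreal (1 + 1 / \<delta>) * ennreal ((norm (X x - Y x))\<^sup>2) \<partial>M)"
    using norm_sq_le_weighted[OF \<open>0 < \<delta>\<close>] \<open>0 < \<delta>\<close>
    by (intro nn_integral_mono) (simp flip: ennreal_mult ennreal_plus add: ennreal_leI)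
  then show ?thesis
    by (simp add: nn_integral_add nn_integral_cmult)
qed

lemma nn_integral_norm_sq_minus_commute:
  fixes X Y :: "'a \<Rightarrow> 'b::real_normed_vector"
  shows "(\<integral>\<^sup>+x. ennreal ((norm (X x - Y x))\<^sup>2) \<partial>M) = (\<integral>\<^sup>+x. ennreal ((norm (Y x - X x))\<^sup>2) \<partial>M)"
  by (simp add: norm_minus_commute)

text \<open>For fixed \<delta> the errors, whose factors contain \<open>1 + 1 / \<delta>\<close>,
  vanish as \<open>n\<close> grows; afterwards \<delta> tends to 0. \<open>X\<close> and
  \<open>Y\<close> live on different measure spaces, so that the lemma serves both for stochastic
  integrals compared with kernels and for functions compared with their transforms.\<close>

lemma mean_square_limit_le:
  fixes X :: "'a \<Rightarrow> 'b::{real_normed_vector, second_countable_topology}"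
    and Y :: "'c \<Rightarrow> 'd::{real_normed_vector, second_countable_topology}"
  assumes [measurable]: "X \<in> borel_measurable M" "Y \<in> borel_measurable N"
      "\<And>n. X' n \<in> borel_measurable M" "\<And>n. Y' n \<in> borel_measurable N"
    and X: "(\<lambda>n. \<integral>\<^sup>+x. ennreal ((norm (X' n x - X x))\<^sup>2) \<partial>M) \<longlonglongrightarrow> 0"
    and Y: "(\<lambda>n. \<integral>\<^sup>+x. ennreal ((norm (Y' n x - Y x))\<^sup>2) \<partial>N) \<longlonglongrightarrow> 0"
    and le: "\<And>n. (\<integral>\<^sup>+x. ennreal ((norm (X' n x))\<^sup>2) \<partial>M) \<le> ennreal c * (\<integral>\<^sup>+x. ennreal ((norm (Y' n x))\<^sup>2) \<partial>N)"
    and "0 < c"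
  shows "(\<integral>\<^sup>+x. ennreal ((norm (X x))\<^sup>2) \<partial>M) \<le> ennreal c * (\<integral>\<^sup>+x. ennreal ((norm (Y x))\<^sup>2) \<partial>N)"
proof (cases "(\<integral>\<^sup>+x. ennreal ((norm (Y x))\<^sup>2) \<partial>N) = \<top>")
  case True
  then show ?thesis using \<open>0 < c\<close> by (simp add: ennreal_mult_top)
next
  case False
  define I where "I = (\<integral>\<^sup>+x. ennreal ((norm (Y x))\<^sup>2) \<partial>N)"
  have I: "I < \<top>" using False by (simp add: I_def less_top)
  have \<delta>: "(\<integral>\<^sup>+x. ennreal ((norm (X x))\<^sup>2) \<partial>M) \<le> ennreal (1 + \<delta>) * (ennreal c * (ennreal (1 + \<delta>) * I))"
    if "0 < \<delta>" for \<delta>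
  proof (rule LIMSEQ_le_const)
    let ?a = "ennreal (1 + \<delta>)" and ?b = "ennreal (1 + 1 / \<delta>)"
    let ?ex = "\<lambda>n. \<integral>\<^sup>+x. ennreal ((norm (X' n x - X x))\<^sup>2) \<partial>M"
    let ?ey = "\<lambda>n. \<integral>\<^sup>+x. ennreal ((norm (Y' n x - Y x))\<^sup>2) \<partial>N"
    show "(\<lambda>n. ?a * (ennreal c * (?a * I + ?b * ?ey n)) + ?b * ?ex n) \<longlonglongrightarrow> ?a * (ennreal c * (?a * I))"
    proof -
      have "(\<lambda>n. ?a * (ennreal c * (?a * I + ?b * ?ey n)) + ?b * ?ex n) \<longlonglongrightarrow>
          ?a * (ennreal c * (?a * I + ?b * 0)) + ?b * 0"
        by (intro tendsto_add ennreal_tendsto_cmult tendsto_const X Y) auto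
      then show ?thesis by simp
    qed
    have "(\<integral>\<^sup>+x. ennreal ((norm (X x))\<^sup>2) \<partial>M) \<le> ?a * (ennreal c * (?a * I + ?b * ?ey n)) + ?b * ?ex n" for n
    proof -
      have "(\<integral>\<^sup>+x. ennreal ((norm (X x))\<^sup>2) \<partial>M) \<le> ?a * (\<integral>\<^sup>+x. ennreal ((norm (X' n x))\<^sup>2) \<partial>M) + ?b * ?ex n"
        using nn_integral_norm_sq_le_weighted[OF _ _ that, of X M "X' n"]
        by (simp add: nn_integral_norm_sq_minus_commute[where X = "X' n"])
      also have "\<dots> \<le> ?a * (ennreal c * (\<integral>\<^sup>+x. ennreal ((norm (Y' n x))\<^sup>2) \<partial>N)) + ?b * ?ex n"
        by (intro add_mono mult_left_mono le) auto
      also have "\<dots> \<le> ?a * (ennreal c * (?a * I + ?b * ?ey n)) + ?b * ?ex n"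
        unfolding I_def by (intro add_mono mult_left_mono nn_integral_norm_sq_le_weighted that) auto
      finally show ?thesis .
    qed
    then show "\<exists>N. \<forall>n\<ge>N. (\<integral>\<^sup>+x. ennreal ((norm (X x))\<^sup>2) \<partial>M) \<le>
        ?a * (ennreal c * (?a * I + ?b * ?ey n)) + ?b * ?ex n"
      by blast
  qed
  obtain i where i: "I = ennreal i" "0 \<le> i"
    using I by (cases I) auto
  \<comment> \<open>The second limit, along \<delta> = 1 / (n + 1).\<close>
  have "(\<lambda>n. ennreal ((1 + 1 / real (Suc n)) * (c * ((1 + 1 / real (Suc n)) * i)))) \<longlonglongrightarrow>
      ennreal ((1 + 0) * (c * ((1 + 0) * i)))"
    by (intro tendsto_ennrealI tendsto_intros LIMSEQ_Suc lim_1_over_n)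
  moreover have "(\<integral>\<^sup>+x. ennreal ((norm (X x))\<^sup>2) \<partial>M) \<le>
      ennreal ((1 + 1 / real (Suc n)) * (c * ((1 + 1 / real (Suc n)) * i)))" for n
    using \<delta>[of "1 / real (Suc n)"] i \<open>0 < c\<close> by (simp add: ennreal_mult)
  ultimately have "(\<integral>\<^sup>+x. ennreal ((norm (X x))\<^sup>2) \<partial>M) \<le> ennreal (c * i)"
    by (intro LIMSEQ_le_const) auto
  then show ?thesis
    using i \<open>0 < c\<close> by (simp add: ennreal_mult flip: I_def)
qed

section \<open>The Fourier transform of integrable functions\<close>

definition fourier :: "(real \<Rightarrow> complex) \<Rightarrow> real \<Rightarrow> complex" where
  "fourier u w = (\<integral>y. cis (- (w * y)) * u y \<partial>lborel)"

lemma borel_measurable_cis [measurable]: "cis \<in> borel_measurable borel"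
  by (intro borel_measurable_continuous_onI continuous_intros)

lemma borel_measurable_cnj [measurable]: "cnj \<in> borel_measurable borel"
  by (intro borel_measurable_continuous_onI continuous_intros)

lemma borel_measurable_fourier [measurable]:
  assumes [measurable]: "u \<in> borel_measurable borel"
  shows "fourier u \<in> borel_measurable borel"
  unfolding fourier_def[abs_def] by measurable

lemma integrable_cis_mult:
  assumes "integrable lborel u" and [measurable]: "g \<in> borel_measurable borel"
  shows "integrable lborel (\<lambda>y. cis (g y) * u y)"
  using assms(1) by (intro Bochner_Integration.integrable_bound[OF assms(1)]) (auto simp: norm_mult)

lemma fourier_diff:
  assumes "integrable lborel u" "integrable lborel v"
  shows "fourier (\<lambda>y. u y - v y) w = fourier u w - fourier v w"
  using assms by (simp add: fourier_def right_diff_distrib integrable_cis_mult)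

lemma norm_fourier_le:
  "cmod (fourier u w) \<le> (\<integral>y. cmod (u y) \<partial>lborel)"
  unfolding fourier_def by (rule order_trans[OF integral_norm_bound]) (simp add: norm_mult)

section \<open>Gaussian regularisation and the two halves of Plancherel's theorem\<close>

lemma integrable_tensor:
  fixes u v :: "real \<Rightarrow> complex"
  assumes "integrable lborel u" "integrable lborel v"
  shows "integrable (lborel \<Otimes>\<^sub>M lborel) (\<lambda>p. u (fst p) * v (snd p))"
proof -
  have [measurable]: "u \<in> borel_measurable borel" "v \<in> borel_measurable borel"
    using assms by auto
  show ?thesis
    by (rule lborel_pair.Fubini_integrable) (use assms in \<open>auto simp: norm_mult\<close>)
qed

text \<open>As a double integral over time, the square depends on the frequency through a phase
  only, which a Gaussian weight integrates explicitly.\<close>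

lemma fourier_norm_sq:
  assumes u: "integrable lborel u"
  shows "complex_of_real ((cmod (fourier u w))\<^sup>2) =
    (\<integral>p. u (fst p) * cnj (u (snd p)) * cis (- (w * (fst p - snd p))) \<partial>(lborel \<Otimes>\<^sub>M lborel))"
proof -
  define v where "v y = cis (- (w * y)) * u y" for y
  have v: "integrable lborel v"
    unfolding v_def by (intro integrable_cis_mult u) auto
  have "complex_of_real ((cmod (fourier u w))\<^sup>2) = (\<integral>y. v y \<partial>lborel) * (\<integral>y. cnj (v y) \<partial>lborel)"
    unfolding complex_norm_square fourier_def v_def by (subst Bochner_Integration.integral_cnj) simp
  also have "\<dots> = (\<integral>x. (\<integral>y. v x * cnj (v y) \<partial>lborel) \<partial>lborel)"
    using v by simp
  also have "\<dots> = (\<integral>p. v (fst p) * cnj (v (snd p)) \<partial>(lborel \<Otimes>\<^sub>M lborel))"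
    using lborel_pair.integral_fst'[OF integrable_tensor[OF v, of "\<lambda>y. cnj (v y)"]] v by simp
  also have "\<dots> = (\<integral>p. u (fst p) * cnj (u (snd p)) * cis (- (w * (fst p - snd p))) \<partial>(lborel \<Otimes>\<^sub>M lborel))"
    by (intro Bochner_Integration.integral_cong refl)
      (simp add: v_def mult_ac cis_cnj cis_mult right_diff_distrib)
  finally show ?thesis .
qed

text \<open>The inner product of \<open>u\<close> with its convolution by a Gaussian of standard
  deviation \<open>\<epsilon>\<close>, an approximation to the square integral of \<open>u\<close>
  for small \<open>\<epsilon>\<close>.\<close>

definition gauss_form :: "(real \<Rightarrow> complex) \<Rightarrow> real \<Rightarrow> complex" where
  "gauss_form u \<epsilon> = (\<integral>p. u (fst p) * cnj (u (snd p)) * normal_density 0 \<epsilon> (fst p - snd p) \<partial>(lborel \<Otimes>\<^sub>M lborel))"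

text \<open>The Gaussian weight makes the triple integral absolutely convergent. After exchanging
  the integrals, the phase is averaged into the characteristic function of the standard normal
  distribution, which is again Gaussian.\<close>

lemma fourier_gauss:
  assumes u: "integrable lborel u" and \<epsilon>: "0 < \<epsilon>"
  shows "(\<integral>\<^sup>+w. ennreal ((cmod (fourier u w))\<^sup>2 * exp (- (\<epsilon> * w)\<^sup>2 / 2)) \<partial>lborel) =
    ennreal (2 * pi * cmod (gauss_form u \<epsilon>))"
proof -
  have [measurable]: "u \<in> borel_measurable borel"
    using u by auto
  let ?N = "std_normal_distribution"
  interpret N: prob_space ?N
    by (rule prob_space_normal_density) simp
  interpret NL: pair_sigma_finite ?N "lborel \<Otimes>\<^sub>M lborel :: (real \<times> real) measure" ..
  define h where "h x p = u (fst p) * cnj (u (snd p)) * cis (- (x / \<epsilon> * (fst p - snd p)))" for x p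
  have uu: "integrable (lborel \<Otimes>\<^sub>M lborel) (\<lambda>p. u (fst p) * cnj (u (snd p)))"
    by (rule integrable_tensor) (use u in auto)
  have "(\<lambda>(x, p). h x p) \<in> borel_measurable (borel \<Otimes>\<^sub>M (lborel \<Otimes>\<^sub>M lborel))"
    unfolding h_def by measurable
  moreover have "sets (?N \<Otimes>\<^sub>M (lborel \<Otimes>\<^sub>M lborel :: (real \<times> real) measure)) = sets (borel \<Otimes>\<^sub>M (lborel \<Otimes>\<^sub>M lborel))"
    by (intro sets_pair_measure_cong) auto
  ultimately have [measurable]: "(\<lambda>(x, p). h x p) \<in> borel_measurable (?N \<Otimes>\<^sub>M (lborel \<Otimes>\<^sub>M lborel))"
    using measurable_cong_sets by blast
  have hint: "integrable (lborel \<Otimes>\<^sub>M lborel) (h x)" for x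
    unfolding h_def by (intro Bochner_Integration.integrable_bound[OF uu]) (auto simp: norm_mult)
  have int: "integrable (?N \<Otimes>\<^sub>M (lborel \<Otimes>\<^sub>M lborel)) (\<lambda>(x, p). h x p)"
    by (rule NL.Fubini_integrable) (simp_all add: hint, simp add: h_def norm_mult)
  have bdd: "(cmod (fourier u w))\<^sup>2 \<le> (\<integral>y. cmod (u y) \<partial>lborel)\<^sup>2" for w
    by (intro power_mono norm_fourier_le) auto
  have L: "(\<integral>x. complex_of_real ((cmod (fourier u (x / \<epsilon>)))\<^sup>2) \<partial>?N) =
      complex_of_real (\<epsilon> * sqrt (2 * pi)) * gauss_form u \<epsilon>"
  proof -
    have "(\<integral>x. complex_of_real ((cmod (fourier u (x / \<epsilon>)))\<^sup>2) \<partial>?N) = (\<integral>x. (\<integral>p. h x p \<partial>(lborel \<Otimes>\<^sub>M lborel)) \<partial>?N)"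
      unfolding fourier_norm_sq[OF u] h_def ..
    also have "\<dots> = (\<integral>p. (\<integral>x. h x p \<partial>?N) \<partial>(lborel \<Otimes>\<^sub>M lborel))"
      by (rule NL.Fubini_integral[symmetric, OF int])
    also have "\<dots> = (\<integral>p. complex_of_real (\<epsilon> * sqrt (2 * pi)) * (u (fst p) * cnj (u (snd p)) * normal_density 0 \<epsilon> (fst p - snd p)) \<partial>(lborel \<Otimes>\<^sub>M lborel))"
    proof (intro Bochner_Integration.integral_cong refl)
      fix p :: "real \<times> real"
      let ?z = "fst p - snd p"
      have "(\<integral>x. cis (- (x / \<epsilon> * ?z)) \<partial>?N) = char ?N (- ?z / \<epsilon>)"
        unfolding char_def cis_conv_exp
        by (intro Bochner_Integration.integral_cong refl arg_cong[where f = "\<lambda>r. exp (\<i> * complex_of_real r)"])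
            (simp add: left_diff_distrib right_diff_distrib diff_divide_distrib mult.commute)
      also have "\<dots> = of_real (exp (- (?z / \<epsilon>)\<^sup>2 / 2))"
        by (simp add: char_std_normal_distribution power_divide power2_commute)
      also have "exp (- (?z / \<epsilon>)\<^sup>2 / 2) = \<epsilon> * sqrt (2 * pi) * normal_density 0 \<epsilon> ?z"
        using \<epsilon> by (simp add: normal_density_def real_sqrt_mult power_divide mult.commute)
      finally show "(\<integral>x. h x p \<partial>?N) = complex_of_real (\<epsilon> * sqrt (2 * pi)) * (u (fst p) * cnj (u (snd p)) * normal_density 0 \<epsilon> ?z)"
        by (simp add: h_def mult_ac)
    qed
    finally show ?thesis
      by (simp add: gauss_form_def)
  qed
  \<comment> \<open>The substitution \<open>w = x / \<epsilon>\<close> turns the weight into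
    \<open>sqrt (2 * pi)\<close> times the standard normal density. The same factor comes from the
    density of deviation \<open>\<epsilon>\<close>, and together they give
    \<open>2 * pi\<close>.\<close>
  have "(\<integral>\<^sup>+w. ennreal ((cmod (fourier u w))\<^sup>2 * exp (- (\<epsilon> * w)\<^sup>2 / 2)) \<partial>lborel) =
    ennreal (1 / \<epsilon>) * (\<integral>\<^sup>+x. ennreal ((cmod (fourier u (x / \<epsilon>)))\<^sup>2 * exp (- x\<^sup>2 / 2)) \<partial>lborel)"
    using nn_integral_real_affine[of "\<lambda>w. ennreal ((cmod (fourier u w))\<^sup>2 * exp (- (\<epsilon> * w)\<^sup>2 / 2))" "1 / \<epsilon>" 0] \<epsilon>
    by simp
  also have "(\<integral>\<^sup>+x. ennreal ((cmod (fourier u (x / \<epsilon>)))\<^sup>2 * exp (- x\<^sup>2 / 2)) \<partial>lborel) =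
      (\<integral>\<^sup>+x. ennreal (sqrt (2 * pi)) * (ennreal (std_normal_density x) * ennreal ((cmod (fourier u (x / \<epsilon>)))\<^sup>2)) \<partial>lborel)"
    by (intro nn_integral_cong) (simp add: std_normal_density_def mult_ac flip: ennreal_mult)
  also have "\<dots> = ennreal (sqrt (2 * pi)) * (\<integral>\<^sup>+x. ennreal ((cmod (fourier u (x / \<epsilon>)))\<^sup>2) \<partial>?N)"
    by (simp add: nn_integral_cmult nn_integral_density)
  also have "(\<integral>\<^sup>+x. ennreal ((cmod (fourier u (x / \<epsilon>)))\<^sup>2) \<partial>?N) = ennreal (\<integral>x. (cmod (fourier u (x / \<epsilon>)))\<^sup>2 \<partial>?N)"
  proof (rule nn_integral_eq_integral)
    show "integrable ?N (\<lambda>x. (cmod (fourier u (x / \<epsilon>)))\<^sup>2)"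
      by (rule N.integrable_const_bound[where B = "(\<integral>y. cmod (u y) \<partial>lborel)\<^sup>2"]) (use bdd in auto)
  qed simp
  also have "(\<integral>x. (cmod (fourier u (x / \<epsilon>)))\<^sup>2 \<partial>?N) = cmod (\<integral>x. complex_of_real ((cmod (fourier u (x / \<epsilon>)))\<^sup>2) \<partial>?N)"
    by (simp del: of_real_power)
  also have "\<dots> = \<epsilon> * sqrt (2 * pi) * cmod (gauss_form u \<epsilon>)"
    unfolding L using \<epsilon> by (simp add: norm_mult)
  finally show ?thesis
    using \<epsilon> by (simp flip: ennreal_mult)
qed

lemma nn_integral_normal_density_shift:
  assumes "0 < \<epsilon>"
  shows "(\<integral>\<^sup>+y. ennreal (normal_density 0 \<epsilon> (x - y)) \<partial>lborel) = 1"
    and "(\<integral>\<^sup>+y. ennreal (normal_density 0 \<epsilon> (y - x)) \<partial>lborel) = 1"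
proof -
  have "(\<integral>\<^sup>+y. ennreal (normal_density x \<epsilon> y) \<partial>lborel) = 1"
    using prob_space.emeasure_space_1[OF prob_space_normal_density[OF assms, of x]]
    by (simp add: emeasure_density)
  then show "(\<integral>\<^sup>+y. ennreal (normal_density 0 \<epsilon> (x - y)) \<partial>lborel) = 1"
    "(\<integral>\<^sup>+y. ennreal (normal_density 0 \<epsilon> (y - x)) \<partial>lborel) = 1"
    by (simp_all add: normal_density_def power2_commute)
qed

text \<open>Schur's test: a product of two moduli is at most the mean of their squares, and the
  Gaussian kernel has integral 1 in either variable.\<close>

lemma norm_gauss_form_le:
  assumes [measurable]: "u \<in> borel_measurable borel" and \<epsilon>: "0 < \<epsilon>"
  shows "ennreal (cmod (gauss_form u \<epsilon>)) \<le> (\<integral>\<^sup>+y. ennreal ((cmod (u y))\<^sup>2) \<partial>lborel)"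
proof -
  let ?n = "\<lambda>x y. normal_density 0 \<epsilon> (x - y)"
  define c :: real where "c = 1 / 2"
  have c: "0 \<le> c" "c + c = 1" by (simp_all add: c_def)
  define I where "I = (\<integral>\<^sup>+y. ennreal ((cmod (u y))\<^sup>2) \<partial>lborel)"
  \<comment> \<open>If the integrand is not integrable, the form is 0 by convention and the bound is
    trivial.\<close>
  have "ennreal (cmod (gauss_form u \<epsilon>)) \<le>
      (\<integral>\<^sup>+p. ennreal (cmod (u (fst p) * cnj (u (snd p)) * ?n (fst p) (snd p))) \<partial>(lborel \<Otimes>\<^sub>M lborel))"
    unfolding gauss_form_def by (cases "integrable (lborel \<Otimes>\<^sub>M lborel) (\<lambda>p. u (fst p) * cnj (u (snd p)) * ?n (fst p) (snd p))")
      (simp_all add: integral_norm_bound_ennreal not_integrable_integral_eq)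
  also have "\<dots> \<le> (\<integral>\<^sup>+p. ennreal c * (ennreal ((cmod (u (fst p)))\<^sup>2) * ennreal (?n (fst p) (snd p)))
      + ennreal c * (ennreal ((cmod (u (snd p)))\<^sup>2) * ennreal (?n (fst p) (snd p))) \<partial>(lborel \<Otimes>\<^sub>M lborel))"
  proof (intro nn_integral_mono)
    fix p :: "real \<times> real"
    let ?a = "cmod (u (fst p))" and ?b = "cmod (u (snd p))" and ?c = "?n (fst p) (snd p)"
    have "?a * ?b * ?c \<le> (c * ?a\<^sup>2 + c * ?b\<^sup>2) * ?c"
      using sum_squares_bound[of ?a ?b] by (intro mult_right_mono) (auto simp: c_def)
    then show "ennreal (cmod (u (fst p) * cnj (u (snd p)) * ?c)) \<le>
        ennreal c * (ennreal (?a\<^sup>2) * ennreal ?c) + ennreal c * (ennreal (?b\<^sup>2) * ennreal ?c)"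
      using c(1) by (simp add: norm_mult distrib_right mult.assoc ennreal_leI flip: ennreal_mult ennreal_plus)
  qed
  also have "\<dots> = ennreal c * (\<integral>\<^sup>+p. ennreal ((cmod (u (fst p)))\<^sup>2) * ennreal (?n (fst p) (snd p)) \<partial>(lborel \<Otimes>\<^sub>M lborel))
      + ennreal c * (\<integral>\<^sup>+p. ennreal ((cmod (u (snd p)))\<^sup>2) * ennreal (?n (fst p) (snd p)) \<partial>(lborel \<Otimes>\<^sub>M lborel))"
    by (simp add: nn_integral_add nn_integral_cmult)
  also have "(\<integral>\<^sup>+p. ennreal ((cmod (u (fst p)))\<^sup>2) * ennreal (?n (fst p) (snd p)) \<partial>(lborel \<Otimes>\<^sub>M lborel)) = I"
    by (subst lborel.nn_integral_fst[symmetric])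
      (simp_all add: nn_integral_cmult nn_integral_normal_density_shift[OF \<epsilon>] I_def)
  also have "(\<integral>\<^sup>+p. ennreal ((cmod (u (snd p)))\<^sup>2) * ennreal (?n (fst p) (snd p)) \<partial>(lborel \<Otimes>\<^sub>M lborel)) = I"
    by (subst lborel_pair.nn_integral_snd[symmetric])
      (simp_all add: nn_integral_cmult nn_integral_normal_density_shift[OF \<epsilon>] I_def)
  also have "ennreal c * I + ennreal c * I = I"
    using c by (simp flip: distrib_right ennreal_plus)
  finally show ?thesis by (simp add: I_def)
qed

text \<open>The bound on the Gaussian form is uniform in the width. The frequency weights tend to 1
  and are removed by Fatou's lemma.\<close>

lemma fourier_norm_sq_le:
  assumes u: "integrable lborel u"
  shows "(\<integral>\<^sup>+w. ennreal ((cmod (fourier u w))\<^sup>2) \<partial>lborel) \<le> ennreal (2 * pi) * (\<integral>\<^sup>+y. ennreal ((cmod (u y))\<^sup>2) \<partial>lborel)"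
proof -
  have [measurable]: "u \<in> borel_measurable borel"
    using u by auto
  define g where "g n w = ennreal ((cmod (fourier u w))\<^sup>2 * exp (- (1 / real (Suc n) * w)\<^sup>2 / 2))" for n :: nat and w
  have [measurable]: "g n \<in> borel_measurable borel" for n
    unfolding g_def by measurable
  have "(\<integral>\<^sup>+w. ennreal ((cmod (fourier u w))\<^sup>2) \<partial>lborel) = (\<integral>\<^sup>+w. liminf (\<lambda>n. g n w) \<partial>lborel)"
  proof (intro nn_integral_cong)
    fix w
    have "(\<lambda>n. exp (- (1 / real (Suc n) * w)\<^sup>2 / 2)) \<longlonglongrightarrow> exp (- (0 * w)\<^sup>2 / 2)"
      by (intro tendsto_exp tendsto_divide tendsto_minus tendsto_power tendsto_mult tendsto_const
          LIMSEQ_Suc[OF lim_1_over_n]) simp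
    then have "(\<lambda>n. g n w) \<longlonglongrightarrow> ennreal ((cmod (fourier u w))\<^sup>2 * exp (- (0 * w)\<^sup>2 / 2))"
      unfolding g_def by (intro tendsto_ennrealI tendsto_mult tendsto_const)
    from lim_imp_Liminf[OF trivial_limit_sequentially this]
    show "ennreal ((cmod (fourier u w))\<^sup>2) = liminf (\<lambda>n. g n w)" by (simp add: g_def)
  qed
  also have "\<dots> \<le> liminf (\<lambda>n. \<integral>\<^sup>+w. g n w \<partial>lborel)"
    by (intro nn_integral_liminf) simp
  also have "\<dots> \<le> ennreal (2 * pi) * (\<integral>\<^sup>+y. ennreal ((cmod (u y))\<^sup>2) \<partial>lborel)"
  proof (intro Liminf_le always_eventually allI)
    fix n
    have eq: "(\<integral>\<^sup>+w. g n w \<partial>lborel) = ennreal (2 * pi * cmod (gauss_form u (1 / real (Suc n))))"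
      unfolding g_def by (rule fourier_gauss[OF u]) simp
    show "(\<integral>\<^sup>+w. g n w \<partial>lborel) \<le> ennreal (2 * pi) * (\<integral>\<^sup>+y. ennreal ((cmod (u y))\<^sup>2) \<partial>lborel)"
      using norm_gauss_form_le[of u "1 / real (Suc n)"]
      unfolding eq by (simp add: ennreal_mult mult_left_mono)
  qed simp
  finally show ?thesis .
qed

text \<open>At a continuity point of the bounded function \<open>v\<close>, its averages over
  shrinking Gaussians converge to its value. Dominated convergence is used twice, with majorants
  \<open>B\<close> times the normal density for the averages and \<open>B\<close> times the modulus
  of \<open>v\<close> for the form.\<close>

lemma gauss_form_tendsto:
  assumes v: "integrable lborel v" and bdd: "\<And>y. cmod (v y) \<le> B" and cont: "AE y in lborel. isCont v y"
  shows "(\<lambda>n. gauss_form v (1 / real (Suc n))) \<longlonglongrightarrow> (\<integral>y. v y * cnj (v y) \<partial>lborel)"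
proof -
  have [measurable]: "v \<in> borel_measurable borel"
    using v by auto
  let ?\<phi> = "std_normal_density"
  let ?m = "\<lambda>n y. \<integral>z. cnj (v (y - 1 / real (Suc n) * z)) * ?\<phi> z \<partial>lborel"
  have \<phi>int: "integrable lborel (\<lambda>z. B * ?\<phi> z)"
    using integrable_normal_density[of 1 0] by auto
  have B: "0 \<le> B" using bdd[of 0] norm_ge_zero order_trans by blast
  have form: "gauss_form v (1 / real (Suc n)) = (\<integral>y. v y * ?m n y \<partial>lborel)" for n
  proof -
    let ?e = "1 / real (Suc n)"
    have bound: "normal_density 0 ?e z \<le> 1 / sqrt (2 * pi * ?e\<^sup>2)" for z
      unfolding normal_density_def by (intro mult_left_le) auto
    have int: "integrable (lborel \<Otimes>\<^sub>M lborel) (\<lambda>p. v (fst p) * cnj (v (snd p)) * normal_density 0 ?e (fst p - snd p))"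
    proof (rule Bochner_Integration.integrable_bound)
      show "integrable (lborel \<Otimes>\<^sub>M lborel) (\<lambda>p. of_real (1 / sqrt (2 * pi * ?e\<^sup>2)) * (v (fst p) * cnj (v (snd p))))"
        by (intro integrable_mult_right integrable_tensor v integrable_cnj)
      show "AE p in lborel \<Otimes>\<^sub>M lborel. cmod (v (fst p) * cnj (v (snd p)) * normal_density 0 ?e (fst p - snd p)) \<le>
          cmod (of_real (1 / sqrt (2 * pi * ?e\<^sup>2)) * (v (fst p) * cnj (v (snd p))))"
      proof (intro AE_I2)
        fix p :: "real \<times> real"
        have "cmod (v (fst p) * cnj (v (snd p))) * normal_density 0 ?e (fst p - snd p) \<le>
            cmod (v (fst p) * cnj (v (snd p))) * (1 / sqrt (2 * pi * ?e\<^sup>2))"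
          by (intro mult_left_mono bound) simp
        then show "cmod (v (fst p) * cnj (v (snd p)) * normal_density 0 ?e (fst p - snd p)) \<le>
            cmod (of_real (1 / sqrt (2 * pi * ?e\<^sup>2)) * (v (fst p) * cnj (v (snd p))))"
          by (simp add: norm_mult norm_divide mult.commute)
      qed
    qed simp
    have "gauss_form v ?e = (\<integral>y. (\<integral>y'. v y * cnj (v y') * normal_density 0 ?e (y - y') \<partial>lborel) \<partial>lborel)"
      unfolding gauss_form_def using lborel_pair.integral_fst'[OF int] by simp
    also have "(\<lambda>y. \<integral>y'. v y * cnj (v y') * normal_density 0 ?e (y - y') \<partial>lborel) = (\<lambda>y. v y * ?m n y)"
    proof
      fix y
      \<comment> \<open>Substituting \<open>y' = y - ?e * z\<close> moves the width from the kernel,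
        now the standard normal density, into the argument of \<open>v\<close>.\<close>
      have "(\<integral>y'. v y * cnj (v y') * normal_density 0 ?e (y - y') \<partial>lborel) =
        ?e *\<^sub>R (\<integral>z. v y * cnj (v (y + - ?e * z)) * normal_density 0 ?e (y - (y + - ?e * z)) \<partial>lborel)"
        by (subst lborel_integral_real_affine[where c = "- ?e" and t = y]) simp_all
      also have "\<dots> = (\<integral>z. ?e *\<^sub>R (v y * cnj (v (y + - ?e * z)) * normal_density 0 ?e (y - (y + - ?e * z))) \<partial>lborel)"
        by simp
      also have "\<dots> = (\<integral>z. v y * (cnj (v (y - ?e * z)) * ?\<phi> z) \<partial>lborel)"
      proof (intro Bochner_Integration.integral_cong refl)
        fix z
        have "?e * normal_density 0 ?e (?e * z) = ?\<phi> z"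
          by (simp add: normal_density_def real_sqrt_mult real_sqrt_divide power_divide power_mult_distrib)
        moreover have "?e *\<^sub>R (v y * cnj (v (y - ?e * z)) * normal_density 0 ?e (?e * z)) =
            v y * (cnj (v (y - ?e * z)) * complex_of_real (?e * normal_density 0 ?e (?e * z)))"
          unfolding scaleR_conv_of_real of_real_mult by (simp only: mult_ac)
        ultimately show "?e *\<^sub>R (v y * cnj (v (y + - ?e * z)) * normal_density 0 ?e (y - (y + - ?e * z))) = v y * (cnj (v (y - ?e * z)) * ?\<phi> z)"
          by simp
      qed
      finally show "(\<integral>y'. v y * cnj (v y') * normal_density 0 ?e (y - y') \<partial>lborel) = v y * ?m n y"
        by simp
    qed
    finally show ?thesis .
  qed
  have m: "(\<lambda>n. ?m n y) \<longlonglongrightarrow> cnj (v y)" if "isCont v y" for y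
  proof -
    have "(\<lambda>n. ?m n y) \<longlonglongrightarrow> (\<integral>z. cnj (v y) * ?\<phi> z \<partial>lborel)"
    proof (rule integral_dominated_convergence[OF _ _ \<phi>int])
      show "AE z in lborel. (\<lambda>n. cnj (v (y - 1 / real (Suc n) * z)) * ?\<phi> z) \<longlonglongrightarrow> cnj (v y) * ?\<phi> z"
      proof (intro AE_I2)
        fix z
        have "(\<lambda>n. y - 1 / real (Suc n) * z) \<longlonglongrightarrow> y - 0 * z"
          by (intro tendsto_intros LIMSEQ_Suc lim_1_over_n)
        then have "(\<lambda>n. v (y - 1 / real (Suc n) * z)) \<longlonglongrightarrow> v y"
          using isCont_tendsto_compose[OF that] by simp
        then show "(\<lambda>n. cnj (v (y - 1 / real (Suc n) * z)) * ?\<phi> z) \<longlonglongrightarrow> cnj (v y) * ?\<phi> z"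
          by (intro tendsto_intros)
      qed
    qed (auto simp: norm_mult bdd intro!: mult_right_mono)
    also have "(\<integral>z. cnj (v y) * complex_of_real (?\<phi> z) \<partial>lborel) = cnj (v y)"
      using integral_normal_density[of 1 0] by (simp del: integral_normal_density)
    finally show ?thesis .
  qed
  have mbd: "cmod (?m n y) \<le> B" for n y
  proof -
    have "cmod (?m n y) \<le> (\<integral>z. B * ?\<phi> z \<partial>lborel)"
      by (rule order_trans[OF Bochner_Integration.integral_norm_bound], rule integral_mono'[OF \<phi>int])
        (auto simp: norm_mult bdd B intro!: mult_right_mono)
    then show ?thesis using integral_normal_density[of 1 0] by simp
  qed
  show ?thesis
    unfolding form
  proof (rule integral_dominated_convergence)
    show "integrable lborel (\<lambda>y. cmod (v y) * B)"
      using v by auto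
    show "AE y in lborel. (\<lambda>n. v y * ?m n y) \<longlonglongrightarrow> v y * cnj (v y)"
      using cont by eventually_elim (intro tendsto_intros m)
    show "AE y in lborel. cmod (v y * ?m n y) \<le> cmod (v y) * B" for n
      unfolding norm_mult by (intro AE_I2 mult_left_mono mbd norm_ge_zero)
  qed measurable
qed

text \<open>The frequency weights are at most 1, so all Gaussian forms are bounded by the full
  frequency integral, while they converge to the square integral of \<open>v\<close>.\<close>

lemma fourier_norm_sq_ge_AE_continuous:
  assumes v: "integrable lborel v" and bdd: "\<And>y. cmod (v y) \<le> B" and cont: "AE y in lborel. isCont v y"
  shows "ennreal (2 * pi) * (\<integral>\<^sup>+y. ennreal ((cmod (v y))\<^sup>2) \<partial>lborel) \<le> (\<integral>\<^sup>+w. ennreal ((cmod (fourier v w))\<^sup>2) \<partial>lborel)"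
proof -
  have [measurable]: "v \<in> borel_measurable borel"
    using v by auto
  have int: "integrable lborel (\<lambda>y. (cmod (v y))\<^sup>2)"
    by (rule Bochner_Integration.integrable_bound[where f = "\<lambda>y. B * cmod (v y)"])
      (use v in \<open>auto simp: power2_eq_square abs_mult intro!: mult_mono bdd order_trans[OF bdd]\<close>)
  have eq: "(\<integral>y. v y * cnj (v y) \<partial>lborel) = complex_of_real (\<integral>y. (cmod (v y))\<^sup>2 \<partial>lborel)"
    by (simp flip: complex_norm_square of_real_power integral_complex_of_real)
  have lim: "(\<lambda>n. ennreal (2 * pi * cmod (gauss_form v (1 / real (Suc n))))) \<longlonglongrightarrow>
      ennreal (2 * pi * cmod (\<integral>y. v y * cnj (v y) \<partial>lborel))"
    by (intro tendsto_ennrealI tendsto_intros gauss_form_tendsto[OF v bdd cont])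
  have le: "ennreal (2 * pi * cmod (gauss_form v (1 / real (Suc n)))) \<le> (\<integral>\<^sup>+w. ennreal ((cmod (fourier v w))\<^sup>2) \<partial>lborel)" for n
    by (subst fourier_gauss[OF v, symmetric]) (auto intro!: nn_integral_mono ennreal_leI mult_left_le)
  have "ennreal (2 * pi * cmod (\<integral>y. v y * cnj (v y) \<partial>lborel)) \<le> (\<integral>\<^sup>+w. ennreal ((cmod (fourier v w))\<^sup>2) \<partial>lborel)"
    using LIMSEQ_le_const2[OF lim] le by blast
  moreover have "ennreal (2 * pi * cmod (\<integral>y. v y * cnj (v y) \<partial>lborel)) = ennreal (2 * pi) * (\<integral>\<^sup>+y. ennreal ((cmod (v y))\<^sup>2) \<partial>lborel)"
    unfolding eq by (simp add: nn_integral_eq_integral[OF int] ennreal_mult)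
  ultimately show ?thesis by simp
qed

text \<open>This half of Plancherel's theorem is only needed for mean square limits of step functions,
  which makes continuity of translations in the mean square unnecessary.\<close>

lemma fourier_norm_sq_ge:
  assumes u: "integrable lborel u"
    and v: "\<And>n. integrable lborel (v n)" "\<And>n. bounded (range (v n))" "\<And>n. AE y in lborel. isCont (v n) y"
    and lim: "(\<lambda>n. \<integral>\<^sup>+y. ennreal ((cmod (v n y - u y))\<^sup>2) \<partial>lborel) \<longlonglongrightarrow> 0"
  shows "(\<integral>\<^sup>+y. ennreal ((cmod (u y))\<^sup>2) \<partial>lborel) \<le> ennreal (1 / (2 * pi)) * (\<integral>\<^sup>+w. ennreal ((cmod (fourier u w))\<^sup>2) \<partial>lborel)"
proof (rule mean_square_limit_le[where X' = v and Y' = "\<lambda>n. fourier (v n)"])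
  have [measurable]: "u \<in> borel_measurable borel" "\<And>n. v n \<in> borel_measurable borel"
    using u v by auto
  show "u \<in> borel_measurable lborel" "fourier u \<in> borel_measurable lborel"
    "\<And>n. v n \<in> borel_measurable lborel" "\<And>n. fourier (v n) \<in> borel_measurable lborel"
    by simp_all
  \<comment> \<open>The upper Plancherel bound for the differences carries the mean square
    convergence over to the transforms.\<close>
  show "(\<lambda>n. \<integral>\<^sup>+w. ennreal ((cmod (fourier (v n) w - fourier u w))\<^sup>2) \<partial>lborel) \<longlonglongrightarrow> 0"
  proof (rule tendsto_sandwich[OF _ _ tendsto_const])
    show "(\<lambda>n. ennreal (2 * pi) * (\<integral>\<^sup>+y. ennreal ((cmod (v n y - u y))\<^sup>2) \<partial>lborel)) \<longlonglongrightarrow> 0"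
      using ennreal_tendsto_cmult[OF _ lim, of "ennreal (2 * pi)"] by simp
    show "\<forall>\<^sub>F n in sequentially. (\<integral>\<^sup>+w. ennreal ((cmod (fourier (v n) w - fourier u w))\<^sup>2) \<partial>lborel) \<le>
        ennreal (2 * pi) * (\<integral>\<^sup>+y. ennreal ((cmod (v n y - u y))\<^sup>2) \<partial>lborel)"
      using fourier_norm_sq_le[of "\<lambda>y. v _ y - u y"] u v(1)
      by (intro always_eventually allI) (simp add: fourier_diff)
  qed simp
  show "(\<integral>\<^sup>+y. ennreal ((cmod (v n y))\<^sup>2) \<partial>lborel) \<le> ennreal (1 / (2 * pi)) * (\<integral>\<^sup>+w. ennreal ((cmod (fourier (v n) w))\<^sup>2) \<partial>lborel)" for n
  proof -
    obtain B where "\<And>y. cmod (v n y) \<le> B"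
      using v(2)[of n] by (auto simp: bounded_iff)
    from fourier_norm_sq_ge_AE_continuous[OF v(1) this v(3)]
    have "ennreal (1 / (2 * pi)) * (ennreal (2 * pi) * (\<integral>\<^sup>+y. ennreal ((cmod (v n y))\<^sup>2) \<partial>lborel)) \<le>
        ennreal (1 / (2 * pi)) * (\<integral>\<^sup>+w. ennreal ((cmod (fourier (v n) w))\<^sup>2) \<partial>lborel)"
      by (rule mult_left_mono) simp
    then show ?thesis
      by (simp flip: mult.assoc ennreal_mult)
  qed
qed (use lim in auto)

section \<open>Stochastic integrals\<close>

text \<open>The square of a linear combination depends only on the inner products of its terms.
  Stated for any measure, this reduces an isometry between two spaces to the equality of two Gram
  matrices.\<close>

lemma integral_norm_sq_sum:
  fixes c :: "'q \<Rightarrow> complex" and \<xi> :: "'q \<Rightarrow> 'a \<Rightarrow> real"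
  assumes "finite Q" and int: "\<And>q r. q \<in> Q \<Longrightarrow> r \<in> Q \<Longrightarrow> integrable M (\<lambda>x. \<xi> q x * \<xi> r x)"
  shows "integrable M (\<lambda>x. (cmod (\<Sum>q\<in>Q. c q * \<xi> q x))\<^sup>2)"
    and "complex_of_real (\<integral>x. (cmod (\<Sum>q\<in>Q. c q * \<xi> q x))\<^sup>2 \<partial>M) =
      (\<Sum>q\<in>Q. \<Sum>r\<in>Q. c q * cnj (c r) * of_real (\<integral>x. \<xi> q x * \<xi> r x \<partial>M))"
proof -
  have eq: "complex_of_real ((cmod (\<Sum>q\<in>Q. c q * \<xi> q x))\<^sup>2) =
      (\<Sum>q\<in>Q. \<Sum>r\<in>Q. c q * cnj (c r) * of_real (\<xi> q x * \<xi> r x))" for x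
    unfolding complex_norm_square cnj_sum sum_product
    by (intro sum.cong refl) (simp add: mult_ac)
  have "integrable M (\<lambda>x. complex_of_real ((cmod (\<Sum>q\<in>Q. c q * \<xi> q x))\<^sup>2))"
    unfolding eq
    by (intro Bochner_Integration.integrable_sum integrable_mult_right integrable_of_real int)
  from integrable_Re[OF this] show "integrable M (\<lambda>x. (cmod (\<Sum>q\<in>Q. c q * \<xi> q x))\<^sup>2)"
    unfolding Re_complex_of_real .
  have "complex_of_real (\<integral>x. (cmod (\<Sum>q\<in>Q. c q * \<xi> q x))\<^sup>2 \<partial>M) =
      (\<integral>x. (\<Sum>q\<in>Q. \<Sum>r\<in>Q. c q * cnj (c r) * of_real (\<xi> q x * \<xi> r x)) \<partial>M)"
    unfolding eq[symmetric] by (rule integral_complex_of_real[symmetric])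
  also have "\<dots> = (\<Sum>q\<in>Q. \<Sum>r\<in>Q. (\<integral>x. c q * cnj (c r) * of_real (\<xi> q x * \<xi> r x) \<partial>M))"
    by (intro trans[OF Bochner_Integration.integral_sum] Bochner_Integration.integrable_sum
        integrable_mult_right integrable_of_real int sum.cong refl)
  also have "\<dots> = (\<Sum>q\<in>Q. \<Sum>r\<in>Q. c q * cnj (c r) * of_real (\<integral>x. \<xi> q x * \<xi> r x \<partial>M))"
    by (intro sum.cong refl) (simp only: integral_mult_right_zero integral_complex_of_real)
  finally show "complex_of_real (\<integral>x. (cmod (\<Sum>q\<in>Q. c q * \<xi> q x))\<^sup>2 \<partial>M) =
      (\<Sum>q\<in>Q. \<Sum>r\<in>Q. c q * cnj (c r) * of_real (\<integral>x. \<xi> q x * \<xi> r x \<partial>M))" .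
qed

section \<open>Second moments of Wiener increments\<close>

context
  fixes M :: "'a measure" and V :: "real \<Rightarrow> 'a \<Rightarrow> real^'m"
  assumes wiener: "standard_wiener M V"
begin

interpretation prob_space M
  using wiener by (simp add: standard_wiener_def)

lemma wiener_measurable [measurable]: "V t \<in> borel_measurable M"
  using wiener by (simp add: standard_wiener_def)

lemma wiener_component_measurable [measurable]: "(\<lambda>x. V t x $ i) \<in> borel_measurable M"
  by (rule borel_measurable_continuous_on[OF _ wiener_measurable]) (intro continuous_intros)

definition wiener_increment :: "real \<Rightarrow> real \<Rightarrow> 'm \<Rightarrow> 'a \<Rightarrow> real" where
  "wiener_increment s t i x = V t x $ i - V s x $ i"

lemma wiener_increment_measurable [measurable]: "wiener_increment s t i \<in> borel_measurable M"
  unfolding wiener_increment_def[abs_def] by measurable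

lemma wiener_increment_moments:
  assumes "s < t"
  shows "integrable M (\<lambda>x. (wiener_increment s t i x)\<^sup>2)"
    and "expectation (wiener_increment s t i) = 0"
    and "expectation (\<lambda>x. (wiener_increment s t i x)\<^sup>2) = t - s"
proof -
  have D: "distributed M lborel (wiener_increment s t i) (\<lambda>y. ennreal (normal_density 0 (sqrt (t - s)) y))"
    using wiener assms unfolding standard_wiener_def wiener_increment_def by blast
  have pos: "0 < sqrt (t - s)" using assms by simp
  show E: "expectation (wiener_increment s t i) = 0"
    using normal_distributed_expectation[OF pos D] .
  show "expectation (\<lambda>x. (wiener_increment s t i x)\<^sup>2) = t - s"
    using normal_distributed_variance[OF pos D] assms by (simp add: E)
  show "integrable M (\<lambda>x. (wiener_increment s t i x)\<^sup>2)"
    using integrable_normal_moment[OF pos, of 0 2]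
    by (subst distributed_integrable[OF D, symmetric]) auto
qed

lemma wiener_increment_sq_integrable:
  "integrable M (\<lambda>x. (wiener_increment s t i x)\<^sup>2)"
proof (cases s t rule: linorder_cases)
  case greater
  then show ?thesis
    using wiener_increment_moments(1)[of t s i] by (simp add: wiener_increment_def power2_commute)
next
  case less
  then show ?thesis by (rule wiener_increment_moments(1))
qed (simp add: wiener_increment_def)

lemma wiener_increment_mult_integrable:
  "integrable M (\<lambda>x. wiener_increment s t i x * wiener_increment s' t' j x)"
proof (rule Bochner_Integration.integrable_bound)
  show "integrable M (\<lambda>x. (wiener_increment s t i x)\<^sup>2 + (wiener_increment s' t' j x)\<^sup>2)"
    by (intro Bochner_Integration.integrable_add wiener_increment_sq_integrable)
  have "\<bar>a * b\<bar> \<le> \<bar>a\<^sup>2 + b\<^sup>2\<bar>" for a b :: real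
  proof -
    have "2 * \<bar>a * b\<bar> \<le> a\<^sup>2 + b\<^sup>2"
      using sum_squares_bound[of "\<bar>a\<bar>" "\<bar>b\<bar>"] by (simp add: abs_mult)
    then show ?thesis by linarith
  qed
  then show "AE x in M. norm (wiener_increment s t i x * wiener_increment s' t' j x) \<le>
      norm ((wiener_increment s t i x)\<^sup>2 + (wiener_increment s' t' j x)\<^sup>2)"
    by simp
qed measurable

lemma wiener_increment_integrable: "integrable M (wiener_increment s t i)"
  using wiener_increment_sq_integrable by (rule square_integrable_imp_integrable[rotated]) measurable

text \<open>Two cases are treated at once: different intervals of a partition, and different
  components over the same interval. Independence factorises the expectation, and the means
  vanish.\<close>

lemma wiener_increment_indep:
  assumes "sorted_wrt (<) ts" "k < length ts - 1" "l < length ts - 1" "(k, i) \<noteq> (l, j)"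
  shows "expectation (\<lambda>x. wiener_increment (ts ! k) (ts ! Suc k) i x * wiener_increment (ts ! l) (ts ! Suc l) j x) = 0"
proof -
  let ?X = "\<lambda>(j, i) x. V (ts ! Suc j) x $ i - V (ts ! j) x $ i"
  let ?I = "{(k, i), (l, j)}"
  have eq: "?X (k, i) = wiener_increment (ts ! k) (ts ! Suc k) i" for k i
    by (simp add: wiener_increment_def fun_eq_iff)
  have int: "integrable M (?X q)" for q
    by (cases q) (simp only: eq wiener_increment_integrable)
  have "indep_vars (\<lambda>_. borel) ?X ({..<length ts - 1} \<times> UNIV)"
    using wiener assms(1) unfolding standard_wiener_def by blast
  then have "indep_vars (\<lambda>_. borel) ?X ?I"
    by (rule indep_vars_subset) (use assms in auto)
  then have "(\<integral>x. (\<Prod>q\<in>?I. ?X q x) \<partial>M) = (\<Prod>q\<in>?I. \<integral>x. ?X q x \<partial>M)"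
    by (intro indep_vars_lebesgue_integral) (simp, assumption, rule int)
  moreover have "ts ! k < ts ! Suc k"
    using sorted_wrt_nth_less[OF assms(1), of k "Suc k"] assms(2) by simp
  then have "expectation (wiener_increment (ts ! k) (ts ! Suc k) i) = 0"
    by (rule wiener_increment_moments)
  ultimately show ?thesis
    using assms(4) eq by (simp add: wiener_increment_def[abs_def])
qed

lemma wiener_increment_cov_same:
  assumes "s < t"
  shows "expectation (\<lambda>x. wiener_increment s t i x * wiener_increment s t j x) = (if i = j then t - s else 0)"
proof (cases "i = j")
  case True
  then show ?thesis
    using wiener_increment_moments(3)[OF assms, of i] by (simp add: power2_eq_square)
next
  case False
  then show ?thesis
    using wiener_increment_indep[of "[s, t]" 0 0 i j] assms by simp
qed

lemma wiener_increment_cov_adjacent: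
  assumes "s < t" "t < u"
  shows "expectation (\<lambda>x. wiener_increment s t i x * wiener_increment t u j x) = 0"
  using wiener_increment_indep[of "[s, t, u]" 0 1 i j] assms by simp

text \<open>The longer increment is split at \<open>s\<close> into the increment up to
  \<open>s\<close> and one uncorrelated with it. The partition times must increase strictly, so
  equal times are handled apart.\<close>

lemma wiener_increment_cov_ordered:
  assumes "a \<le> s" "s \<le> t"
  shows "expectation (\<lambda>x. wiener_increment a s i x * wiener_increment a t j x) = (if i = j then s - a else 0)"
proof -
  have split: "wiener_increment a s i x * wiener_increment a t j x =
      wiener_increment a s i x * wiener_increment a s j x + wiener_increment a s i x * wiener_increment s t j x" for x
    by (simp add: wiener_increment_def algebra_simps)
  have 1: "expectation (\<lambda>x. wiener_increment a s i x * wiener_increment a s j x) = (if i = j then s - a else 0)"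
    by (cases "a = s") (use assms wiener_increment_cov_same[of a s i j] in \<open>auto simp: wiener_increment_def\<close>)
  have 2: "expectation (\<lambda>x. wiener_increment a s i x * wiener_increment s t j x) = 0"
    by (cases "a = s \<or> s = t") (use assms wiener_increment_cov_adjacent[of a s t i j] in \<open>auto simp: wiener_increment_def\<close>)
  show ?thesis
    unfolding split by (simp add: wiener_increment_mult_integrable 1 2)
qed

lemma wiener_increment_cov_base:
  assumes "a \<le> s" "a \<le> t"
  shows "expectation (\<lambda>x. wiener_increment a s i x * wiener_increment a t j x) = (if i = j then min s t - a else 0)"
proof (cases "s \<le> t")
  case True
  then show ?thesis using wiener_increment_cov_ordered[of a s t i j] assms by (simp add: min_def)
next
  case False
  then show ?thesis
    using wiener_increment_cov_ordered[of a t s j i] assms by (simp add: min_def mult.commute eq_commute)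
qed

text \<open>Measured from a common base point \<open>m\<close>, increments have the covariance of
  Brownian motion, a minimum of times. The resulting combination of four minima is the length of the
  overlap of the two intervals.\<close>

lemma wiener_increment_cov:
  assumes "a \<le> b" "c \<le> d"
  shows "expectation (\<lambda>x. wiener_increment a b i x * wiener_increment c d j x) =
    (if i = j then \<integral>\<tau>. indicat_real {a<..b} \<tau> * indicat_real {c<..d} \<tau> \<partial>lborel else 0)"
proof -
  define m where "m = min a c"
  let ?X = "\<lambda>s t x. wiener_increment m s i x * wiener_increment m t j x"
  have m: "m \<le> a" "m \<le> b" "m \<le> c" "m \<le> d"
    using assms by (auto simp: m_def)
  have split: "wiener_increment a b i x * wiener_increment c d j x =
      (?X b d x - ?X b c x) - (?X a d x - ?X a c x)" for x
    by (simp add: wiener_increment_def algebra_simps)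
  have "(\<integral>\<tau>. indicat_real {a<..b} \<tau> * indicat_real {c<..d} \<tau> \<partial>lborel) = (\<integral>\<tau>. indicat_real {max a c<..min b d} \<tau> \<partial>lborel)"
    by (intro Bochner_Integration.integral_cong) (auto simp: indicator_def)
  also have "\<dots> = (min b d - min b c) - (min a d - min a c)"
    using assms by (auto simp: min_def max_def)
  finally have *: "(\<integral>\<tau>. indicat_real {a<..b} \<tau> * indicat_real {c<..d} \<tau> \<partial>lborel) = (min b d - min b c) - (min a d - min a c)" .
  show ?thesis
    unfolding split *
    by (simp add: wiener_increment_mult_integrable wiener_increment_cov_base m)
qed

end

section \<open>The isometry for step functions\<close>

lemma step_fun_eq_sum:
  fixes S :: "('m::finite, 'p::finite) steps"
  shows "step_fun S \<tau> = (\<Sum>n<length S. indicat_real {fst (S ! n)<..fst (snd (S ! n))} \<tau> *\<^sub>R snd (snd (S ! n)))"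
  by (simp add: step_fun_def sum_list_sum_nth atLeast0LessThan case_prod_unfold)

lemma step_integral_eq_sum:
  fixes S :: "('m::finite, 'p::finite) steps"
  shows "step_integral U S x = (\<Sum>n<length S. snd (snd (S ! n)) *v (U (fst (snd (S ! n))) x - U (fst (S ! n)) x))"
  by (simp add: step_integral_def sum_list_sum_nth atLeast0LessThan case_prod_unfold)

definition of_real_vec :: "real^'m \<Rightarrow> complex^'m" where
  "of_real_vec v = (\<chi> i. complex_of_real (v $ i))"

lemma integrable_indicator_Ioc_mult:
  fixes a b c d :: real
  shows "integrable lborel (\<lambda>\<tau>. indicat_real {a<..b} \<tau> * indicat_real {c<..d} \<tau>)"
proof -
  have "emeasure lborel ({a<..b} \<inter> {c<..d}) < \<infinity>"
    by (rule emeasure_bounded_finite, rule bounded_subset[of "{a..b}"]) auto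
  then have "integrable lborel (indicat_real ({a<..b} \<inter> {c<..d}))"
    by (intro integrable_real_indicator) auto
  moreover have "(\<lambda>\<tau>. indicat_real {a<..b} \<tau> * indicat_real {c<..d} \<tau>) = indicat_real ({a<..b} \<inter> {c<..d})"
    by (auto simp: indicator_def fun_eq_iff)
  ultimately show ?thesis by (simp only:)
qed

lemma norm_vec_sq:
  fixes v :: "complex^'p"
  shows "(norm v)\<^sup>2 = (\<Sum>i\<in>UNIV. (cmod (v $ i))\<^sup>2)"
  by (simp add: norm_vec_def L2_set_def sum_nonneg)

text \<open>The intervals of \<open>S\<close> may overlap or repeat, and no common refinement is
  formed: both sides are quadratic forms in the same coefficients, and the covariances of the
  increments match the overlaps of the intervals.\<close>

lemma wiener_step_integral_isometry:
  fixes V :: "real \<Rightarrow> 'a \<Rightarrow> real^'m::finite" and S :: "('m::finite, 'p::finite) steps"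
  assumes wiener: "standard_wiener M V" and S: "\<forall>(a, b, A)\<in>set S. a \<le> b"
  shows "(\<integral>\<^sup>+x. ennreal ((norm (step_integral (\<lambda>\<tau> x. of_real_vec (V \<tau> x)) S x))\<^sup>2) \<partial>M) =
    (\<integral>\<^sup>+\<tau>. ennreal ((norm (step_fun S \<tau>))\<^sup>2) \<partial>lborel)"
proof -
  define Q where "Q = {..<length S} \<times> (UNIV :: 'm set)"
  define a b where "a n = fst (S ! n)" and "b n = fst (snd (S ! n))" for n
  define c where "c p = (\<lambda>(n, i). snd (snd (S ! n)) $ p $ i)" for p
  define \<xi> where "\<xi> = (\<lambda>(n, i). wiener_increment V (a n) (b n) i)"
  \<comment> \<open>\<open>\<zeta> k (n, i)\<close> is the component \<open>k\<close> of the unit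
    vector \<open>i\<close> times the indicator of the interval \<open>n\<close>. Summation over
    \<open>k\<close> makes different components orthogonal, like the components of the Wiener
    process.\<close>
  define \<zeta> where "\<zeta> k = (\<lambda>(n, i :: 'm) \<tau>. if i = k then indicat_real {a n<..b n} \<tau> else 0)" for k
  have fin: "finite Q" by (simp add: Q_def)
  have ab: "a n \<le> b n" if "n < length S" for n
    using S nth_mem[OF that] by (auto simp: a_def b_def split_beta)
  have \<xi>int: "integrable M (\<lambda>x. \<xi> q x * \<xi> r x)" for q r
    by (simp add: \<xi>_def split_beta wiener_increment_mult_integrable[OF wiener])
  have \<zeta>int: "integrable lborel (\<lambda>x. \<zeta> k q x * \<zeta> k r x)" for k q r
    by (cases "snd q = k \<and> snd r = k") (auto simp: \<zeta>_def split_beta integrable_indicator_Ioc_mult)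
  have cov: "(\<integral>x. \<xi> q x * \<xi> r x \<partial>M) = (\<Sum>k\<in>UNIV. \<integral>\<tau>. \<zeta> k q \<tau> * \<zeta> k r \<tau> \<partial>lborel)"
    if qr: "q \<in> Q" "r \<in> Q" for q r
  proof -
    obtain n i l j where q: "q = (n, i)" and r: "r = (l, j)" by (cases q; cases r)
    have "(\<integral>x. \<xi> q x * \<xi> r x \<partial>M) =
        (if i = j then \<integral>\<tau>. indicat_real {a n<..b n} \<tau> * indicat_real {a l<..b l} \<tau> \<partial>lborel else 0)"
      using qr by (simp add: \<xi>_def q r wiener_increment_cov[OF wiener] ab Q_def)
    also have "\<dots> = (\<Sum>k\<in>UNIV. if k = i then
        (if i = j then \<integral>\<tau>. indicat_real {a n<..b n} \<tau> * indicat_real {a l<..b l} \<tau> \<partial>lborel else 0) else 0)"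
      by simp
    also have "\<dots> = (\<Sum>k\<in>UNIV. \<integral>\<tau>. \<zeta> k q \<tau> * \<zeta> k r \<tau> \<partial>lborel)"
      by (intro sum.cong refl) (auto simp: \<zeta>_def q r)
    finally show ?thesis .
  qed
  have I: "step_integral (\<lambda>\<tau> x. of_real_vec (V \<tau> x)) S x $ p = (\<Sum>q\<in>Q. c p q * \<xi> q x)" for x p
    unfolding Q_def sum.cartesian_product'
    by (simp add: step_integral_eq_sum sum_component matrix_vector_mult_def of_real_vec_def c_def \<xi>_def a_def b_def
        wiener_increment_def[OF wiener])
  have F: "step_fun S \<tau> $ p $ k = (\<Sum>q\<in>Q. c p q * \<zeta> k q \<tau>)" for \<tau> p k
  proof -
    have "step_fun S \<tau> $ p $ k = (\<Sum>n<length S. c p (n, k) * of_real (indicat_real {a n<..b n} \<tau>))"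
      unfolding step_fun_eq_sum sum_component vector_scaleR_component scaleR_conv_of_real[where 'a = complex]
        c_def prod.case a_def b_def by (simp only: mult.commute)
    also have "\<dots> = (\<Sum>n<length S. \<Sum>i\<in>UNIV. if i = k then c p (n, k) * of_real (indicat_real {a n<..b n} \<tau>) else 0)"
      by (simp only: sum.delta finite UNIV_I if_True)
    also have "\<dots> = (\<Sum>n<length S. \<Sum>i\<in>UNIV. c p (n, i) * \<zeta> k (n, i) \<tau>)"
      by (intro sum.cong refl) (simp add: \<zeta>_def)
    finally show ?thesis
      unfolding Q_def sum.cartesian_product' .
  qed
  have key: "(\<integral>x. (cmod (\<Sum>q\<in>Q. c p q * \<xi> q x))\<^sup>2 \<partial>M) = (\<Sum>k\<in>UNIV. (\<integral>\<tau>. (cmod (\<Sum>q\<in>Q. c p q * \<zeta> k q \<tau>))\<^sup>2 \<partial>lborel))" for p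
  proof -
    have "complex_of_real (\<integral>x. (cmod (\<Sum>q\<in>Q. c p q * \<xi> q x))\<^sup>2 \<partial>M) =
        (\<Sum>q\<in>Q. \<Sum>r\<in>Q. \<Sum>k\<in>UNIV. c p q * cnj (c p r) * of_real (\<integral>\<tau>. \<zeta> k q \<tau> * \<zeta> k r \<tau> \<partial>lborel))"
      unfolding integral_norm_sq_sum(2)[where M = M, OF fin \<xi>int]
      by (intro sum.cong refl) (simp add: cov sum_distrib_left)
    also have "\<dots> = (\<Sum>k\<in>UNIV. \<Sum>q\<in>Q. \<Sum>r\<in>Q. c p q * cnj (c p r) * of_real (\<integral>\<tau>. \<zeta> k q \<tau> * \<zeta> k r \<tau> \<partial>lborel))"
      by (simp only: sum.swap[where A = "UNIV :: 'm set" and B = Q])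
    also have "\<dots> = complex_of_real (\<Sum>k\<in>UNIV. (\<integral>\<tau>. (cmod (\<Sum>q\<in>Q. c p q * \<zeta> k q \<tau>))\<^sup>2 \<partial>lborel))"
      unfolding of_real_sum integral_norm_sq_sum(2)[where M = lborel, OF fin \<zeta>int] ..
    finally show ?thesis
      by (simp only: of_real_eq_iff)
  qed
  have "(\<integral>\<^sup>+x. ennreal ((norm (step_integral (\<lambda>\<tau> x. of_real_vec (V \<tau> x)) S x))\<^sup>2) \<partial>M) =
      ennreal (\<integral>x. (\<Sum>p\<in>UNIV. (cmod (\<Sum>q\<in>Q. c p q * \<xi> q x))\<^sup>2) \<partial>M)"
    unfolding norm_vec_sq I
    by (intro nn_integral_eq_integral Bochner_Integration.integrable_sum integral_norm_sq_sum(1) fin \<xi>int AE_I2 sum_nonneg) auto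
  also have "(\<integral>x. (\<Sum>p\<in>UNIV. (cmod (\<Sum>q\<in>Q. c p q * \<xi> q x))\<^sup>2) \<partial>M) =
      (\<integral>\<tau>. (\<Sum>p\<in>UNIV. \<Sum>k\<in>UNIV. (cmod (\<Sum>q\<in>Q. c p q * \<zeta> k q \<tau>))\<^sup>2) \<partial>lborel)"
    by (simp add: integral_norm_sq_sum(1)[where M = lborel, OF fin \<zeta>int] integral_norm_sq_sum(1)[where M = M, OF fin \<xi>int] key)
  also have "ennreal \<dots> = (\<integral>\<^sup>+\<tau>. ennreal ((norm (step_fun S \<tau>))\<^sup>2) \<partial>lborel)"
    unfolding norm_matrix_sq F
    by (intro nn_integral_eq_integral[symmetric] Bochner_Integration.integrable_sum integral_norm_sq_sum(1) fin \<zeta>int AE_I2 sum_nonneg) auto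
  finally show ?thesis .
qed

section \<open>Norms and measurability of matrix products\<close>

lemma cauchy_schwarz_sum_sq:
  fixes f g :: "'k \<Rightarrow> complex"
  shows "(cmod (\<Sum>k\<in>K. f k * g k))\<^sup>2 \<le> (\<Sum>k\<in>K. (cmod (f k))\<^sup>2) * (\<Sum>k\<in>K. (cmod (g k))\<^sup>2)"
proof -
  have "cmod (\<Sum>k\<in>K. f k * g k) \<le> (\<Sum>k\<in>K. \<bar>cmod (f k)\<bar> * \<bar>cmod (g k)\<bar>)"
    by (rule order_trans[OF norm_sum]) (simp add: norm_mult)
  also have "\<dots> \<le> L2_set (\<lambda>k. cmod (f k)) K * L2_set (\<lambda>k. cmod (g k)) K"
    by (rule L2_set_mult_ineq)
  finally have "(cmod (\<Sum>k\<in>K. f k * g k))\<^sup>2 \<le> (L2_set (\<lambda>k. cmod (f k)) K * L2_set (\<lambda>k. cmod (g k)) K)\<^sup>2"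
    by (intro power_mono) auto
  then show ?thesis
    by (simp add: L2_set_def power_mult_distrib sum_nonneg)
qed

lemma norm_matrix_mult_le:
  fixes A :: "complex^'m^'p" and B :: "complex^'k^'m"
  shows "norm (A ** B) \<le> norm A * norm B"
proof -
  have "(norm (A ** B))\<^sup>2 \<le> (\<Sum>i\<in>UNIV. \<Sum>j\<in>UNIV. (\<Sum>k\<in>UNIV. (cmod (A $ i $ k))\<^sup>2) * (\<Sum>k\<in>UNIV. (cmod (B $ k $ j))\<^sup>2))"
    unfolding norm_matrix_sq by (intro sum_mono) (simp add: matrix_matrix_mult_def cauchy_schwarz_sum_sq)
  also have "\<dots> = (\<Sum>i\<in>UNIV. (\<Sum>k\<in>UNIV. (cmod (A $ i $ k))\<^sup>2)) * (\<Sum>j\<in>UNIV. \<Sum>k\<in>UNIV. (cmod (B $ k $ j))\<^sup>2)"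
    by (simp only: sum_product)
  also have "(\<Sum>j\<in>UNIV. \<Sum>k\<in>UNIV. (cmod (B $ k $ j))\<^sup>2) = (norm B)\<^sup>2"
    unfolding norm_matrix_sq by (rule sum.swap)
  also have "(\<Sum>i\<in>UNIV. (\<Sum>k\<in>UNIV. (cmod (A $ i $ k))\<^sup>2)) = (norm A)\<^sup>2"
    by (simp add: norm_matrix_sq)
  finally show ?thesis
    unfolding power_mult_distrib[symmetric] by (rule power2_le_imp_le) simp
qed

lemma norm_matrix_vector_mult_le:
  fixes A :: "complex^'m^'p" and x :: "complex^'m"
  shows "norm (A *v x) \<le> norm A * norm x"
proof -
  have "(norm (A *v x))\<^sup>2 \<le> (\<Sum>i\<in>UNIV. (\<Sum>k\<in>UNIV. (cmod (A $ i $ k))\<^sup>2) * (\<Sum>k\<in>UNIV. (cmod (x $ k))\<^sup>2))"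
    unfolding norm_vec_sq by (intro sum_mono) (simp add: matrix_vector_mult_def cauchy_schwarz_sum_sq)
  also have "\<dots> = (norm A)\<^sup>2 * (norm x)\<^sup>2"
    by (simp add: norm_matrix_sq norm_vec_sq[of x] sum_distrib_right)
  finally show ?thesis
    unfolding power_mult_distrib[symmetric] by (rule power2_le_imp_le) simp
qed

lemma borel_measurable_matrix_mult [measurable]:
  fixes f :: "'a \<Rightarrow> complex^'m^'p" and g :: "'a \<Rightarrow> complex^'k^'m"
  assumes "f \<in> borel_measurable M" "g \<in> borel_measurable M"
  shows "(\<lambda>x. f x ** g x) \<in> borel_measurable M"
  using assms by (rule borel_measurable_continuous_Pair) (intro continuous_intros)

lemma borel_measurable_matrix_vector_mult [measurable]:
  fixes f :: "'a \<Rightarrow> complex^'m"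
  assumes "f \<in> borel_measurable M"
  shows "(\<lambda>x. (A :: complex^'m^'p) *v f x) \<in> borel_measurable M"
  by (rule borel_measurable_continuous_on[OF _ assms]) (unfold matrix_vector_mult_def, intro continuous_intros)

lemma borel_measurable_of_real_vec:
  "f \<in> borel_measurable M \<Longrightarrow> (\<lambda>x. of_real_vec (f x)) \<in> borel_measurable M"
  by (rule borel_measurable_continuous_on[of of_real_vec])
    (unfold of_real_vec_def[abs_def], intro continuous_intros)

lemma borel_measurable_step_fun [measurable]:
  fixes S :: "('m::finite, 'p::finite) steps"
  shows "step_fun S \<in> borel_measurable borel"
  unfolding step_fun_eq_sum[abs_def] by measurable

lemma borel_measurable_step_integral:
  fixes S :: "('m::finite, 'p::finite) steps"
  assumes "\<And>a b A. (a, b, A) \<in> set S \<Longrightarrow> (\<lambda>x. U b x - U a x) \<in> borel_measurable M"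
  shows "step_integral U S \<in> borel_measurable M"
proof -
  have "(\<lambda>x. U (fst (snd (S ! n))) x - U (fst (S ! n)) x) \<in> borel_measurable M" if "n < length S" for n
    using assms[of "fst (S ! n)" "fst (snd (S ! n))" "snd (snd (S ! n))"] that by simp
  then show ?thesis
    unfolding step_integral_eq_sum[abs_def]
    by (intro borel_measurable_sum borel_measurable_matrix_vector_mult) simp
qed

lemma step_fun_append: "step_fun (S @ S') \<tau> = step_fun S \<tau> + step_fun S' \<tau>"
  by (simp add: step_fun_def)

lemma step_integral_append: "step_integral U (S @ S') x = step_integral U S x + step_integral U S' x"
  by (simp add: step_integral_def)

lemma matrix_mult_scaleR_right:
  fixes A :: "complex^'m^'p" and B :: "complex^'k^'m"
  shows "A ** (r *\<^sub>R B) = r *\<^sub>R (A ** B)"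
  by (simp add: vec_eq_iff matrix_matrix_mult_def scaleR_sum_right)

lemma step_fun_map_mult:
  fixes A :: "complex^'m^'p" and S :: "('k::finite, 'm) steps"
  shows "step_fun (map (\<lambda>(a, b, B). (a, b, A ** B)) S) \<tau> = A ** step_fun S \<tau>"
  by (induction S) (auto simp: step_fun_def matrix_add_ldistrib matrix_mult_scaleR_right)

lemma step_integral_map_mult:
  fixes A :: "complex^'m^'p" and S :: "('k::finite, 'm) steps"
  shows "step_integral U (map (\<lambda>(a, b, B). (a, b, A ** B)) S) x = A *v step_integral U S x"
  by (induction S) (auto simp: step_integral_def matrix_vector_right_distrib matrix_vector_mul_assoc)

lemma nn_integral_norm_sq_add_le:
  fixes X Y :: "'a \<Rightarrow> 'b::{real_normed_vector, second_countable_topology}"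
  assumes [measurable]: "X \<in> borel_measurable M" "Y \<in> borel_measurable M"
  shows "(\<integral>\<^sup>+x. ennreal ((norm (X x + Y x))\<^sup>2) \<partial>M) \<le>
    2 * (\<integral>\<^sup>+x. ennreal ((norm (X x))\<^sup>2) \<partial>M) + 2 * (\<integral>\<^sup>+x. ennreal ((norm (Y x))\<^sup>2) \<partial>M)"
  using nn_integral_norm_sq_le_weighted[of "\<lambda>x. X x + Y x" M X 1] by simp

lemma mean_square_tendsto_add:
  fixes X Y :: "'a \<Rightarrow> 'b::{real_normed_vector, second_countable_topology}"
  assumes [measurable]: "X \<in> borel_measurable M" "Y \<in> borel_measurable M"
      "\<And>n. X' n \<in> borel_measurable M" "\<And>n. Y' n \<in> borel_measurable M"
    and X: "(\<lambda>n. \<integral>\<^sup>+x. ennreal ((norm (X' n x - X x))\<^sup>2) \<partial>M) \<longlonglongrightarrow> 0"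
    and Y: "(\<lambda>n. \<integral>\<^sup>+x. ennreal ((norm (Y' n x - Y x))\<^sup>2) \<partial>M) \<longlonglongrightarrow> 0"
  shows "(\<lambda>n. \<integral>\<^sup>+x. ennreal ((norm (X' n x + Y' n x - (X x + Y x)))\<^sup>2) \<partial>M) \<longlonglongrightarrow> 0"
proof (rule tendsto_sandwich[OF _ _ tendsto_const])
  show "(\<lambda>n. 2 * (\<integral>\<^sup>+x. ennreal ((norm (X' n x - X x))\<^sup>2) \<partial>M) + 2 * (\<integral>\<^sup>+x. ennreal ((norm (Y' n x - Y x))\<^sup>2) \<partial>M)) \<longlonglongrightarrow> 0"
    using tendsto_add[OF ennreal_tendsto_cmult[OF _ X, of 2] ennreal_tendsto_cmult[OF _ Y, of 2]] by simp
  show "\<forall>\<^sub>F n in sequentially. (\<integral>\<^sup>+x. ennreal ((norm (X' n x + Y' n x - (X x + Y x)))\<^sup>2) \<partial>M) \<le>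
      2 * (\<integral>\<^sup>+x. ennreal ((norm (X' n x - X x))\<^sup>2) \<partial>M) + 2 * (\<integral>\<^sup>+x. ennreal ((norm (Y' n x - Y x))\<^sup>2) \<partial>M)"
    using nn_integral_norm_sq_add_le[of "\<lambda>x. X' _ x - X x" M "\<lambda>x. Y' _ x - Y x"]
    by (intro always_eventually allI) (simp add: algebra_simps)
qed simp

lemma mean_square_tendsto_bound:
  fixes Y :: "'a \<Rightarrow> 'b::{real_normed_vector, second_countable_topology}"
  assumes [measurable]: "Y \<in> borel_measurable M" "\<And>n. Y' n \<in> borel_measurable M"
    and le: "\<And>n x. norm (X' n x - X x) \<le> K * norm (Y' n x - Y x)"
    and Y: "(\<lambda>n. \<integral>\<^sup>+x. ennreal ((norm (Y' n x - Y x))\<^sup>2) \<partial>M) \<longlonglongrightarrow> 0"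
  shows "(\<lambda>n. \<integral>\<^sup>+x. ennreal ((norm (X' n x - X x))\<^sup>2) \<partial>M) \<longlonglongrightarrow> 0"
proof (rule tendsto_sandwich[OF _ _ tendsto_const])
  show "(\<lambda>n. ennreal (K\<^sup>2) * (\<integral>\<^sup>+x. ennreal ((norm (Y' n x - Y x))\<^sup>2) \<partial>M)) \<longlonglongrightarrow> 0"
    using ennreal_tendsto_cmult[OF _ Y, of "ennreal (K\<^sup>2)"] by simp
  have "(\<integral>\<^sup>+x. ennreal ((norm (X' n x - X x))\<^sup>2) \<partial>M) \<le> ennreal (K\<^sup>2) * (\<integral>\<^sup>+x. ennreal ((norm (Y' n x - Y x))\<^sup>2) \<partial>M)" for n
  proof -
    have "(\<integral>\<^sup>+x. ennreal ((norm (X' n x - X x))\<^sup>2) \<partial>M) \<le> (\<integral>\<^sup>+x. ennreal (K\<^sup>2) * ennreal ((norm (Y' n x - Y x))\<^sup>2) \<partial>M)"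
      using power_mono[OF le norm_ge_zero, where n = 2]
      by (intro nn_integral_mono) (simp add: power_mult_distrib ennreal_leI flip: ennreal_mult)
    then show ?thesis by (simp add: nn_integral_cmult)
  qed
  then show "\<forall>\<^sub>F n in sequentially. (\<integral>\<^sup>+x. ennreal ((norm (X' n x - X x))\<^sup>2) \<partial>M) \<le>
      ennreal (K\<^sup>2) * (\<integral>\<^sup>+x. ennreal ((norm (Y' n x - Y x))\<^sup>2) \<partial>M)"
    by simp
qed simp

section \<open>Linearity of the stochastic integral\<close>

lemma has_stoch_integral_zero:
  "has_stoch_integral M U (\<lambda>_. 0 :: complex^'m^'p) (\<lambda>_. 0)"
  unfolding has_stoch_integral_def
  by (intro conjI exI[of _ "\<lambda>_. []"]) (simp_all add: step_fun_def step_integral_def)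

lemma has_stoch_integral_add:
  fixes g h :: "real \<Rightarrow> complex^'m^'p"
  assumes U: "\<And>t. U t \<in> borel_measurable M"
    and "has_stoch_integral M U g X" "has_stoch_integral M U h Y"
  shows "has_stoch_integral M U (\<lambda>\<tau>. g \<tau> + h \<tau>) (\<lambda>x. X x + Y x)"
proof -
  have [measurable]: "g \<in> borel_measurable borel" "h \<in> borel_measurable borel"
      "X \<in> borel_measurable M" "Y \<in> borel_measurable M"
    and int: "integrable lborel (\<lambda>\<tau>. (norm (g \<tau>))\<^sup>2)" "integrable lborel (\<lambda>\<tau>. (norm (h \<tau>))\<^sup>2)"
    using assms(2,3) by (auto simp: has_stoch_integral_def)
  obtain S where S: "\<And>n. \<forall>(a, b, A)\<in>set (S n). a \<le> b"
      "(\<lambda>n. \<integral>\<^sup>+\<tau>. ennreal ((norm (step_fun (S n) \<tau> - g \<tau>))\<^sup>2) \<partial>lborel) \<longlonglongrightarrow> 0"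
      "(\<lambda>n. \<integral>\<^sup>+x. ennreal ((norm (step_integral U (S n) x - X x))\<^sup>2) \<partial>M) \<longlonglongrightarrow> 0"
    using assms(2) unfolding has_stoch_integral_def by blast
  obtain R where R: "\<And>n. \<forall>(a, b, A)\<in>set (R n). a \<le> b"
      "(\<lambda>n. \<integral>\<^sup>+\<tau>. ennreal ((norm (step_fun (R n) \<tau> - h \<tau>))\<^sup>2) \<partial>lborel) \<longlonglongrightarrow> 0"
      "(\<lambda>n. \<integral>\<^sup>+x. ennreal ((norm (step_integral U (R n) x - Y x))\<^sup>2) \<partial>M) \<longlonglongrightarrow> 0"
    using assms(3) unfolding has_stoch_integral_def by blast
  have [measurable]: "step_integral U T \<in> borel_measurable M" for T :: "('m, 'p) steps"
    by (intro borel_measurable_step_integral borel_measurable_diff U)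
  have "integrable lborel (\<lambda>\<tau>. (norm (g \<tau> + h \<tau>))\<^sup>2)"
  proof (rule Bochner_Integration.integrable_bound)
    show "integrable lborel (\<lambda>\<tau>. 2 * (norm (g \<tau>))\<^sup>2 + 2 * (norm (h \<tau>))\<^sup>2)"
      using int by simp
    show "AE \<tau> in lborel. norm ((norm (g \<tau> + h \<tau>))\<^sup>2) \<le> norm (2 * (norm (g \<tau>))\<^sup>2 + 2 * (norm (h \<tau>))\<^sup>2)"
    proof (intro AE_I2)
      show "norm ((norm (g \<tau> + h \<tau>))\<^sup>2) \<le> norm (2 * (norm (g \<tau>))\<^sup>2 + 2 * (norm (h \<tau>))\<^sup>2)" for \<tau>
        using norm_sq_le_weighted[of 1 "g \<tau> + h \<tau>" "g \<tau>"] by simp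
    qed
  qed measurable
  moreover have "\<forall>(a, b, A)\<in>set (S n @ R n). a \<le> b" for n
    using S(1)[of n] R(1)[of n] by (simp add: ball_Un)
  ultimately show ?thesis
    unfolding has_stoch_integral_def
  proof (intro conjI exI[of _ "\<lambda>n. S n @ R n"])
    show "(\<lambda>n. \<integral>\<^sup>+\<tau>. ennreal ((norm (step_fun (S n @ R n) \<tau> - (g \<tau> + h \<tau>)))\<^sup>2) \<partial>lborel) \<longlonglongrightarrow> 0"
      unfolding step_fun_append by (intro mean_square_tendsto_add S R) auto
    show "(\<lambda>n. \<integral>\<^sup>+x. ennreal ((norm (step_integral U (S n @ R n) x - (X x + Y x)))\<^sup>2) \<partial>M) \<longlonglongrightarrow> 0"
      unfolding step_integral_append by (intro mean_square_tendsto_add S R) auto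
  qed auto
qed

lemma has_stoch_integral_mult:
  fixes A :: "complex^'k^'p" and g :: "real \<Rightarrow> complex^'m^'k"
  assumes U: "\<And>t. U t \<in> borel_measurable M" and "has_stoch_integral M U g X"
  shows "has_stoch_integral M U (\<lambda>\<tau>. A ** g \<tau>) (\<lambda>x. A *v X x)"
proof -
  have [measurable]: "g \<in> borel_measurable borel" "X \<in> borel_measurable M"
    and int: "integrable lborel (\<lambda>\<tau>. (norm (g \<tau>))\<^sup>2)"
    using assms(2) by (auto simp: has_stoch_integral_def)
  obtain S where S: "\<And>n. \<forall>(a, b, A)\<in>set (S n). a \<le> b"
      "(\<lambda>n. \<integral>\<^sup>+\<tau>. ennreal ((norm (step_fun (S n) \<tau> - g \<tau>))\<^sup>2) \<partial>lborel) \<longlonglongrightarrow> 0"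
      "(\<lambda>n. \<integral>\<^sup>+x. ennreal ((norm (step_integral U (S n) x - X x))\<^sup>2) \<partial>M) \<longlonglongrightarrow> 0"
    using assms(2) unfolding has_stoch_integral_def by blast
  have [measurable]: "step_integral U T \<in> borel_measurable M" for T :: "('m, 'k) steps"
    by (intro borel_measurable_step_integral borel_measurable_diff U)
  have "integrable lborel (\<lambda>\<tau>. (norm (A ** g \<tau>))\<^sup>2)"
  proof (rule Bochner_Integration.integrable_bound)
    show "integrable lborel (\<lambda>\<tau>. (norm A)\<^sup>2 * (norm (g \<tau>))\<^sup>2)"
      using int by simp
    show "AE \<tau> in lborel. norm ((norm (A ** g \<tau>))\<^sup>2) \<le> norm ((norm A)\<^sup>2 * (norm (g \<tau>))\<^sup>2)"
      using power_mono[OF norm_matrix_mult_le norm_ge_zero, where n = 2]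
      by (intro AE_I2) (simp add: power_mult_distrib)
  qed measurable
  moreover have "norm (A ** step_fun T \<tau> - A ** g \<tau>) \<le> norm A * norm (step_fun T \<tau> - g \<tau>)" for T :: "('m, 'k) steps" and \<tau>
  proof -
    have "A ** step_fun T \<tau> - A ** g \<tau> = A ** (step_fun T \<tau> - g \<tau>)"
      by (simp add: vec_eq_iff matrix_matrix_mult_def right_diff_distrib sum_subtractf)
    then show ?thesis by (simp add: norm_matrix_mult_le)
  qed
  then have "(\<lambda>n. \<integral>\<^sup>+\<tau>. ennreal ((norm (A ** step_fun (S n) \<tau> - A ** g \<tau>))\<^sup>2) \<partial>lborel) \<longlonglongrightarrow> 0"
    by (intro mean_square_tendsto_bound[OF _ _ _ S(2)]) auto
  moreover have "norm (A *v step_integral U T x - A *v X x) \<le> norm A * norm (step_integral U T x - X x)" for T :: "('m, 'k) steps" and x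
    using norm_matrix_vector_mult_le[of A "step_integral U T x - X x"] by (simp add: matrix_vector_mult_diff_distrib)
  then have "(\<lambda>n. \<integral>\<^sup>+x. ennreal ((norm (A *v step_integral U (S n) x - A *v X x))\<^sup>2) \<partial>M) \<longlonglongrightarrow> 0"
    by (intro mean_square_tendsto_bound[OF _ _ _ S(3)]) auto
  moreover have "\<forall>(a, b, C)\<in>set (map (\<lambda>(a, b, B). (a, b, A ** B)) (S n)). a \<le> b" for n
    using S(1)[of n] by fastforce
  ultimately show ?thesis
    unfolding has_stoch_integral_def
    by (intro conjI exI[of _ "\<lambda>n. map (\<lambda>(a, b, B). (a, b, A ** B)) (S n)"])
      (auto simp: step_fun_map_mult step_integral_map_mult simp del: set_map)
qed

text \<open>Lets a step integral against a process with correlated increments be treated as one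
  integral against \<open>U\<close>, provided each increment is such an integral. It is applied with
  a Wiener process for \<open>U\<close> and the filtered process for \<open>W\<close>.\<close>

lemma has_stoch_integral_step_integral:
  fixes S :: "('k::finite, 'p::finite) steps" and g :: "real \<Rightarrow> real \<Rightarrow> real \<Rightarrow> complex^'m^'k"
  assumes U: "\<And>t. U t \<in> borel_measurable M"
    and S: "\<And>a b A. (a, b, A) \<in> set S \<Longrightarrow> has_stoch_integral M U (g a b) (\<lambda>x. W b x - W a x)"
  shows "has_stoch_integral M U (\<lambda>\<tau>. \<Sum>(a, b, A)\<leftarrow>S. A ** g a b \<tau>) (step_integral W S)"
  using S
proof (induction S)
  case Nil
  then show ?case
    using has_stoch_integral_zero[of M U] by (simp add: step_integral_def[abs_def])
next
  case (Cons q S)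
  obtain a b A where q: "q = (a, b, A)" by (cases q)
  have "has_stoch_integral M U (\<lambda>\<tau>. A ** g a b \<tau> + (\<Sum>(a, b, A)\<leftarrow>S. A ** g a b \<tau>))
      (\<lambda>x. A *v (W b x - W a x) + step_integral W S x)"
    using Cons q by (intro has_stoch_integral_add has_stoch_integral_mult U) auto
  then show ?case
    by (simp add: q step_integral_def[abs_def])
qed

lemma wiener_stoch_integral_norm_sq_le:
  fixes V :: "real \<Rightarrow> 'a \<Rightarrow> real^'m" and g :: "real \<Rightarrow> complex^'m^'p"
  assumes wiener: "standard_wiener M V"
    and X: "has_stoch_integral M (\<lambda>\<tau> x. of_real_vec (V \<tau> x)) g X"
  shows "(\<integral>\<^sup>+x. ennreal ((norm (X x))\<^sup>2) \<partial>M) \<le> (\<integral>\<^sup>+\<tau>. ennreal ((norm (g \<tau>))\<^sup>2) \<partial>lborel)"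
proof -
  obtain S where S: "\<And>n. \<forall>(a, b, A)\<in>set (S n). a \<le> b"
      "(\<lambda>n. \<integral>\<^sup>+\<tau>. ennreal ((norm (step_fun (S n) \<tau> - g \<tau>))\<^sup>2) \<partial>lborel) \<longlonglongrightarrow> 0"
      "(\<lambda>n. \<integral>\<^sup>+x. ennreal ((norm (step_integral (\<lambda>\<tau> x. of_real_vec (V \<tau> x)) (S n) x - X x))\<^sup>2) \<partial>M) \<longlonglongrightarrow> 0"
    using X unfolding has_stoch_integral_def by blast
  have "(\<integral>\<^sup>+x. ennreal ((norm (X x))\<^sup>2) \<partial>M) \<le> ennreal 1 * (\<integral>\<^sup>+\<tau>. ennreal ((norm (g \<tau>))\<^sup>2) \<partial>lborel)"
  proof (rule mean_square_limit_le[OF _ _ _ _ S(3,2)])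
    show "X \<in> borel_measurable M" "g \<in> borel_measurable lborel"
      using X by (auto simp: has_stoch_integral_def)
    show "step_integral (\<lambda>\<tau> x. of_real_vec (V \<tau> x)) (S n) \<in> borel_measurable M" for n
      by (intro borel_measurable_step_integral borel_measurable_diff borel_measurable_of_real_vec wiener_measurable[OF wiener])
    show "step_fun (S n) \<in> borel_measurable lborel" for n
      by simp
    show "(\<integral>\<^sup>+x. ennreal ((norm (step_integral (\<lambda>\<tau> x. of_real_vec (V \<tau> x)) (S n) x))\<^sup>2) \<partial>M) \<le>
        ennreal 1 * (\<integral>\<^sup>+\<tau>. ennreal ((norm (step_fun (S n) \<tau>))\<^sup>2) \<partial>lborel)" for n
      using wiener_step_integral_isometry[OF wiener S(1)] by simp
  qed simp
  then show ?thesis by simp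
qed

section \<open>Transforms of matrix-valued functions\<close>

lemma borel_measurable_matrix_components:
  fixes f :: "'a \<Rightarrow> complex^'m^'p"
  assumes "\<And>i j. (\<lambda>x. f x $ i $ j) \<in> borel_measurable M"
  shows "f \<in> borel_measurable M"
proof -
  have "(\<lambda>x. f x $ i $ j \<bullet> u) \<in> borel_measurable M" for i j u
    using assms[of i j] by measurable
  then show ?thesis
    by (subst borel_measurable_euclidean_space) (auto simp: Basis_vec_def inner_axis)
qed

lemma borel_measurable_matrix_nth [measurable (raw)]:
  fixes f :: "'a \<Rightarrow> complex^'m^'p"
  assumes "f \<in> borel_measurable M"
  shows "(\<lambda>x. f x $ i $ j) \<in> borel_measurable M"
  by (rule borel_measurable_continuous_on[OF _ assms]) (intro continuous_intros)

definition cscale :: "complex \<Rightarrow> complex^'m^'p \<Rightarrow> complex^'m^'p" where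
  "cscale z A = (\<chi> i j. z * A $ i $ j)"

lemma cscale_nth [simp]: "cscale z A $ i $ j = z * A $ i $ j"
  by (simp add: cscale_def)

lemma norm_cscale: "norm (cscale z A) = cmod z * norm A"
proof -
  have "(norm (cscale z A))\<^sup>2 = (cmod z * norm A)\<^sup>2"
    by (simp add: norm_matrix_sq power_mult_distrib norm_mult sum_distrib_left)
  then show ?thesis by (simp add: power2_eq_iff_nonneg)
qed

lemma cscale_mult_left:
  fixes A :: "complex^'m^'p" and B :: "complex^'k^'m"
  shows "cscale z A ** B = cscale z (A ** B)"
  by (simp add: vec_eq_iff matrix_matrix_mult_def sum_distrib_left mult.assoc)

lemma cscale_mult_right:
  fixes A :: "complex^'m^'p" and B :: "complex^'k^'m"
  shows "A ** cscale z B = cscale z (A ** B)"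
  by (simp add: vec_eq_iff matrix_matrix_mult_def sum_distrib_left mult_ac)

definition mintegrable :: "(real \<Rightarrow> complex^'m^'p) \<Rightarrow> bool" where
  "mintegrable u \<longleftrightarrow> (\<forall>i j. integrable lborel (\<lambda>\<tau>. u \<tau> $ i $ j))"

text \<open>In contrast to \<open>fourier\<close>, the sign in the exponent is positive: time is reversed in the
  convolution with the filter.\<close>

definition mfourier :: "(real \<Rightarrow> complex^'m^'p) \<Rightarrow> real \<Rightarrow> complex^'m^'p" where
  "mfourier u w = (\<chi> i j. \<integral>\<tau>. cis (w * \<tau>) * u \<tau> $ i $ j \<partial>lborel)"

lemma mfourier_eq_fourier: "mfourier u w $ i $ j = fourier (\<lambda>\<tau>. u \<tau> $ i $ j) (- w)"
  by (simp add: mfourier_def fourier_def)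

lemma borel_measurable_mfourier [measurable]:
  assumes [measurable]: "u \<in> borel_measurable borel"
  shows "mfourier u \<in> borel_measurable borel"
proof (rule borel_measurable_matrix_components)
  show "(\<lambda>w. mfourier u w $ i $ j) \<in> borel_measurable borel" for i j
    unfolding mfourier_eq_fourier by measurable
qed

lemma mintegrable_measurable: "mintegrable u \<Longrightarrow> u \<in> borel_measurable borel"
  by (rule borel_measurable_matrix_components) (use borel_measurable_integrable in \<open>force simp: mintegrable_def\<close>)

lemma mintegrable_add: "mintegrable u \<Longrightarrow> mintegrable v \<Longrightarrow> mintegrable (\<lambda>\<tau>. u \<tau> + v \<tau>)"
  by (simp add: mintegrable_def)

lemma mintegrable_diff: "mintegrable u \<Longrightarrow> mintegrable v \<Longrightarrow> mintegrable (\<lambda>\<tau>. u \<tau> - v \<tau>)"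
  by (simp add: mintegrable_def)

lemma mintegrable_mult:
  fixes A :: "complex^'m^'p" and u :: "real \<Rightarrow> complex^'k^'m"
  shows "mintegrable u \<Longrightarrow> mintegrable (\<lambda>\<tau>. A ** u \<tau>)"
  by (simp add: mintegrable_def matrix_matrix_mult_def)

lemma mfourier_add:
  "mintegrable u \<Longrightarrow> mintegrable v \<Longrightarrow> mfourier (\<lambda>\<tau>. u \<tau> + v \<tau>) w = mfourier u w + mfourier v w"
  by (simp add: mintegrable_def mfourier_def vec_eq_iff distrib_left integrable_cis_mult)

lemma mfourier_diff:
  "mintegrable u \<Longrightarrow> mintegrable v \<Longrightarrow> mfourier (\<lambda>\<tau>. u \<tau> - v \<tau>) w = mfourier u w - mfourier v w"
  by (simp add: mintegrable_def mfourier_def vec_eq_iff right_diff_distrib integrable_cis_mult)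

lemma mfourier_mult:
  fixes A :: "complex^'m^'p" and u :: "real \<Rightarrow> complex^'k^'m"
  assumes "mintegrable u"
  shows "mfourier (\<lambda>\<tau>. A ** u \<tau>) w = A ** mfourier u w"
proof -
  have int: "integrable lborel (\<lambda>\<tau>. cis (w * \<tau>) * u \<tau> $ l $ j)" for l j
    using assms by (simp add: mintegrable_def integrable_cis_mult)
  have "(\<integral>\<tau>. cis (w * \<tau>) * (A ** u \<tau>) $ i $ j \<partial>lborel) = (A ** mfourier u w) $ i $ j" for i j
  proof -
    have "(\<integral>\<tau>. cis (w * \<tau>) * (A ** u \<tau>) $ i $ j \<partial>lborel) = (\<integral>\<tau>. (\<Sum>l\<in>UNIV. A $ i $ l * (cis (w * \<tau>) * u \<tau> $ l $ j)) \<partial>lborel)"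
      by (simp add: matrix_matrix_mult_def sum_distrib_left mult_ac)
    also have "\<dots> = (\<Sum>l\<in>UNIV. A $ i $ l * (\<integral>\<tau>. cis (w * \<tau>) * u \<tau> $ l $ j \<partial>lborel))"
      using int by simp
    finally show ?thesis
      by (simp add: matrix_matrix_mult_def mfourier_def)
  qed
  then show ?thesis
    by (simp add: vec_eq_iff mfourier_def)
qed

lemma nn_integral_norm_matrix_sq:
  fixes u :: "'a \<Rightarrow> complex^'m^'p"
  assumes [measurable]: "u \<in> borel_measurable M"
  shows "(\<integral>\<^sup>+x. ennreal ((norm (u x))\<^sup>2) \<partial>M) = (\<Sum>i\<in>UNIV. \<Sum>j\<in>UNIV. \<integral>\<^sup>+x. ennreal ((cmod (u x $ i $ j))\<^sup>2) \<partial>M)"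
  unfolding norm_matrix_sq by (simp add: sum_nonneg nn_integral_sum flip: sum_ennreal)

lemma nn_integral_mfourier_nth:
  assumes [measurable]: "u \<in> borel_measurable borel"
  shows "(\<integral>\<^sup>+w. ennreal ((cmod (mfourier u w $ i $ j))\<^sup>2) \<partial>lborel) = (\<integral>\<^sup>+w. ennreal ((cmod (fourier (\<lambda>\<tau>. u \<tau> $ i $ j) w))\<^sup>2) \<partial>lborel)"
  unfolding mfourier_eq_fourier
  using nn_integral_real_affine[of "\<lambda>w. ennreal ((cmod (fourier (\<lambda>\<tau>. u \<tau> $ i $ j) w))\<^sup>2)" "-1" 0] by simp

lemma mfourier_norm_sq_le:
  assumes u: "mintegrable u"
  shows "(\<integral>\<^sup>+w. ennreal ((norm (mfourier u w))\<^sup>2) \<partial>lborel) \<le> ennreal (2 * pi) * (\<integral>\<^sup>+\<tau>. ennreal ((norm (u \<tau>))\<^sup>2) \<partial>lborel)"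
proof -
  have [measurable]: "u \<in> borel_measurable borel"
    by (rule mintegrable_measurable[OF u])
  show ?thesis
    using u by (simp add: nn_integral_norm_matrix_sq nn_integral_mfourier_nth sum_distrib_left mintegrable_def)
      (intro sum_mono fourier_norm_sq_le, simp)
qed

lemma mfourier_norm_sq_ge:
  fixes u :: "real \<Rightarrow> complex^'m^'p"
  assumes u: "mintegrable u" and v: "\<And>n. mintegrable (v n)" "\<And>n. bounded (range (v n))"
      "\<And>n. AE \<tau> in lborel. isCont (v n) \<tau>"
    and lim: "(\<lambda>n. \<integral>\<^sup>+\<tau>. ennreal ((norm (v n \<tau> - u \<tau>))\<^sup>2) \<partial>lborel) \<longlonglongrightarrow> 0"
  shows "(\<integral>\<^sup>+\<tau>. ennreal ((norm (u \<tau>))\<^sup>2) \<partial>lborel) \<le> ennreal (1 / (2 * pi)) * (\<integral>\<^sup>+w. ennreal ((norm (mfourier u w))\<^sup>2) \<partial>lborel)"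
proof -
  have [measurable]: "u \<in> borel_measurable borel" "\<And>n. v n \<in> borel_measurable borel"
    using u v by (auto intro: mintegrable_measurable)
  have comp: "cmod (A $ i $ j) \<le> norm A" for A :: "complex^'m^'p" and i j
    by (rule order_trans[OF Finite_Cartesian_Product.norm_nth_le Finite_Cartesian_Product.norm_nth_le])
  have "(\<integral>\<^sup>+\<tau>. ennreal ((cmod (u \<tau> $ i $ j))\<^sup>2) \<partial>lborel) \<le>
      ennreal (1 / (2 * pi)) * (\<integral>\<^sup>+w. ennreal ((cmod (fourier (\<lambda>\<tau>. u \<tau> $ i $ j) w))\<^sup>2) \<partial>lborel)" for i j
  proof (rule fourier_norm_sq_ge[where v = "\<lambda>n \<tau>. v n \<tau> $ i $ j"])
    show "integrable lborel (\<lambda>\<tau>. u \<tau> $ i $ j)" "\<And>n. integrable lborel (\<lambda>\<tau>. v n \<tau> $ i $ j)"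
      using u v(1) by (auto simp: mintegrable_def)
    show "bounded (range (\<lambda>\<tau>. v n \<tau> $ i $ j))" for n
    proof -
      obtain B where "\<And>\<tau>. norm (v n \<tau>) \<le> B"
        using v(2)[of n] by (auto simp: bounded_iff)
      then have "cmod (v n \<tau> $ i $ j) \<le> B" for \<tau>
        using comp order_trans by blast
      then show ?thesis by (auto simp: bounded_iff)
    qed
    show "AE \<tau> in lborel. isCont (\<lambda>\<tau>. v n \<tau> $ i $ j) \<tau>" for n
      using v(3)[of n] by eventually_elim (intro continuous_intros)
    show "(\<lambda>n. \<integral>\<^sup>+\<tau>. ennreal ((cmod (v n \<tau> $ i $ j - u \<tau> $ i $ j))\<^sup>2) \<partial>lborel) \<longlonglongrightarrow> 0"
    proof (rule mean_square_tendsto_bound[OF _ _ _ lim])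
      show "cmod (v n \<tau> $ i $ j - u \<tau> $ i $ j) \<le> 1 * norm (v n \<tau> - u \<tau>)" for n \<tau>
        using comp[of "v n \<tau> - u \<tau>" i j] by simp
    qed simp_all
  qed
  then show ?thesis
    by (simp add: nn_integral_norm_matrix_sq nn_integral_mfourier_nth sum_distrib_left)
      (intro sum_mono, simp)
qed

lemma mean_square_tendsto_dominated:
  fixes X :: "'a \<Rightarrow> 'b::{real_normed_vector, second_countable_topology}"
  assumes [measurable]: "X \<in> borel_measurable M" "\<And>n. X' n \<in> borel_measurable M" "G \<in> borel_measurable M"
    and lim: "AE x in M. (\<lambda>n. X' n x) \<longlonglongrightarrow> X x"
    and le: "\<And>n. AE x in M. norm (X' n x - X x) \<le> norm (G x :: 'c::{real_normed_vector, second_countable_topology})"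
    and fin: "(\<integral>\<^sup>+x. ennreal ((norm (G x))\<^sup>2) \<partial>M) < \<infinity>"
  shows "(\<lambda>n. \<integral>\<^sup>+x. ennreal ((norm (X' n x - X x))\<^sup>2) \<partial>M) \<longlonglongrightarrow> 0"
proof -
  have "(\<lambda>n. \<integral>\<^sup>+x. ennreal ((norm (X' n x - X x))\<^sup>2) \<partial>M) \<longlonglongrightarrow> (\<integral>\<^sup>+x. 0 \<partial>M)"
  proof (rule nn_integral_dominated_convergence[OF _ _ _ _ fin])
    show "AE x in M. ennreal ((norm (X' n x - X x))\<^sup>2) \<le> ennreal ((norm (G x))\<^sup>2)" for n
      using le[of n] by eventually_elim (simp add: ennreal_leI power_mono)
    show "AE x in M. (\<lambda>n. ennreal ((norm (X' n x - X x))\<^sup>2)) \<longlonglongrightarrow> 0"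
      using lim
    proof eventually_elim
      case (elim x)
      then have "(\<lambda>n. X' n x - X x) \<longlonglongrightarrow> 0"
        by (simp add: LIM_zero)
      then have "(\<lambda>n. ennreal ((norm (X' n x - X x))\<^sup>2)) \<longlonglongrightarrow> ennreal ((norm (0 :: 'b))\<^sup>2)"
        by (intro tendsto_ennrealI tendsto_power tendsto_norm)
      then show ?case by simp
    qed
  qed auto
  then show ?thesis by simp
qed

section \<open>The response of a filter to step functions\<close>

lemma exp_Complex_mult: "exp (Complex x w * complex_of_real \<tau>) = of_real (exp (x * \<tau>)) * cis (w * \<tau>)"
  by (simp add: Complex_eq distrib_right exp_add cis_conv_exp mult.assoc flip: exp_of_real)

lemma integral_reflect:
  fixes f :: "real \<Rightarrow> complex"
  shows "(\<integral>\<tau>. f (b - \<tau>) \<partial>lborel) = (\<integral>\<tau>. f \<tau> \<partial>lborel)"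
  using lborel_integral_real_affine[of "-1" f b] by simp

lemma integrable_reflect:
  fixes f :: "real \<Rightarrow> complex"
  assumes "integrable lborel f"
  shows "integrable lborel (\<lambda>\<tau>. f (b - \<tau>))"
  using lborel_integrable_real_affine[OF assms, of "-1" b] by simp

text \<open>Under the time reversal \<open>\<tau> = b - z\<close> the growing weight
  \<open>exp (x * \<tau>)\<close> becomes a constant times the decaying weight of the Laplace
  integral. As \<open>k\<close> vanishes at negative times, that integral extends over the whole
  line.\<close>

lemma step_response_transform:
  fixes k :: "real \<Rightarrow> complex^'m^'p"
  assumes k: "step_response \<Gamma> k" and x: "0 < x"
  shows "mintegrable (\<lambda>\<tau>. exp (x * \<tau>) *\<^sub>R k (b - \<tau>))"
    and "mfourier (\<lambda>\<tau>. exp (x * \<tau>) *\<^sub>R k (b - \<tau>)) w = cscale (exp (Complex x w * b) / Complex x w) (\<Gamma> (Complex x w))"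
proof -
  define L where "L w i j z = exp (- Complex x w * complex_of_real z) * k z $ i $ j" for w i j z
  have L0: "indicator {0..} z *\<^sub>R L w i j z = L w i j z" for w i j z
    using k by (cases "0 \<le> z") (auto simp: L_def step_response_def)
  have Lint: "integrable lborel (L w i j)" for w i j
  proof -
    have "set_integrable lborel {0..} (L w i j)"
      using k x unfolding step_response_def L_def by simp
    then show ?thesis
      by (simp add: set_integrable_def L0)
  qed
  have Lval: "(\<integral>z. L w i j z \<partial>lborel) = \<Gamma> (Complex x w) $ i $ j / Complex x w" for w i j
  proof -
    have "laplace k (Complex x w) $ i $ j = (LBINT z:{0..}. L w i j z)"
      by (simp add: laplace_def L_def)
    also have "\<dots> = (\<integral>z. L w i j z \<partial>lborel)"
      unfolding set_lebesgue_integral_def L0 ..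
    finally show ?thesis
      using k x by (simp add: step_response_def map_matrix_def)
  qed
  have eq: "cis (w * \<tau>) * (exp (x * \<tau>) *\<^sub>R k (b - \<tau>)) $ i $ j = exp (Complex x w * b) * L w i j (b - \<tau>)" for w \<tau> i j
  proof -
    have "exp (Complex x w * b) * exp (- Complex x w * complex_of_real (b - \<tau>)) = exp (Complex x w * complex_of_real \<tau>)"
      by (simp add: algebra_simps flip: exp_add)
    then have "exp (Complex x w * b) * L w i j (b - \<tau>) = exp (Complex x w * complex_of_real \<tau>) * k (b - \<tau>) $ i $ j"
      by (simp only: L_def mult.assoc[symmetric])
    then show ?thesis
      unfolding vector_scaleR_component scaleR_conv_of_real[where 'a = complex] exp_Complex_mult
      by (simp only: mult_ac)
  qed
  have eq0: "(exp (x * \<tau>) *\<^sub>R k (b - \<tau>)) $ i $ j = exp (Complex x 0 * b) * L 0 i j (b - \<tau>)" for \<tau> i j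
    using eq[of 0 \<tau> i j] by simp
  show "mintegrable (\<lambda>\<tau>. exp (x * \<tau>) *\<^sub>R k (b - \<tau>))"
    unfolding mintegrable_def eq0 by (intro allI integrable_mult_right integrable_reflect Lint)
  have "(\<integral>\<tau>. cis (w * \<tau>) * (exp (x * \<tau>) *\<^sub>R k (b - \<tau>)) $ i $ j \<partial>lborel) = exp (Complex x w * b) * (\<Gamma> (Complex x w) $ i $ j / Complex x w)" for i j
    unfolding eq integral_mult_right_zero integral_reflect Lval ..
  then show "mfourier (\<lambda>\<tau>. exp (x * \<tau>) *\<^sub>R k (b - \<tau>)) w = cscale (exp (Complex x w * b) / Complex x w) (\<Gamma> (Complex x w))"
    by (simp add: vec_eq_iff mfourier_def)
qed

lemma integral_exp_Ioc:
  assumes "a \<le> b" "s \<noteq> 0"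
  shows "integrable lborel (\<lambda>\<tau>. indicat_real {a<..b} \<tau> *\<^sub>R exp (s * complex_of_real \<tau>))"
    and "(\<integral>\<tau>. indicat_real {a<..b} \<tau> *\<^sub>R exp (s * complex_of_real \<tau>) \<partial>lborel) = (exp (s * b) - exp (s * a)) / s"
proof -
  have D: "((\<lambda>\<tau>. exp (s * complex_of_real \<tau>) / s) has_vector_derivative exp (s * complex_of_real \<tau>)) (at \<tau> within {a..b})" for \<tau>
    using assms(2) by (auto intro!: has_vector_derivative_real_field derivative_eq_intros)
  have C: "continuous_on {a..b} (\<lambda>\<tau>. exp (s * complex_of_real \<tau>))"
    by (intro continuous_intros)
  have H: "has_bochner_integral lborel (\<lambda>\<tau>. indicat_real {a..b} \<tau> *\<^sub>R exp (s * complex_of_real \<tau>)) (exp (s * b) / s - exp (s * a) / s)"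
    by (rule has_bochner_integral_FTC_Icc[OF assms(1) D C])
  have AE: "AE \<tau> in lborel. indicat_real {a..b} \<tau> *\<^sub>R exp (s * complex_of_real \<tau>) = indicat_real {a<..b} \<tau> *\<^sub>R exp (s * complex_of_real \<tau>)"
    using AE_lborel_singleton[of a] by eventually_elim (auto simp: indicator_def)
  have "has_bochner_integral lborel (\<lambda>\<tau>. indicat_real {a<..b} \<tau> *\<^sub>R exp (s * complex_of_real \<tau>)) (exp (s * b) / s - exp (s * a) / s)"
    by (rule iffD1[OF has_bochner_integral_cong_AE[OF _ _ AE] H]) measurable
  then show "integrable lborel (\<lambda>\<tau>. indicat_real {a<..b} \<tau> *\<^sub>R exp (s * complex_of_real \<tau>))"
    "(\<integral>\<tau>. indicat_real {a<..b} \<tau> *\<^sub>R exp (s * complex_of_real \<tau>) \<partial>lborel) = (exp (s * b) - exp (s * a)) / s"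
    by (auto simp: has_bochner_integral_iff diff_divide_distrib)
qed

lemma indicator_transform:
  fixes A :: "complex^'m^'p"
  assumes "a \<le> b" "0 < x"
  shows "mintegrable (\<lambda>\<tau>. exp (x * \<tau>) *\<^sub>R indicat_real {a<..b} \<tau> *\<^sub>R A)"
    and "mfourier (\<lambda>\<tau>. exp (x * \<tau>) *\<^sub>R indicat_real {a<..b} \<tau> *\<^sub>R A) w =
      cscale (exp (Complex x w * b) / Complex x w - exp (Complex x w * a) / Complex x w) A"
proof -
  have nz: "Complex x w \<noteq> 0" for w
    using assms(2) by (simp add: complex_eq_iff)
  have eq: "cis (w * \<tau>) * (exp (x * \<tau>) *\<^sub>R indicat_real {a<..b} \<tau> *\<^sub>R A) $ i $ j =
      (indicat_real {a<..b} \<tau> *\<^sub>R exp (Complex x w * complex_of_real \<tau>)) * A $ i $ j" for w \<tau> i j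
    unfolding exp_Complex_mult vector_scaleR_component scaleR_conv_of_real[where 'a = complex]
    by (simp only: mult_ac)
  have eq0: "(exp (x * \<tau>) *\<^sub>R indicat_real {a<..b} \<tau> *\<^sub>R A) $ i $ j =
      (indicat_real {a<..b} \<tau> *\<^sub>R exp (Complex x 0 * complex_of_real \<tau>)) * A $ i $ j" for \<tau> i j
    using eq[of 0 \<tau> i j] by simp
  show "mintegrable (\<lambda>\<tau>. exp (x * \<tau>) *\<^sub>R indicat_real {a<..b} \<tau> *\<^sub>R A)"
    unfolding mintegrable_def eq0 by (intro allI integrable_mult_left integral_exp_Ioc assms(1) nz)
  have "(\<integral>\<tau>. cis (w * \<tau>) * (exp (x * \<tau>) *\<^sub>R indicat_real {a<..b} \<tau> *\<^sub>R A) $ i $ j \<partial>lborel) =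
      (exp (Complex x w * b) - exp (Complex x w * a)) / Complex x w * A $ i $ j" for i j
    unfolding eq integral_mult_left_zero integral_exp_Ioc(2)[OF assms(1) nz] ..
  then show "mfourier (\<lambda>\<tau>. exp (x * \<tau>) *\<^sub>R indicat_real {a<..b} \<tau> *\<^sub>R A) w =
      cscale (exp (Complex x w * b) / Complex x w - exp (Complex x w * a) / Complex x w) A"
    by (simp add: vec_eq_iff mfourier_def diff_divide_distrib)
qed

text \<open>The kernel whose integral against the Wiener process is the integral of the step function
  against the filtered process.\<close>

definition filtered_step ::
  "(real \<Rightarrow> complex^'m^'k) \<Rightarrow> ('k::finite, 'p::finite) steps \<Rightarrow> real \<Rightarrow> complex^'m^'p" where
  "filtered_step k S \<tau> = (\<Sum>(a, b, A)\<leftarrow>S. A ** (k (b - \<tau>) - k (a - \<tau>)))"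

lemma matrix_mult_add_left:
  fixes A B :: "complex^'m^'p" and C :: "complex^'k^'m"
  shows "(A + B) ** C = A ** C + B ** C"
  by (simp add: vec_eq_iff matrix_matrix_mult_def distrib_right sum.distrib)

lemma mfourier_zero: "mfourier (\<lambda>\<tau>. 0) w = 0"
  by (simp add: mfourier_def vec_eq_iff)

text \<open>The transform of \<open>k (b - \<tau>) - k (a - \<tau>)\<close> at s is (exp(s b) -
  exp(s a)) / s times \<Gamma>(s), and the first factor is the transform of the indicator of the
  interval. Thus filtering acts as multiplication by the transfer function. The integrability claims
  are carried along because the additivity steps of the induction require them.\<close>

lemma filtered_step_transform:
  fixes k :: "real \<Rightarrow> complex^'m^'k" and S :: "('k::finite, 'p::finite) steps"
  assumes k: "step_response \<Gamma> k" and x: "0 < x" and S: "\<forall>(a, b, A)\<in>set S. a \<le> b"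
  shows "mintegrable (\<lambda>\<tau>. exp (x * \<tau>) *\<^sub>R step_fun S \<tau>) \<and>
    mintegrable (\<lambda>\<tau>. exp (x * \<tau>) *\<^sub>R filtered_step k S \<tau>) \<and>
    mfourier (\<lambda>\<tau>. exp (x * \<tau>) *\<^sub>R filtered_step k S \<tau>) w =
      mfourier (\<lambda>\<tau>. exp (x * \<tau>) *\<^sub>R step_fun S \<tau>) w ** \<Gamma> (Complex x w)"
  using S
proof (induction S)
  case Nil
  have "(0 :: complex^'k^'p) ** B = 0" for B :: "complex^'m^'k"
    by (simp add: vec_eq_iff matrix_matrix_mult_def)
  then show ?case
    by (simp add: step_fun_def filtered_step_def mintegrable_def mfourier_zero)
next
  case (Cons q S)
  obtain a b A where q: "q = (a, b, A)" by (cases q)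
  let ?s = "Complex x w"
  let ?ka = "\<lambda>\<tau>. exp (x * \<tau>) *\<^sub>R k (a - \<tau>)" and ?kb = "\<lambda>\<tau>. exp (x * \<tau>) *\<^sub>R k (b - \<tau>)"
  let ?i = "\<lambda>\<tau>. exp (x * \<tau>) *\<^sub>R indicat_real {a<..b} \<tau> *\<^sub>R A"
  have ab: "a \<le> b" using Cons.prems q by simp
  have IH: "mintegrable (\<lambda>\<tau>. exp (x * \<tau>) *\<^sub>R step_fun S \<tau>)"
      "mintegrable (\<lambda>\<tau>. exp (x * \<tau>) *\<^sub>R filtered_step k S \<tau>)"
      "mfourier (\<lambda>\<tau>. exp (x * \<tau>) *\<^sub>R filtered_step k S \<tau>) w =
        mfourier (\<lambda>\<tau>. exp (x * \<tau>) *\<^sub>R step_fun S \<tau>) w ** \<Gamma> ?s"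
    using Cons by auto
  have s: "exp (x * \<tau>) *\<^sub>R step_fun (q # S) \<tau> = ?i \<tau> + exp (x * \<tau>) *\<^sub>R step_fun S \<tau>" for \<tau>
    by (simp add: q step_fun_def scaleR_add_right)
  have f: "exp (x * \<tau>) *\<^sub>R filtered_step k (q # S) \<tau> = A ** (?kb \<tau> - ?ka \<tau>) + exp (x * \<tau>) *\<^sub>R filtered_step k S \<tau>" for \<tau>
    by (simp add: q filtered_step_def scaleR_add_right matrix_mult_scaleR_right flip: scaleR_diff_right)
  have ints: "mintegrable ?i" "mintegrable ?ka" "mintegrable ?kb"
    by (rule indicator_transform(1)[OF ab x], rule step_response_transform(1)[OF k x], rule step_response_transform(1)[OF k x])
  have int': "mintegrable (\<lambda>\<tau>. A ** (?kb \<tau> - ?ka \<tau>))"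
    by (intro mintegrable_mult mintegrable_diff ints)
  have csd: "cscale z B - cscale z' B = cscale (z - z') B" for z z' and B :: "complex^'m^'k"
    by (simp add: vec_eq_iff left_diff_distrib)
  have "mfourier (\<lambda>\<tau>. exp (x * \<tau>) *\<^sub>R filtered_step k (q # S) \<tau>) w =
      A ** mfourier (\<lambda>\<tau>. ?kb \<tau> - ?ka \<tau>) w + mfourier (\<lambda>\<tau>. exp (x * \<tau>) *\<^sub>R filtered_step k S \<tau>) w"
    unfolding f mfourier_add[OF int' IH(2)] mfourier_mult[OF mintegrable_diff[OF ints(3,2)]] ..
  also have "\<dots> = mfourier ?i w ** \<Gamma> ?s + mfourier (\<lambda>\<tau>. exp (x * \<tau>) *\<^sub>R step_fun S \<tau>) w ** \<Gamma> ?s"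
    unfolding mfourier_diff[OF ints(3,2)] step_response_transform(2)[OF k x] indicator_transform(2)[OF ab x] IH(3) csd
      cscale_mult_left cscale_mult_right ..
  also have "\<dots> = mfourier (\<lambda>\<tau>. exp (x * \<tau>) *\<^sub>R step_fun (q # S) \<tau>) w ** \<Gamma> ?s"
    unfolding s mfourier_add[OF ints(1) IH(1)] matrix_mult_add_left ..
  finally show ?case
    unfolding s f using mintegrable_add[OF ints(1) IH(1)] mintegrable_add[OF int' IH(2)] by blast
qed

lemma step_fun_eq_0:
  fixes S :: "('m::finite, 'p::finite) steps"
  assumes "\<And>a b A. (a, b, A) \<in> set S \<Longrightarrow> b \<le> c" "c < \<tau>"
  shows "step_fun S \<tau> = 0"
proof -
  have "indicat_real {a<..b} \<tau> *\<^sub>R A = 0" if "(a, b, A) \<in> set S" for a b A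
    using assms(1)[OF that] assms(2) by simp
  then have "map (\<lambda>(a, b, A). indicat_real {a<..b} \<tau> *\<^sub>R A) S = map (\<lambda>_. 0) S"
    by (intro map_cong refl) (simp only: split_paired_all prod.case)
  then show ?thesis
    unfolding step_fun_def by (simp only: sum_list_0)
qed

text \<open>Causality: beyond \<open>c\<close> all arguments of the step response are negative. This
  bounds the support on the side where the weights \<open>exp (x * \<tau>)\<close> grow.\<close>

lemma filtered_step_eq_0:
  fixes S :: "('k::finite, 'p::finite) steps"
  assumes k: "step_response \<Gamma> k" and "\<And>a b A. (a, b, A) \<in> set S \<Longrightarrow> a \<le> c \<and> b \<le> c" "c < \<tau>"
  shows "filtered_step k S \<tau> = 0"
proof -
  have "k (b - \<tau>) = 0 \<and> k (a - \<tau>) = 0" if "(a, b, A) \<in> set S" for a b A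
  proof -
    have "b - \<tau> < 0" "a - \<tau> < 0"
      using assms(2)[OF that] assms(3) by auto
    then show ?thesis
      using k unfolding step_response_def by blast
  qed
  then have "A ** (k (b - \<tau>) - k (a - \<tau>)) = 0" if "(a, b, A) \<in> set S" for a b A
    using that by (simp add: vec_eq_iff matrix_matrix_mult_def)
  then have "map (\<lambda>(a, b, A). A ** (k (b - \<tau>) - k (a - \<tau>))) S = map (\<lambda>_. 0) S"
    by (intro map_cong refl) (simp only: split_paired_all prod.case)
  then show ?thesis
    unfolding filtered_step_def by (simp only: sum_list_0)
qed

lemma steps_bounded_above:
  fixes S :: "('m::finite, 'p::finite) steps"
  obtains c where "\<And>a b A. (a, b, A) \<in> set S \<Longrightarrow> a \<le> c \<and> b \<le> c"
proof -
  let ?B = "(\<lambda>(a, b, A). max a b) ` set S"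
  have "max a b \<le> Max ?B" if "(a, b, A) \<in> set S" for a b A
    using that by (intro Max_ge) force+
  then show thesis
    using that[of "Max ?B"] by auto
qed

lemma frontier_Ioc_subset: "frontier {a<..b::real} \<subseteq> {a, b}"
proof -
  have "closure {a<..b} \<subseteq> {a..b}"
    by (rule closure_minimal) auto
  moreover have "{a<..<b} \<subseteq> interior {a<..b}"
    by (rule interior_maximal) auto
  ultimately show ?thesis
    by (auto simp: frontier_def)
qed

lemma AE_isCont_step_fun:
  fixes S :: "('m::finite, 'p::finite) steps"
  shows "AE \<tau> in lborel. isCont (step_fun S) \<tau>"
proof -
  let ?B = "\<Union>n<length S. {fst (S ! n), fst (snd (S ! n))}"
  have "?B \<in> null_sets lborel"
    by (intro countable_imp_null_set_lborel countable_finite) auto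
  then have "AE \<tau> in lborel. \<tau> \<notin> ?B"
    by (rule AE_not_in)
  then show ?thesis
  proof eventually_elim
    case (elim \<tau>)
    have "isCont (indicat_real {fst (S ! n)<..fst (snd (S ! n))}) \<tau>" if "n < length S" for n
      using elim that frontier_Ioc_subset unfolding isCont_indicator by fastforce
    then show ?case
      unfolding step_fun_eq_sum[abs_def] by (intro continuous_intros) auto
  qed
qed

lemma bounded_step_fun:
  fixes S :: "('m::finite, 'p::finite) steps"
  shows "\<exists>B. \<forall>\<tau>. norm (step_fun S \<tau>) \<le> B"
proof (intro exI allI)
  show "norm (step_fun S \<tau>) \<le> (\<Sum>n<length S. norm (snd (snd (S ! n))))" for \<tau>
    unfolding step_fun_eq_sum
    by (rule order_trans[OF norm_sum]) (intro sum_mono, simp add: indicator_def)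
qed

lemma mintegrable_step_fun:
  fixes S :: "('m::finite, 'p::finite) steps"
  shows "mintegrable (step_fun S)"
proof -
  have "integrable lborel (\<lambda>\<tau>. indicat_real {a<..b} \<tau> *\<^sub>R z)" for a b :: real and z :: complex
  proof -
    have "emeasure lborel {a<..b} < \<infinity>"
      by (rule emeasure_bounded_finite, rule bounded_subset[of "{a..b}"]) auto
    then show ?thesis
      by (intro integrable_scaleR_left integrable_real_indicator) auto
  qed
  then show ?thesis
    unfolding mintegrable_def step_fun_eq_sum sum_component vector_scaleR_component
    by (intro allI Bochner_Integration.integrable_sum)
qed

lemma mintegrable_bounded_scaleR:
  fixes u :: "real \<Rightarrow> complex^'m^'p"
  assumes u: "mintegrable u" and [measurable]: "r \<in> borel_measurable borel" and r: "\<And>\<tau>. \<bar>r \<tau>\<bar> \<le> C"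
  shows "mintegrable (\<lambda>\<tau>. r \<tau> *\<^sub>R u \<tau>)"
  unfolding mintegrable_def
proof (intro allI, rule Bochner_Integration.integrable_bound)
  have [measurable]: "u \<in> borel_measurable borel"
    by (rule mintegrable_measurable[OF u])
  fix i j
  show "integrable lborel (\<lambda>\<tau>. of_real C * u \<tau> $ i $ j)"
    using u by (simp add: mintegrable_def)
  have "0 \<le> C" using r[of 0] by linarith
  then show "AE \<tau> in lborel. cmod ((r \<tau> *\<^sub>R u \<tau>) $ i $ j) \<le> cmod (of_real C * u \<tau> $ i $ j)"
    by (simp add: norm_mult r mult_right_mono)
  show "(\<lambda>\<tau>. (r \<tau> *\<^sub>R u \<tau>) $ i $ j) \<in> borel_measurable lborel"
    by simp
qed

lemma step_fun_norm_sq_finite: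
  fixes S :: "('m::finite, 'p::finite) steps"
  shows "(\<integral>\<^sup>+\<tau>. ennreal ((norm (step_fun S \<tau>))\<^sup>2) \<partial>lborel) < \<infinity>"
proof -
  obtain B where B: "\<And>\<tau>. norm (step_fun S \<tau>) \<le> B"
    using bounded_step_fun[of S] by blast
  have "integrable lborel (\<lambda>\<tau>. (cmod (step_fun S \<tau> $ i $ j))\<^sup>2)" for i j
  proof (rule Bochner_Integration.integrable_bound)
    show "integrable lborel (\<lambda>\<tau>. B * cmod (step_fun S \<tau> $ i $ j))"
      using mintegrable_step_fun[of S] by (simp add: mintegrable_def)
    have "cmod (step_fun S \<tau> $ i $ j) \<le> B" for \<tau>
      using order_trans[OF order_trans[OF Finite_Cartesian_Product.norm_nth_le Finite_Cartesian_Product.norm_nth_le] B] .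
    then show "AE \<tau> in lborel. norm ((cmod (step_fun S \<tau> $ i $ j))\<^sup>2) \<le> norm (B * cmod (step_fun S \<tau> $ i $ j))"
      by (intro AE_I2) (simp add: power2_eq_square abs_mult mult_mono' order_trans[OF _ abs_ge_self])
  qed simp
  then have "integrable lborel (\<lambda>\<tau>. (norm (step_fun S \<tau>))\<^sup>2)"
    unfolding norm_matrix_sq by (intro Bochner_Integration.integrable_sum)
  then show ?thesis
    by (simp add: nn_integral_eq_integral)
qed

section \<open>Boundary values\<close>

lemma hardy_inf_measurable:
  assumes "hardy_inf \<Gamma>" "0 < x"
  shows "(\<lambda>w. \<Gamma> (Complex x w)) \<in> borel_measurable borel"
proof (rule borel_measurable_matrix_components)
  fix i j
  have "continuous_on {s. 0 < Re s} (\<lambda>s. \<Gamma> s $ i $ j)"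
    using assms(1) by (intro holomorphic_on_imp_continuous_on) (simp add: hardy_inf_def)
  moreover have "continuous_on UNIV (\<lambda>w. Complex x w)"
    unfolding Complex_eq by (intro continuous_intros)
  ultimately have "continuous_on UNIV (\<lambda>w. \<Gamma> (Complex x w) $ i $ j)"
    by (rule continuous_on_compose2) (use assms(2) in auto)
  then show "(\<lambda>w. \<Gamma> (Complex x w) $ i $ j) \<in> borel_measurable borel"
    by (rule borel_measurable_continuous_onI)
qed

lemma boundary_value_sequence:
  fixes G :: "complex \<Rightarrow> complex^'m^'p"
  assumes "has_boundary_value G Ghat"
  shows "AE w in lborel. (\<lambda>n. G (Complex (1 / real (Suc n)) w)) \<longlonglongrightarrow> Ghat w"
proof -
  have "filterlim (\<lambda>n. 1 / real (Suc n)) (at_right 0) sequentially"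
    by (intro tendsto_imp_filterlim_at_right LIMSEQ_Suc[OF lim_1_over_n]) simp
  then show ?thesis
    using assms filterlim_compose unfolding has_boundary_value_def by (auto elim!: eventually_mono)
qed

text \<open>A boundary value is fixed only up to a null set and may fail to be measurable. The
  pointwise \<open>lim\<close> along x = 1 / (n + 1) is a measurable version of it.\<close>

lemma boundary_value_measurable:
  fixes G :: "complex \<Rightarrow> complex^'m^'p"
  assumes "has_boundary_value G Ghat" and meas: "\<And>x. 0 < x \<Longrightarrow> (\<lambda>w. G (Complex x w)) \<in> borel_measurable borel"
  obtains G' where "G' \<in> borel_measurable borel" "AE w in lborel. Ghat w = G' w"
proof
  define G' where "G' w = lim (\<lambda>n. G (Complex (1 / real (Suc n)) w))" for w
  show "G' \<in> borel_measurable borel"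
    unfolding G'_def[abs_def] by (intro borel_measurable_lim_metric meas) simp
  show "AE w in lborel. Ghat w = G' w"
    using boundary_value_sequence[OF assms(1)] unfolding G'_def by eventually_elim (simp add: limI)
qed

section \<open>Plancherel inequalities for filtered step functions\<close>

text \<open>Where \<open>g\<close> is nonzero, \<tau> is at most \<open>c\<close>, and the rate
  \<open>1 / real (Suc n)\<close> is at most 1, so the weight does not exceed
  \<open>exp \<bar>c\<bar>\<close>. This gives the constant \<open>exp \<bar>c\<bar> + 1\<close> of
  the dominating function.\<close>

lemma exp_weight_tendsto:
  fixes g :: "real \<Rightarrow> complex^'m^'p"
  assumes [measurable]: "g \<in> borel_measurable borel" and fin: "(\<integral>\<^sup>+\<tau>. ennreal ((norm (g \<tau>))\<^sup>2) \<partial>lborel) < \<infinity>"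
    and zero: "\<And>\<tau>. c < \<tau> \<Longrightarrow> g \<tau> = 0"
  shows "(\<lambda>n. \<integral>\<^sup>+\<tau>. ennreal ((norm (exp (1 / real (Suc n) * \<tau>) *\<^sub>R g \<tau> - g \<tau>))\<^sup>2) \<partial>lborel) \<longlonglongrightarrow> 0"
proof (rule mean_square_tendsto_dominated[where G = "\<lambda>\<tau>. (exp \<bar>c\<bar> + 1) *\<^sub>R g \<tau>"])
  have "(\<lambda>n. exp (1 / real (Suc n) * \<tau>) *\<^sub>R g \<tau>) \<longlonglongrightarrow> exp (0 * \<tau>) *\<^sub>R g \<tau>" for \<tau>
    by (intro tendsto_scaleR tendsto_exp tendsto_mult tendsto_const LIMSEQ_Suc[OF lim_1_over_n])
  then show "AE \<tau> in lborel. (\<lambda>n. exp (1 / real (Suc n) * \<tau>) *\<^sub>R g \<tau>) \<longlonglongrightarrow> g \<tau>"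
    by simp
  have bound: "norm (exp (1 / real (Suc n) * \<tau>) *\<^sub>R g \<tau> - g \<tau>) \<le> norm ((exp \<bar>c\<bar> + 1) *\<^sub>R g \<tau>)" for n \<tau>
  proof (cases "c < \<tau>")
    case True
    then show ?thesis by (simp add: zero)
  next
    case False
    have "1 / real (Suc n) * \<tau> \<le> 1 / real (Suc n) * \<bar>c\<bar>"
      using False by (intro mult_left_mono) auto
    also have "\<dots> \<le> 1 * \<bar>c\<bar>"
      by (intro mult_right_mono) auto
    finally have "exp (1 / real (Suc n) * \<tau>) \<le> exp \<bar>c\<bar>" by simp
    then have "\<bar>exp (1 / real (Suc n) * \<tau>) - 1\<bar> \<le> exp \<bar>c\<bar> + 1"
      using exp_gt_zero[of "1 / real (Suc n) * \<tau>"] by linarith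
    then have "\<bar>exp (1 / real (Suc n) * \<tau>) - 1\<bar> * norm (g \<tau>) \<le> (exp \<bar>c\<bar> + 1) * norm (g \<tau>)"
      by (intro mult_right_mono) auto
    moreover have "exp (1 / real (Suc n) * \<tau>) *\<^sub>R g \<tau> - g \<tau> = (exp (1 / real (Suc n) * \<tau>) - 1) *\<^sub>R g \<tau>"
      by (simp only: scaleR_left_diff_distrib scaleR_one)
    ultimately show ?thesis
      by (simp only: norm_scaleR abs_of_pos add_pos_pos exp_gt_zero zero_less_one)
  qed
  then show "AE \<tau> in lborel. norm (exp (1 / real (Suc n) * \<tau>) *\<^sub>R g \<tau> - g \<tau>) \<le> norm ((exp \<bar>c\<bar> + 1) *\<^sub>R g \<tau>)" for n
    by simp
  show "(\<integral>\<^sup>+\<tau>. ennreal ((norm ((exp \<bar>c\<bar> + 1) *\<^sub>R g \<tau>))\<^sup>2) \<partial>lborel) < \<infinity>"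
    using fin by (simp add: power_mult_distrib ennreal_mult nn_integral_cmult ennreal_mult_less_top)
qed measurable

text \<open>The lower half of Plancherel's theorem asks for bounded, integrable and almost
  everywhere continuous approximants. The stochastic integrability of the kernel, contained in
  \<open>X\<close>, supplies step functions close to it in mean square, and these only have to be
  weighted.\<close>

lemma weighted_filtered_step_le:
  fixes k :: "real \<Rightarrow> complex^'m^'k" and S :: "('k::finite, 'p::finite) steps"
  assumes k: "step_response \<Gamma> k" and x: "0 < x" and S: "\<forall>(a, b, A)\<in>set S. a \<le> b"
    and X: "has_stoch_integral M U (filtered_step k S) X"
  shows "(\<integral>\<^sup>+\<tau>. ennreal ((norm (exp (x * \<tau>) *\<^sub>R filtered_step k S \<tau>))\<^sup>2) \<partial>lborel) \<le> ennreal (1 / (2 * pi)) *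
    (\<integral>\<^sup>+w. ennreal ((norm (mfourier (\<lambda>\<tau>. exp (x * \<tau>) *\<^sub>R step_fun S \<tau>) w ** \<Gamma> (Complex x w)))\<^sup>2) \<partial>lborel)"
proof -
  let ?u = "\<lambda>\<tau>. exp (x * \<tau>) *\<^sub>R filtered_step k S \<tau>"
  obtain c where c: "\<And>a b A. (a, b, A) \<in> set S \<Longrightarrow> a \<le> c \<and> b \<le> c"
    using steps_bounded_above[of S] by blast
  obtain T where T: "(\<lambda>n. \<integral>\<^sup>+\<tau>. ennreal ((norm (step_fun (T n) \<tau> - filtered_step k S \<tau>))\<^sup>2) \<partial>lborel) \<longlonglongrightarrow> 0"
    using X unfolding has_stoch_integral_def by blast
  have [measurable]: "filtered_step k S \<in> borel_measurable borel"
    using X by (simp add: has_stoch_integral_def)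
  \<comment> \<open>Cutting the weight off at \<open>c\<close> keeps it bounded, so it can multiply
    the approximants; on the kernel, which vanishes beyond \<open>c\<close>, the cut has no
    effect.\<close>
  define r where "r \<tau> = indicat_real {..c} \<tau> * exp (x * \<tau>)" for \<tau>
  have [measurable]: "r \<in> borel_measurable borel"
    unfolding r_def[abs_def] by measurable
  have r: "\<bar>r \<tau>\<bar> \<le> exp (x * c)" for \<tau>
    using x by (auto simp: r_def indicator_def)
  have eq: "r \<tau> *\<^sub>R filtered_step k S \<tau> = ?u \<tau>" for \<tau>
    by (cases "c < \<tau>") (auto simp: r_def filtered_step_eq_0[OF k c])
  have "(\<integral>\<^sup>+\<tau>. ennreal ((norm (?u \<tau>))\<^sup>2) \<partial>lborel) \<le> ennreal (1 / (2 * pi)) * (\<integral>\<^sup>+w. ennreal ((norm (mfourier ?u w))\<^sup>2) \<partial>lborel)"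
  proof (rule mfourier_norm_sq_ge[where v = "\<lambda>n \<tau>. r \<tau> *\<^sub>R step_fun (T n) \<tau>"])
    show "mintegrable ?u"
      using filtered_step_transform[OF k x S] by blast
    show "mintegrable (\<lambda>\<tau>. r \<tau> *\<^sub>R step_fun (T n) \<tau>)" for n
      by (rule mintegrable_bounded_scaleR[OF mintegrable_step_fun _ r]) measurable
    show "bounded (range (\<lambda>\<tau>. r \<tau> *\<^sub>R step_fun (T n) \<tau>))" for n
    proof -
      obtain B where B: "\<And>\<tau>. norm (step_fun (T n) \<tau>) \<le> B"
        using bounded_step_fun[of "T n"] by blast
      have "norm (r \<tau> *\<^sub>R step_fun (T n) \<tau>) \<le> exp (x * c) * B" for \<tau>
        unfolding norm_scaleR by (intro mult_mono r B) auto
      then show ?thesis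
        unfolding bounded_iff by blast
    qed
    show "AE \<tau> in lborel. isCont (\<lambda>\<tau>. r \<tau> *\<^sub>R step_fun (T n) \<tau>) \<tau>" for n
      using AE_isCont_step_fun[of "T n"] AE_lborel_singleton[of c]
    proof eventually_elim
      case (elim \<tau>)
      have "isCont (indicat_real {..c}) \<tau>"
        using elim by (simp add: isCont_indicator)
      then show ?case
        unfolding r_def using elim by (intro continuous_intros) auto
    qed
    show "(\<lambda>n. \<integral>\<^sup>+\<tau>. ennreal ((norm (r \<tau> *\<^sub>R step_fun (T n) \<tau> - ?u \<tau>))\<^sup>2) \<partial>lborel) \<longlonglongrightarrow> 0"
    proof (rule mean_square_tendsto_bound[OF _ _ _ T])
      show "norm (r \<tau> *\<^sub>R step_fun (T n) \<tau> - ?u \<tau>) \<le> exp (x * c) * norm (step_fun (T n) \<tau> - filtered_step k S \<tau>)" for n \<tau>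
        unfolding eq[symmetric] scaleR_diff_right[symmetric] norm_scaleR by (intro mult_right_mono r) auto
    qed measurable
  qed
  then show ?thesis
    using filtered_step_transform[OF k x S] by simp
qed

text \<open>As x tends to 0, the error of the product splits into (P - Q) times the transfer
  function on the line, controlled by the bound \<open>K\<close> and Plancherel's inequality, and
  \<open>Q\<close> times the error of the transfer function, controlled by dominated convergence
  with majorant \<open>2 * K\<close> times \<open>Q\<close>.\<close>

lemma filtered_step_plancherel_le:
  fixes k :: "real \<Rightarrow> complex^'m^'k" and S :: "('k::finite, 'p::finite) steps"
  assumes \<Gamma>: "hardy_inf \<Gamma>" and K: "\<And>s. 0 < Re s \<Longrightarrow> norm (\<Gamma> s) \<le> K"
    and G [measurable]: "G \<in> borel_measurable borel" and GK: "\<And>w. norm (G w) \<le> K"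
    and lim: "AE w in lborel. (\<lambda>n. \<Gamma> (Complex (1 / real (Suc n)) w)) \<longlonglongrightarrow> G w"
    and k: "step_response \<Gamma> k" and S: "\<forall>(a, b, A)\<in>set S. a \<le> b"
    and X: "has_stoch_integral M U (filtered_step k S) X"
  shows "(\<integral>\<^sup>+\<tau>. ennreal ((norm (filtered_step k S \<tau>))\<^sup>2) \<partial>lborel) \<le>
    ennreal (1 / (2 * pi)) * (\<integral>\<^sup>+w. ennreal ((norm (mfourier (step_fun S) w ** G w))\<^sup>2) \<partial>lborel)"
proof -
  define x where "x n = 1 / real (Suc n)" for n
  have x: "0 < x n" for n by (simp add: x_def)
  define P where "P n = mfourier (\<lambda>\<tau>. exp (x n * \<tau>) *\<^sub>R step_fun S \<tau>)" for n
  define Q where "Q = mfourier (step_fun S)"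
  define \<Gamma>' where "\<Gamma>' n w = \<Gamma> (Complex (x n) w)" for n w
  obtain c where c: "\<And>a b A. (a, b, A) \<in> set S \<Longrightarrow> a \<le> c \<and> b \<le> c"
    using steps_bounded_above[of S] by blast
  have [measurable]: "filtered_step k S \<in> borel_measurable borel"
    using X by (simp add: has_stoch_integral_def)
  have [measurable]: "\<Gamma>' n \<in> borel_measurable borel" "P n \<in> borel_measurable borel" "Q \<in> borel_measurable borel" for n
    using hardy_inf_measurable[OF \<Gamma> x] by (auto simp: \<Gamma>'_def[abs_def] P_def Q_def)
  have \<Gamma>'K: "norm (\<Gamma>' n w) \<le> K" for n w
    by (simp add: \<Gamma>'_def K x)
  have Qfin: "(\<integral>\<^sup>+w. ennreal ((norm (Q w))\<^sup>2) \<partial>lborel) < \<infinity>"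
    unfolding Q_def using step_fun_norm_sq_finite[of S]
    by (intro le_less_trans[OF mfourier_norm_sq_le[OF mintegrable_step_fun]]) (simp add: ennreal_mult_less_top)
  have PQ: "(\<lambda>n. \<integral>\<^sup>+w. ennreal ((norm (P n w - Q w))\<^sup>2) \<partial>lborel) \<longlonglongrightarrow> 0"
  proof (rule tendsto_sandwich[OF _ _ tendsto_const])
    have int: "mintegrable (\<lambda>\<tau>. exp (x n * \<tau>) *\<^sub>R step_fun S \<tau>)" for n
      using filtered_step_transform[OF k x S] by blast
    have "(\<integral>\<^sup>+w. ennreal ((norm (P n w - Q w))\<^sup>2) \<partial>lborel) \<le>
        ennreal (2 * pi) * (\<integral>\<^sup>+\<tau>. ennreal ((norm (exp (1 / real (Suc n) * \<tau>) *\<^sub>R step_fun S \<tau> - step_fun S \<tau>))\<^sup>2) \<partial>lborel)" for n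
      using mfourier_norm_sq_le[OF mintegrable_diff[OF int mintegrable_step_fun], of n S]
      unfolding mfourier_diff[OF int mintegrable_step_fun] by (simp add: P_def Q_def x_def)
    then show "\<forall>\<^sub>F n in sequentially. (\<integral>\<^sup>+w. ennreal ((norm (P n w - Q w))\<^sup>2) \<partial>lborel) \<le>
        ennreal (2 * pi) * (\<integral>\<^sup>+\<tau>. ennreal ((norm (exp (1 / real (Suc n) * \<tau>) *\<^sub>R step_fun S \<tau> - step_fun S \<tau>))\<^sup>2) \<partial>lborel)"
      by (intro always_eventually allI)
    have "(\<lambda>n. \<integral>\<^sup>+\<tau>. ennreal ((norm (exp (1 / real (Suc n) * \<tau>) *\<^sub>R step_fun S \<tau> - step_fun S \<tau>))\<^sup>2) \<partial>lborel) \<longlonglongrightarrow> 0"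
      using c by (intro exp_weight_tendsto[where c = c] step_fun_norm_sq_finite step_fun_eq_0) auto
    from ennreal_tendsto_cmult[OF _ this, of "ennreal (2 * pi)"]
    show "(\<lambda>n. ennreal (2 * pi) * (\<integral>\<^sup>+\<tau>. ennreal ((norm (exp (1 / real (Suc n) * \<tau>) *\<^sub>R step_fun S \<tau> - step_fun S \<tau>))\<^sup>2) \<partial>lborel)) \<longlonglongrightarrow> 0"
      by simp
  qed simp
  have "(\<lambda>n. \<integral>\<^sup>+w. ennreal ((norm (P n w ** \<Gamma>' n w - Q w ** \<Gamma>' n w - 0))\<^sup>2) \<partial>lborel) \<longlonglongrightarrow> 0"
  proof (rule mean_square_tendsto_bound[OF _ _ _ PQ])
    show "norm (P n w ** \<Gamma>' n w - Q w ** \<Gamma>' n w - 0) \<le> K * norm (P n w - Q w)" for n w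
    proof -
      have "P n w ** \<Gamma>' n w - Q w ** \<Gamma>' n w = (P n w - Q w) ** \<Gamma>' n w"
        by (simp add: vec_eq_iff matrix_matrix_mult_def left_diff_distrib sum_subtractf)
      moreover have "norm ((P n w - Q w) ** \<Gamma>' n w) \<le> norm (P n w - Q w) * K"
        by (rule order_trans[OF norm_matrix_mult_le]) (intro mult_left_mono \<Gamma>'K norm_ge_zero)
      ultimately show ?thesis by (simp add: mult.commute)
    qed
  qed measurable
  moreover have "(\<lambda>n. \<integral>\<^sup>+w. ennreal ((norm (Q w ** \<Gamma>' n w - Q w ** G w))\<^sup>2) \<partial>lborel) \<longlonglongrightarrow> 0"
  proof (rule mean_square_tendsto_dominated[where G = "\<lambda>w. (2 * K) *\<^sub>R Q w"])
    have cont: "continuous_on UNIV (\<lambda>B. A ** B)" for A :: "complex^'k^'p" and B :: "complex^'m^'k"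
      by (intro continuous_intros)
    show "AE w in lborel. (\<lambda>n. Q w ** \<Gamma>' n w) \<longlonglongrightarrow> Q w ** G w"
      using lim unfolding \<Gamma>'_def x_def
      by eventually_elim (rule continuous_on_tendsto_compose[OF cont], auto)
    have "norm (Q w ** \<Gamma>' n w - Q w ** G w) \<le> norm ((2 * K) *\<^sub>R Q w)" for n w
    proof -
      have K0: "0 \<le> K" using GK[of 0] norm_ge_zero order_trans by blast
      have "norm (Q w ** \<Gamma>' n w) \<le> norm (Q w) * K" "norm (Q w ** G w) \<le> norm (Q w) * K"
        by (rule order_trans[OF norm_matrix_mult_le], intro mult_left_mono \<Gamma>'K GK norm_ge_zero)+
      then show ?thesis
        using norm_triangle_ineq4[of "Q w ** \<Gamma>' n w" "Q w ** G w"] K0 by (simp add: mult_ac)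
    qed
    then show "AE w in lborel. norm (Q w ** \<Gamma>' n w - Q w ** G w) \<le> norm ((2 * K) *\<^sub>R Q w)" for n
      by simp
    show "(\<integral>\<^sup>+w. ennreal ((norm ((2 * K) *\<^sub>R Q w))\<^sup>2) \<partial>lborel) < \<infinity>"
      using Qfin by (simp add: power_mult_distrib ennreal_mult nn_integral_cmult ennreal_mult_less_top)
  qed measurable
  ultimately have "(\<lambda>n. \<integral>\<^sup>+w. ennreal ((norm (P n w ** \<Gamma>' n w - Q w ** \<Gamma>' n w + Q w ** \<Gamma>' n w - (0 + Q w ** G w)))\<^sup>2) \<partial>lborel) \<longlonglongrightarrow> 0"
    by (intro mean_square_tendsto_add) auto
  then have Y: "(\<lambda>n. \<integral>\<^sup>+w. ennreal ((norm (P n w ** \<Gamma>' n w - Q w ** G w))\<^sup>2) \<partial>lborel) \<longlonglongrightarrow> 0"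
    by simp
  have fin: "(\<integral>\<^sup>+\<tau>. ennreal ((norm (filtered_step k S \<tau>))\<^sup>2) \<partial>lborel) < \<infinity>"
    using X by (simp add: has_stoch_integral_def nn_integral_eq_integral)
  have XX: "(\<lambda>n. \<integral>\<^sup>+\<tau>. ennreal ((norm (exp (x n * \<tau>) *\<^sub>R filtered_step k S \<tau> - filtered_step k S \<tau>))\<^sup>2) \<partial>lborel) \<longlonglongrightarrow> 0"
    unfolding x_def using filtered_step_eq_0[OF k c] by (intro exp_weight_tendsto[where c = c] fin) auto
  have "(\<integral>\<^sup>+\<tau>. ennreal ((norm (filtered_step k S \<tau>))\<^sup>2) \<partial>lborel) \<le>
    ennreal (1 / (2 * pi)) * (\<integral>\<^sup>+w. ennreal ((norm (Q w ** G w))\<^sup>2) \<partial>lborel)"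
  proof (rule mean_square_limit_le[OF _ _ _ _ XX Y])
    show "(\<integral>\<^sup>+\<tau>. ennreal ((norm (exp (x n * \<tau>) *\<^sub>R filtered_step k S \<tau>))\<^sup>2) \<partial>lborel) \<le>
        ennreal (1 / (2 * pi)) * (\<integral>\<^sup>+w. ennreal ((norm (P n w ** \<Gamma>' n w))\<^sup>2) \<partial>lborel)" for n
      unfolding P_def \<Gamma>'_def by (rule weighted_filtered_step_le[OF k x S X])
  qed simp_all
  then show ?thesis by (simp add: Q_def)
qed

section \<open>From step functions to the impulse response\<close>

lemma mean_square_fatou:
  fixes Y :: "'a \<Rightarrow> 'b::{real_normed_vector, second_countable_topology}"
  assumes [measurable]: "\<And>n. Y' n \<in> borel_measurable M"
    and lim: "AE x in M. (\<lambda>n. Y' n x) \<longlonglongrightarrow> Y x"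
    and le: "\<And>n. (\<integral>\<^sup>+x. ennreal ((norm (Y' n x))\<^sup>2) \<partial>M) \<le> C"
  shows "(\<integral>\<^sup>+x. ennreal ((norm (Y x))\<^sup>2) \<partial>M) \<le> C"
proof -
  have "(\<integral>\<^sup>+x. ennreal ((norm (Y x))\<^sup>2) \<partial>M) = (\<integral>\<^sup>+x. liminf (\<lambda>n. ennreal ((norm (Y' n x))\<^sup>2)) \<partial>M)"
  proof (rule nn_integral_cong_AE, use lim in eventually_elim)
    case (elim x)
    then have "(\<lambda>n. ennreal ((norm (Y' n x))\<^sup>2)) \<longlonglongrightarrow> ennreal ((norm (Y x))\<^sup>2)"
      by (intro tendsto_ennrealI tendsto_power tendsto_norm)
    then show ?case
      using lim_imp_Liminf[OF trivial_limit_sequentially] by metis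
  qed
  also have "\<dots> \<le> liminf (\<lambda>n. \<integral>\<^sup>+x. ennreal ((norm (Y' n x))\<^sup>2) \<partial>M)"
    by (rule nn_integral_liminf) measurable
  also have "\<dots> \<le> C"
    by (rule Liminf_le) (auto simp: le)
  finally show ?thesis .
qed

text \<open>In the past of \<open>t\<close> the weight is the Laplace damping of the elapsed time;
  being square integrable there, it makes the square integrable function \<open>g t\<close>
  integrable. With the absolute value the weight is at most 1 on the whole line, so that it can also
  be put on functions to be compared with \<open>g t\<close>.\<close>

lemma impulse_weighted_transform:
  fixes h :: "real \<Rightarrow> complex^'m^'p"
  defines "g \<equiv> \<lambda>t \<tau>. if \<tau> \<le> t then h (t - \<tau>) else 0"
  assumes [measurable]: "g t \<in> borel_measurable borel" and int: "integrable lborel (\<lambda>\<tau>. (norm (g t \<tau>))\<^sup>2)" and x: "0 < x"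
  shows "mintegrable (\<lambda>\<tau>. exp (- (x * \<bar>t - \<tau>\<bar>)) *\<^sub>R g t \<tau>)"
    and "mfourier (\<lambda>\<tau>. exp (- (x * \<bar>t - \<tau>\<bar>)) *\<^sub>R g t \<tau>) w = cscale (cis (w * t)) (laplace h (Complex x w))"
proof -
  \<comment> \<open>\<open>H (t - \<tau>)\<close> is the square of the weight for \<tau> < t. At
    \<tau> = t it is 0, hence this point is excluded below as a null set.\<close>
  define H where "H z = indicat_real {0<..} z *\<^sub>R exp (- (z * (2 * x)))" for z
  have "integrable lborel H"
    using integrable_I0i_exp_mscale[of "2 * x"] x unfolding H_def set_integrable_def by simp
  from lborel_integrable_real_affine[OF this, of "-1" t] have H: "integrable lborel (\<lambda>\<tau>. H (t - \<tau>))"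
    by simp
  show "mintegrable (\<lambda>\<tau>. exp (- (x * \<bar>t - \<tau>\<bar>)) *\<^sub>R g t \<tau>)"
    unfolding mintegrable_def
  proof (intro allI)
    fix i j
    show "integrable lborel (\<lambda>\<tau>. (exp (- (x * \<bar>t - \<tau>\<bar>)) *\<^sub>R g t \<tau>) $ i $ j)"
    proof (rule Bochner_Integration.integrable_bound)
      show "integrable lborel (\<lambda>\<tau>. H (t - \<tau>) + (norm (g t \<tau>))\<^sup>2)"
        by (intro Bochner_Integration.integrable_add H int)
      show "AE \<tau> in lborel. norm ((exp (- (x * \<bar>t - \<tau>\<bar>)) *\<^sub>R g t \<tau>) $ i $ j) \<le> norm (H (t - \<tau>) + (norm (g t \<tau>))\<^sup>2)"
        using AE_lborel_singleton[of t]
      proof eventually_elim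
        case (elim \<tau>)
        show ?case
        proof (cases "\<tau> < t")
          case True
          define e where "e = exp (- (x * \<bar>t - \<tau>\<bar>))"
          define a where "a = cmod (g t \<tau> $ i $ j)"
          have "a \<le> norm (g t \<tau>)"
            unfolding a_def by (rule order_trans[OF Finite_Cartesian_Product.norm_nth_le Finite_Cartesian_Product.norm_nth_le])
          then have "a\<^sup>2 \<le> (norm (g t \<tau>))\<^sup>2"
            by (intro power_mono) (auto simp: a_def)
          moreover have "2 * (e * a) \<le> e\<^sup>2 + a\<^sup>2" "0 \<le> e * a"
            using sum_squares_bound[of e a] by (auto simp: e_def a_def)
          moreover have "e\<^sup>2 = H (t - \<tau>)"
            using True by (simp add: e_def H_def power2_eq_square algebra_simps flip: exp_add)
          ultimately show ?thesis
            by (simp add: norm_mult flip: e_def a_def)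
        next
          case False
          then show ?thesis using elim by (simp add: g_def)
        qed
      qed
    qed measurable
  qed
  have "(\<integral>\<tau>. cis (w * \<tau>) * (exp (- (x * \<bar>t - \<tau>\<bar>)) *\<^sub>R g t \<tau>) $ i $ j \<partial>lborel) = cis (w * t) * laplace h (Complex x w) $ i $ j" for i j
  proof -
    let ?\<phi> = "\<lambda>\<tau>. cis (w * \<tau>) * (exp (- (x * \<bar>t - \<tau>\<bar>)) *\<^sub>R g t \<tau>) $ i $ j"
    have \<phi>: "?\<phi> (t - z) = cis (w * t) * (indicat_real {0..} z *\<^sub>R (exp (- Complex x w * complex_of_real z) * h z $ i $ j))" for z
    proof (cases "0 \<le> z")
      case True
      have "exp (- Complex x w * complex_of_real z) = of_real (exp (x * - z)) * cis (w * - z)"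
        using exp_Complex_mult[of x w "- z"] by simp
      moreover have "cis (w * (t - z)) = cis (w * t) * cis (w * - z)"
        by (simp add: cis_mult algebra_simps)
      ultimately show ?thesis
        using True by (simp add: g_def scaleR_conv_of_real[where 'a = complex])
    qed (simp add: g_def)
    have "(\<integral>z. ?\<phi> (t - z) \<partial>lborel) = cis (w * t) * laplace h (Complex x w) $ i $ j"
      unfolding \<phi> integral_mult_right_zero by (simp add: laplace_def set_lebesgue_integral_def)
    then show ?thesis
      using integral_reflect[of ?\<phi> t] by simp
  qed
  then show "mfourier (\<lambda>\<tau>. exp (- (x * \<bar>t - \<tau>\<bar>)) *\<^sub>R g t \<tau>) w = cscale (cis (w * t)) (laplace h (Complex x w))"
    by (simp add: vec_eq_iff mfourier_def)
qed

text \<open>Up to a continuous phase of modulus 1, the Laplace transform on a vertical line is the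
  Fourier transform of the damped kernel, which is measurable in the frequency.\<close>

lemma borel_measurable_laplace:
  fixes h :: "real \<Rightarrow> complex^'m^'p"
  defines "g \<equiv> \<lambda>t \<tau>. if \<tau> \<le> t then h (t - \<tau>) else 0"
  assumes [measurable]: "g t \<in> borel_measurable borel" and int: "integrable lborel (\<lambda>\<tau>. (norm (g t \<tau>))\<^sup>2)" and x: "0 < x"
  shows "(\<lambda>w. laplace h (Complex x w)) \<in> borel_measurable borel"
proof -
  let ?m = "mfourier (\<lambda>\<tau>. exp (- (x * \<bar>t - \<tau>\<bar>)) *\<^sub>R g t \<tau>)"
  have m: "?m w = cscale (cis (w * t)) (laplace h (Complex x w))" for w
    unfolding g_def by (rule impulse_weighted_transform[OF assms(2,3)[unfolded g_def] x])
  have "laplace h (Complex x w) $ i $ j = cis (- (w * t)) * ?m w $ i $ j" for w i j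
    unfolding m by (simp add: cis_mult flip: mult.assoc)
  then show ?thesis
    by (intro borel_measurable_matrix_components) simp
qed

text \<open>Up to a phase, the boundary value plays the part of the mean square Fourier transform of
  \<open>g t\<close>, which need not be integrable. Damping by \<open>r n\<close> makes it
  integrable and only lowers the right-hand side, and Fatou's lemma carries the left-hand side to
  the undamped limit.\<close>

lemma mfourier_minus_boundary_value_le:
  fixes h :: "real \<Rightarrow> complex^'m^'p" and u :: "real \<Rightarrow> complex^'m^'p"
  defines "g \<equiv> \<lambda>t \<tau>. if \<tau> \<le> t then h (t - \<tau>) else 0"
  assumes [measurable]: "g t \<in> borel_measurable borel" and int: "integrable lborel (\<lambda>\<tau>. (norm (g t \<tau>))\<^sup>2)"
    and lim: "AE w in lborel. (\<lambda>n. laplace h (Complex (1 / real (Suc n)) w)) \<longlonglongrightarrow> \<Phi> w"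
    and u: "mintegrable u"
  shows "(\<integral>\<^sup>+w. ennreal ((norm (mfourier u w - cscale (cis (w * t)) (\<Phi> w)))\<^sup>2) \<partial>lborel) \<le>
    ennreal (2 * pi) * (\<integral>\<^sup>+\<tau>. ennreal ((norm (u \<tau> - g t \<tau>))\<^sup>2) \<partial>lborel)"
proof -
  define r where "r n \<tau> = exp (- (1 / real (Suc n) * \<bar>t - \<tau>\<bar>))" for n \<tau>
  have r: "\<bar>r n \<tau>\<bar> \<le> 1" for n \<tau>
    by (simp add: r_def)
  have rm [measurable]: "r n \<in> borel_measurable borel" for n
    unfolding r_def[abs_def] by measurable
  have r_lim: "(\<lambda>n. r n \<tau>) \<longlonglongrightarrow> 1" for \<tau>
  proof -
    have "(\<lambda>n. r n \<tau>) \<longlonglongrightarrow> exp (- (0 * \<bar>t - \<tau>\<bar>))"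
      unfolding r_def by (intro tendsto_exp tendsto_minus tendsto_mult tendsto_const LIMSEQ_Suc[OF lim_1_over_n])
    then show ?thesis by simp
  qed
  have [measurable]: "u \<in> borel_measurable borel"
    by (rule mintegrable_measurable[OF u])
  have ru: "mintegrable (\<lambda>\<tau>. r n \<tau> *\<^sub>R u \<tau>)" for n
    by (rule mintegrable_bounded_scaleR[OF u rm r])
  have pos: "0 < 1 / real (Suc n)" for n by simp
  have rg: "mintegrable (\<lambda>\<tau>. r n \<tau> *\<^sub>R g t \<tau>)"
      "mfourier (\<lambda>\<tau>. r n \<tau> *\<^sub>R g t \<tau>) w = cscale (cis (w * t)) (laplace h (Complex (1 / real (Suc n)) w))" for n w
    using impulse_weighted_transform[OF assms(2,3)[unfolded g_def] pos[of n]] by (simp_all only: r_def g_def)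
  define Y where "Y n w = mfourier (\<lambda>\<tau>. r n \<tau> *\<^sub>R u \<tau> - r n \<tau> *\<^sub>R g t \<tau>) w" for n w
  show ?thesis
  proof (rule mean_square_fatou[where Y' = Y])
    show "Y n \<in> borel_measurable lborel" for n
      unfolding Y_def[abs_def] by measurable
    have ulim: "(\<lambda>n. mfourier (\<lambda>\<tau>. r n \<tau> *\<^sub>R u \<tau>) w) \<longlonglongrightarrow> mfourier u w" for w
    proof (intro vec_tendstoI)
      fix i j
      have "(\<lambda>n. \<integral>\<tau>. cis (w * \<tau>) * (r n \<tau> *\<^sub>R u \<tau>) $ i $ j \<partial>lborel) \<longlonglongrightarrow> (\<integral>\<tau>. cis (w * \<tau>) * u \<tau> $ i $ j \<partial>lborel)"
      proof (rule integral_dominated_convergence[where w = "\<lambda>\<tau>. cmod (u \<tau> $ i $ j)"])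
        show "integrable lborel (\<lambda>\<tau>. cmod (u \<tau> $ i $ j))"
          using u by (simp add: mintegrable_def)
        have "(\<lambda>n. cis (w * \<tau>) * (r n \<tau> *\<^sub>R u \<tau> $ i $ j)) \<longlonglongrightarrow> cis (w * \<tau>) * (1 *\<^sub>R u \<tau> $ i $ j)" for \<tau>
          by (intro tendsto_mult tendsto_const tendsto_scaleR r_lim)
        then show "AE \<tau> in lborel. (\<lambda>n. cis (w * \<tau>) * (r n \<tau> *\<^sub>R u \<tau>) $ i $ j) \<longlonglongrightarrow> cis (w * \<tau>) * u \<tau> $ i $ j"
          by simp
        show "AE \<tau> in lborel. cmod (cis (w * \<tau>) * (r n \<tau> *\<^sub>R u \<tau>) $ i $ j) \<le> cmod (u \<tau> $ i $ j)" for n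
          by (intro AE_I2) (simp add: norm_mult mult_left_le_one_le r)
      qed measurable
      then show "(\<lambda>n. mfourier (\<lambda>\<tau>. r n \<tau> *\<^sub>R u \<tau>) w $ i $ j) \<longlonglongrightarrow> mfourier u w $ i $ j"
        by (simp add: mfourier_def)
    qed
    show "AE w in lborel. (\<lambda>n. Y n w) \<longlonglongrightarrow> mfourier u w - cscale (cis (w * t)) (\<Phi> w)"
      using lim
    proof eventually_elim
      case (elim w)
      have "(\<lambda>n. cscale (cis (w * t)) (laplace h (Complex (1 / real (Suc n)) w))) \<longlonglongrightarrow> cscale (cis (w * t)) (\<Phi> w)"
        unfolding cscale_def by (intro vec_tendstoI) (simp only: vec_lambda_beta, intro tendsto_mult tendsto_const tendsto_vec_nth elim)
      then show ?case
        unfolding Y_def mfourier_diff[OF ru rg(1)] rg(2) by (intro tendsto_diff ulim)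
    qed
    show "(\<integral>\<^sup>+w. ennreal ((norm (Y n w))\<^sup>2) \<partial>lborel) \<le> ennreal (2 * pi) * (\<integral>\<^sup>+\<tau>. ennreal ((norm (u \<tau> - g t \<tau>))\<^sup>2) \<partial>lborel)" for n
    proof -
      have "(norm (r n \<tau> *\<^sub>R u \<tau> - r n \<tau> *\<^sub>R g t \<tau>))\<^sup>2 \<le> (norm (u \<tau> - g t \<tau>))\<^sup>2" for \<tau>
        unfolding scaleR_diff_right[symmetric] norm_scaleR
        by (intro power_mono mult_left_le_one_le r) auto
      then have "(\<integral>\<^sup>+\<tau>. ennreal ((norm (r n \<tau> *\<^sub>R u \<tau> - r n \<tau> *\<^sub>R g t \<tau>))\<^sup>2) \<partial>lborel) \<le> (\<integral>\<^sup>+\<tau>. ennreal ((norm (u \<tau> - g t \<tau>))\<^sup>2) \<partial>lborel)"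
        by (intro nn_integral_mono ennreal_leI)
      then show ?thesis
        unfolding Y_def
        by (intro order_trans[OF mfourier_norm_sq_le[OF mintegrable_diff[OF ru rg(1)]]] mult_left_mono) auto
    qed
  qed
qed

text \<open>The everywhere valid bound \<open>K\<close> on \<open>G\<close> lets the mean square
  convergence of the transforms survive multiplication by \<open>G\<close>. The time
  \<open>t\<close> enters only through a phase of modulus 1, so the bound is the same at all
  times.\<close>

lemma output_norm_sq_le:
  fixes h :: "real \<Rightarrow> complex^'m^'p" and V :: "real \<Rightarrow> 'a \<Rightarrow> real^'m"
  assumes wiener: "standard_wiener M V"
    and \<Gamma>: "hardy_inf \<Gamma>" and K: "\<And>s. 0 < Re s \<Longrightarrow> norm (\<Gamma> s) \<le> K"
    and G [measurable]: "G \<in> borel_measurable borel" and GK: "\<And>w. norm (G w) \<le> K"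
    and Glim: "AE w in lborel. (\<lambda>n. \<Gamma> (Complex (1 / real (Suc n)) w)) \<longlonglongrightarrow> G w"
    and \<Phi> [measurable]: "\<Phi> \<in> borel_measurable borel"
    and \<Phi>lim: "AE w in lborel. (\<lambda>n. laplace h (Complex (1 / real (Suc n)) w)) \<longlonglongrightarrow> \<Phi> w"
    and W: "shaped_process M V \<Gamma> W"
    and Z: "has_stoch_integral M W (\<lambda>\<tau>. if \<tau> \<le> t then h (t - \<tau>) else 0) Z"
  shows "(\<integral>\<^sup>+x. ennreal ((norm (Z x))\<^sup>2) \<partial>M) \<le>
    ennreal (1 / (2 * pi)) * (\<integral>\<^sup>+w. ennreal ((norm (\<Phi> w ** G w))\<^sup>2) \<partial>lborel)"
proof -
  let ?g = "\<lambda>\<tau>. if \<tau> \<le> t then h (t - \<tau>) else 0"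
  let ?U = "\<lambda>\<tau> x. of_real_vec (V \<tau> x)"
  have [measurable]: "?g \<in> borel_measurable borel" and gint: "integrable lborel (\<lambda>\<tau>. (norm (?g \<tau>))\<^sup>2)"
    and [measurable]: "Z \<in> borel_measurable M"
    using Z by (auto simp: has_stoch_integral_def)
  obtain S where S: "\<And>n. \<forall>(a, b, A)\<in>set (S n). a \<le> b"
      and Sg: "(\<lambda>n. \<integral>\<^sup>+\<tau>. ennreal ((norm (step_fun (S n) \<tau> - ?g \<tau>))\<^sup>2) \<partial>lborel) \<longlonglongrightarrow> 0"
      and SZ: "(\<lambda>n. \<integral>\<^sup>+x. ennreal ((norm (step_integral W (S n) x - Z x))\<^sup>2) \<partial>M) \<longlonglongrightarrow> 0"
    using Z unfolding has_stoch_integral_def by blast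
  obtain k where k: "step_response \<Gamma> k"
    and kW: "\<And>s t. s \<le> t \<Longrightarrow> has_stoch_integral M ?U (\<lambda>\<tau>. k (t - \<tau>) - k (s - \<tau>)) (\<lambda>x. W t x - W s x)"
    using W unfolding shaped_process_def of_real_vec_def by blast
  have int: "has_stoch_integral M ?U (filtered_step k (S n)) (step_integral W (S n))" for n
    unfolding filtered_step_def[abs_def]
    by (rule has_stoch_integral_step_integral[where g = "\<lambda>a b \<tau>. k (b - \<tau>) - k (a - \<tau>)"])
      (use S[of n] in \<open>auto intro!: kW borel_measurable_of_real_vec wiener_measurable[OF wiener]\<close>)
  have [measurable]: "step_integral W (S n) \<in> borel_measurable M" for n
    using int[of n] by (simp add: has_stoch_integral_def)
  define \<Phi>' where "\<Phi>' w = cscale (cis (w * t)) (\<Phi> w)" for w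
  have [measurable]: "\<Phi>' \<in> borel_measurable borel"
    by (rule borel_measurable_matrix_components) (simp add: \<Phi>'_def)
  have Y0: "(\<lambda>n. \<integral>\<^sup>+w. ennreal ((norm (mfourier (step_fun (S n)) w - \<Phi>' w))\<^sup>2) \<partial>lborel) \<longlonglongrightarrow> 0"
  proof (rule tendsto_sandwich[OF _ _ tendsto_const])
    show "\<forall>\<^sub>F n in sequentially. (\<integral>\<^sup>+w. ennreal ((norm (mfourier (step_fun (S n)) w - \<Phi>' w))\<^sup>2) \<partial>lborel) \<le>
        ennreal (2 * pi) * (\<integral>\<^sup>+\<tau>. ennreal ((norm (step_fun (S n) \<tau> - ?g \<tau>))\<^sup>2) \<partial>lborel)"
      unfolding \<Phi>'_def
      by (intro always_eventually allI mfourier_minus_boundary_value_le \<Phi>lim mintegrable_step_fun gint) measurable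
    show "(\<lambda>n. ennreal (2 * pi) * (\<integral>\<^sup>+\<tau>. ennreal ((norm (step_fun (S n) \<tau> - ?g \<tau>))\<^sup>2) \<partial>lborel)) \<longlonglongrightarrow> 0"
      using ennreal_tendsto_cmult[OF _ Sg, of "ennreal (2 * pi)"] by simp
  qed simp
  have Y: "(\<lambda>n. \<integral>\<^sup>+w. ennreal ((norm (mfourier (step_fun (S n)) w ** G w - \<Phi>' w ** G w))\<^sup>2) \<partial>lborel) \<longlonglongrightarrow> 0"
  proof (rule mean_square_tendsto_bound[OF _ _ _ Y0])
    show "norm (mfourier (step_fun (S n)) w ** G w - \<Phi>' w ** G w) \<le> K * norm (mfourier (step_fun (S n)) w - \<Phi>' w)" for n w
    proof -
      have "mfourier (step_fun (S n)) w ** G w - \<Phi>' w ** G w = (mfourier (step_fun (S n)) w - \<Phi>' w) ** G w"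
        by (simp add: vec_eq_iff matrix_matrix_mult_def left_diff_distrib sum_subtractf)
      moreover have "norm ((mfourier (step_fun (S n)) w - \<Phi>' w) ** G w) \<le> norm (mfourier (step_fun (S n)) w - \<Phi>' w) * K"
        by (rule order_trans[OF norm_matrix_mult_le]) (intro mult_left_mono GK norm_ge_zero)
      ultimately show ?thesis by (simp add: mult.commute)
    qed
  qed measurable
  have "(\<integral>\<^sup>+x. ennreal ((norm (Z x))\<^sup>2) \<partial>M) \<le> ennreal (1 / (2 * pi)) * (\<integral>\<^sup>+w. ennreal ((norm (\<Phi>' w ** G w))\<^sup>2) \<partial>lborel)"
  proof (rule mean_square_limit_le[OF _ _ _ _ SZ Y])
    show "(\<integral>\<^sup>+x. ennreal ((norm (step_integral W (S n) x))\<^sup>2) \<partial>M) \<le>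
        ennreal (1 / (2 * pi)) * (\<integral>\<^sup>+w. ennreal ((norm (mfourier (step_fun (S n)) w ** G w))\<^sup>2) \<partial>lborel)" for n
      by (rule order_trans[OF wiener_stoch_integral_norm_sq_le[OF wiener int]
          filtered_step_plancherel_le[OF \<Gamma> K G GK Glim k S int]])
  qed simp_all
  then show ?thesis
    by (simp add: \<Phi>'_def cscale_mult_left norm_cscale)
qed

section \<open>The worst-case output variance\<close>

text \<open>As the real line has infinite measure, finiteness of the functional forces the infimum
  of \<open>\<psi>\<close> to vanish; this makes the convex conjugate nonnegative on \<open>[0, \<infinity>)\<close>.\<close>

lemma trace_integral_finite_imp_inf_zero:
  fixes G :: "real \<Rightarrow> complex^'m^'m"
  assumes fin: "(\<integral>\<^sup>+w. ennreal (\<Sum>i\<in>UNIV. \<psi> (eigvals (G w ** hadj (G w)) i)) \<partial>lborel) < \<infinity>"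
    and det: "AE w in lborel. det (G w) \<noteq> 0" and nonneg: "\<And>x. 0 < x \<Longrightarrow> 0 \<le> \<psi> x" and "0 < e"
  shows "\<exists>x>0. \<psi> x < e"
proof (rule ccontr)
  assume "\<not> (\<exists>x>0. \<psi> x < e)"
  then have ge: "e \<le> \<psi> x" if "0 < x" for x
    using that by force
  have "e \<le> (\<Sum>i\<in>UNIV. \<psi> (eigvals (G w ** hadj (G w)) i))" if "det (G w) \<noteq> 0" for w
  proof -
    have "\<psi> (eigvals (G w ** hadj (G w)) j) \<le> (\<Sum>i\<in>UNIV. \<psi> (eigvals (G w ** hadj (G w)) i))" for j
      by (rule member_le_sum) (use nonneg gram_eigvals_pos[OF that] in auto)
    then show ?thesis
      using ge[OF gram_eigvals_pos[OF that]] order_trans by blast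
  qed
  then have "(\<integral>\<^sup>+w. ennreal e \<partial>(lborel :: real measure)) \<le> (\<integral>\<^sup>+w. ennreal (\<Sum>i\<in>UNIV. \<psi> (eigvals (G w ** hadj (G w)) i)) \<partial>lborel)"
    using det by (intro nn_integral_mono_AE) (auto intro: ennreal_leI elim!: eventually_mono)
  moreover have "(\<integral>\<^sup>+w. ennreal e \<partial>(lborel :: real measure)) = \<infinity>"
    using \<open>0 < e\<close> by (simp add: ennreal_mult_top)
  ultimately show False
    using fin by simp
qed

text \<open>The pointwise trace inequality is integrated over the frequency for the scaled boundary
  value and then divided by \<open>\<sigma>\<close>. \<open>G\<close> and \<open>\<Phi>\<close> are
  measurable versions of the boundary values, as \<open>Ghat\<close> and \<open>Fhat\<close>
  themselves may not be measurable.\<close>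

lemma norm_sq_integral_le_cov_functional:
  fixes G Ghat :: "real \<Rightarrow> complex^'m^'m" and \<Phi> Fhat :: "real \<Rightarrow> complex^'m^'p" and \<psi> :: "real \<Rightarrow> real"
  assumes nonneg: "\<And>x. 0 < x \<Longrightarrow> 0 \<le> \<psi> x" and cvx: "convex_on {0<..} \<psi>"
    and deriv: "\<And>x. 0 < x \<Longrightarrow> (\<psi> has_real_derivative deriv \<psi> x) (at x)"
    and [measurable]: "G \<in> borel_measurable borel" "\<Phi> \<in> borel_measurable borel"
    and Ghat: "AE w in lborel. Ghat w = G w" and Fhat: "AE w in lborel. Fhat w = \<Phi> w"
    and det: "AE w in lborel. det (Ghat w) \<noteq> 0"
    and cov: "cov_functional (\<lambda>x. ereal (\<psi> x)) Ghat \<le> ereal d" and d: "0 \<le> d" and \<sigma>: "0 < \<sigma>"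
  shows "enn2ereal (ennreal (1 / (2 * pi)) * (\<integral>\<^sup>+w. ennreal ((norm (\<Phi> w ** G w))\<^sup>2) \<partial>lborel)) \<le>
    ereal (1 / \<sigma>) * (cov_functional (convex_conj \<psi>) (\<lambda>w. sqrt \<sigma> *\<^sub>R Fhat w) + ereal d)"
proof -
  \<comment> \<open>On the null set where the determinant vanishes, \<open>\<psi>\<close> would be
    evaluated at 0, outside its domain. The value 0 there keeps \<open>a\<close> nonnegative and
    measurable.\<close>
  define a where "a w = (if det (G w) \<noteq> 0 then \<Sum>i\<in>UNIV. \<psi> (eigvals (G w ** hadj (G w)) i) else 0)" for w
  define tr where "tr w = trace_fun (convex_conj \<psi>) ((sqrt \<sigma> *\<^sub>R Fhat w) ** hadj (sqrt \<sigma> *\<^sub>R Fhat w))" for w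
  define IA where "IA = (\<integral>\<^sup>+w. ennreal (a w) \<partial>lborel)"
  define IB where "IB = (\<integral>\<^sup>+w. e2ennreal (tr w) \<partial>lborel)"
  define N where "N = (\<integral>\<^sup>+w. ennreal ((norm (\<Phi> w ** G w))\<^sup>2) \<partial>lborel)"
  define q where "q = 1 / (2 * pi)"
  have q: "0 < q" by (simp add: q_def)
  have a_meas [measurable]: "a \<in> borel_measurable borel"
    using measurable_compose[OF \<open>G \<in> borel_measurable borel\<close> borel_measurable_trace_gram[OF cvx]]
    by (simp add: a_def[abs_def])
  have G_det: "AE w in lborel. det (G w) \<noteq> 0"
    using det Ghat by eventually_elim simp
  have tr\<psi>: "AE w in lborel. trace_fun (\<lambda>x. ereal (\<psi> x)) (Ghat w ** hadj (Ghat w)) = ereal (a w)"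
    using Ghat G_det by eventually_elim (simp add: trace_fun_def a_def)
  have a0: "0 \<le> a w" for w
    by (auto simp: a_def intro!: sum_nonneg nonneg gram_eigvals_pos)
  have "cov_functional (\<lambda>x. ereal (\<psi> x)) Ghat = ereal q *
      enn2ereal (\<integral>\<^sup>+w. e2ennreal (trace_fun (\<lambda>x. ereal (\<psi> x)) (Ghat w ** hadj (Ghat w))) \<partial>lborel)"
    unfolding q_def by (rule cov_functional_nonneg_eq) (use tr\<psi> a0 in \<open>auto elim: eventually_mono\<close>)
  also have "(\<integral>\<^sup>+w. e2ennreal (trace_fun (\<lambda>x. ereal (\<psi> x)) (Ghat w ** hadj (Ghat w))) \<partial>lborel) = IA"
    unfolding IA_def using tr\<psi> by (intro nn_integral_cong_AE) (auto simp: ennreal.abs_eq e2ennreal_ereal elim!: eventually_mono)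
  finally have "ereal q * enn2ereal IA \<le> ereal d"
    using cov by simp
  then have IA: "ennreal q * IA \<le> ennreal d"
    using q d by (simp add: less_eq_ennreal.rep_eq times_ennreal.rep_eq)
  have "IA < \<infinity>"
    using IA q by (cases "IA = \<top>") (auto simp: ennreal_mult_top top_unique less_top)
  moreover have "(\<integral>\<^sup>+w. ennreal (\<Sum>i\<in>UNIV. \<psi> (eigvals (G w ** hadj (G w)) i)) \<partial>lborel) = IA"
    unfolding IA_def using G_det by (intro nn_integral_cong_AE) (auto simp: a_def elim!: eventually_mono)
  ultimately have inf: "\<exists>x>0. \<psi> x < e" if "0 < e" for e
    using trace_integral_finite_imp_inf_zero[OF _ G_det nonneg that] by simp
  have conj0: "0 \<le> convex_conj \<psi> z" if "0 \<le> z" for z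
    by (rule convex_conj_nonneg[OF cvx deriv inf that])
  have tr0: "0 \<le> tr w" for w
    unfolding tr_def trace_fun_def by (intro sum_nonneg conj0 gram_eigvals_nonneg)
  have J: "cov_functional (convex_conj \<psi>) (\<lambda>w. sqrt \<sigma> *\<^sub>R Fhat w) = ereal q * enn2ereal IB"
    unfolding q_def IB_def tr_def by (rule cov_functional_nonneg_eq) (use tr0 in \<open>simp add: tr_def\<close>)
  have "AE w in lborel. ennreal (\<sigma> * (norm (\<Phi> w ** G w))\<^sup>2) \<le> ennreal (a w) + e2ennreal (tr w)"
    using Ghat Fhat G_det tr\<psi>
  proof eventually_elim
    case (elim w)
    \<comment> \<open>The factor \<open>sqrt \<sigma>\<close> scales the eigenvalues of the Gram
      matrix of \<open>Fhat w\<close>, and the squared norm of the product, by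
      \<open>\<sigma>\<close>.\<close>
    have "(sqrt \<sigma> *\<^sub>R \<Phi> w) ** G w = sqrt \<sigma> *\<^sub>R (\<Phi> w ** G w)"
      by (simp add: vec_eq_iff matrix_matrix_mult_def scaleR_sum_right)
    then have "ereal (\<sigma> * (norm (\<Phi> w ** G w))\<^sup>2) = ereal ((norm ((sqrt \<sigma> *\<^sub>R Fhat w) ** Ghat w))\<^sup>2)"
      using \<sigma> elim by (simp add: power_mult_distrib)
    also have "\<dots> \<le> ereal (a w) + tr w"
      unfolding elim(4)[symmetric] tr_def
      by (rule norm_mult_sq_le_trace_fun) (use elim nonneg conj0 convex_conj_young[OF cvx deriv] in auto)
    finally have "e2ennreal (ereal (\<sigma> * (norm (\<Phi> w ** G w))\<^sup>2)) \<le> e2ennreal (ereal (a w) + tr w)"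
      by (rule e2ennreal_mono)
    moreover have "e2ennreal (ereal (a w) + tr w) = ennreal (a w) + e2ennreal (tr w)"
      using a0[of w] tr0[of w] by (cases "tr w") auto
    ultimately show ?case
      by (simp add: e2ennreal_ereal)
  qed
  then have "(\<integral>\<^sup>+w. ennreal (\<sigma> * (norm (\<Phi> w ** G w))\<^sup>2) \<partial>lborel) \<le> IA + IB"
    unfolding IA_def IB_def by (intro nn_integral_le_add_nonmeasurable) auto
  moreover have "(\<integral>\<^sup>+w. ennreal (\<sigma> * (norm (\<Phi> w ** G w))\<^sup>2) \<partial>lborel) = ennreal \<sigma> * N"
    using \<sigma> by (simp add: N_def ennreal_mult nn_integral_cmult)
  ultimately have "ennreal \<sigma> * N \<le> IA + IB" by simp
  have "ennreal q * N = ennreal (1 / \<sigma>) * (ennreal q * (ennreal \<sigma> * N))"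
    using \<sigma> q by (simp flip: mult.assoc ennreal_mult)
  also have "\<dots> \<le> ennreal (1 / \<sigma>) * (ennreal q * (IA + IB))"
    by (intro mult_left_mono \<open>ennreal \<sigma> * N \<le> IA + IB\<close>) auto
  also have "\<dots> \<le> ennreal (1 / \<sigma>) * (ennreal q * IB + ennreal d)"
    using IA by (intro mult_left_mono) (auto simp: distrib_left add.commute intro: add_left_mono)
  finally have "enn2ereal (ennreal q * N) \<le> enn2ereal (ennreal (1 / \<sigma>) * (ennreal q * IB + ennreal d))"
    by (simp only: less_eq_ennreal.rep_eq)
  also have "\<dots> = ereal (1 / \<sigma>) * (ereal q * enn2ereal IB + ereal d)"
    using \<sigma> q d by (simp add: times_ennreal.rep_eq plus_ennreal.rep_eq)
  finally show ?thesis
    unfolding J by (simp add: q_def N_def)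
qed

theorem theorem3:
  fixes \<psi> :: "real \<Rightarrow> real" and \<Psi> :: "complex \<Rightarrow> complex"
    and f :: "real \<Rightarrow> real^'m^'p"
    and F :: "complex \<Rightarrow> complex^'m^'p" and Fhat :: "real \<Rightarrow> complex^'m^'p"
    and M :: "'a measure" and V :: "real \<Rightarrow> 'a \<Rightarrow> real^'m"
    and W :: "(complex \<Rightarrow> complex^'m^'m) \<Rightarrow> real \<Rightarrow> 'a \<Rightarrow> complex^'m"
    and Z :: "(complex \<Rightarrow> complex^'m^'m) \<Rightarrow> real \<Rightarrow> 'a \<Rightarrow> complex^'p"
    and d t :: real
  assumes psi_nonneg: "\<And>x. 0 < x \<Longrightarrow> 0 \<le> \<psi> x"
    and psi_analytic: "\<Psi> analytic_on complex_of_real ` {0<..}"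
      "\<And>x. 0 < x \<Longrightarrow> \<Psi> (complex_of_real x) = complex_of_real (\<psi> x)"
    and psi_convex: "\<And>x. 0 < x \<Longrightarrow> 0 < deriv (deriv \<psi>) x"
    and f_L2: "set_borel_measurable lborel {0..} f"
      "set_integrable lborel {0..} (\<lambda>\<tau>. (norm (f \<tau>))\<^sup>2)"
    and F_def: "F = laplace (\<lambda>\<tau>. map_matrix complex_of_real (f \<tau>))"
    and F_nonzero: "\<exists>s. 0 < Re s \<and> F s \<noteq> 0"
    and Fhat: "has_boundary_value F Fhat"
    and wiener: "standard_wiener M V"
    and input: "\<And>\<Gamma>. \<Gamma> \<in> uncertainty_class \<psi> d \<Longrightarrow> shaped_process M V \<Gamma> (W \<Gamma>)"
    and "output": "\<And>\<Gamma>. \<Gamma> \<in> uncertainty_class \<psi> d \<Longrightarrow> system_output M f (W \<Gamma>) (Z \<Gamma>)"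
    and d: "0 \<le> d"
  shows "(SUP \<Gamma>\<in>uncertainty_class \<psi> d. ereal (prob_space.expectation M (\<lambda>x. (norm (Z \<Gamma> t x))\<^sup>2)))
    \<le> (INF \<sigma>\<in>{0<..}. ereal (1 / \<sigma>) *
          (cov_functional (convex_conj \<psi>) (\<lambda>\<omega>. sqrt \<sigma> *\<^sub>R Fhat \<omega>) + ereal d))"
proof (intro SUP_least INF_greatest)
  fix \<Gamma> :: "complex \<Rightarrow> complex^'m^'m" and \<sigma> :: real
  assume cls: "\<Gamma> \<in> uncertainty_class \<psi> d" and "\<sigma> \<in> {0<..}"
  then have \<sigma>: "0 < \<sigma>" by simp
  have cvx: "convex_on {0<..} \<psi>" and der: "\<And>x. 0 < x \<Longrightarrow> (\<psi> has_real_derivative deriv \<psi> x) (at x)"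
    using analytic_psi_convex[OF psi_analytic psi_convex] by auto
  obtain \<Gamma>hat where \<Gamma>: "hardy_inf \<Gamma>" and \<Gamma>hat: "has_boundary_value \<Gamma> \<Gamma>hat"
    and det: "AE \<omega> in lborel. det (\<Gamma>hat \<omega>) \<noteq> 0" and cov: "cov_functional (\<lambda>x. ereal (\<psi> x)) \<Gamma>hat \<le> ereal d"
    using cls unfolding uncertainty_class_def by blast
  obtain K where K: "norm (\<Gamma> s) \<le> K" if "0 < Re s" for s
    using \<Gamma> by (auto simp: hardy_inf_def bounded_iff)
  have K0: "0 \<le> K"
    using K[of 1] order_trans[OF norm_ge_zero] by simp
  obtain G0 where G0 [measurable]: "G0 \<in> borel_measurable borel" and G0_eq: "AE w in lborel. \<Gamma>hat w = G0 w"
    using boundary_value_measurable[OF \<Gamma>hat hardy_inf_measurable[OF \<Gamma>]] by blast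
  \<comment> \<open>The boundary value inherits the bound \<open>K\<close> almost everywhere; the
    cut makes the bound hold everywhere and changes \<open>G0\<close> only on a null set.\<close>
  define G where "G w = (if norm (G0 w) \<le> K then G0 w else 0)" for w
  have G [measurable]: "G \<in> borel_measurable borel"
    unfolding G_def[abs_def] by measurable
  have GK: "norm (G w) \<le> K" for w
    using K0 by (simp add: G_def)
  have G_eq: "AE w in lborel. \<Gamma>hat w = G w"
    using G0_eq boundary_value_sequence[OF \<Gamma>hat]
  proof eventually_elim
    case (elim w)
    have "norm (\<Gamma>hat w) \<le> K"
      by (rule Lim_norm_ubound[OF trivial_limit_sequentially elim(2)]) (simp add: K)
    then show ?case using elim by (simp add: G_def)
  qed
  have Glim: "AE w in lborel. (\<lambda>n. \<Gamma> (Complex (1 / real (Suc n)) w)) \<longlonglongrightarrow> G w"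
    using G_eq boundary_value_sequence[OF \<Gamma>hat] by eventually_elim simp
  define h where "h \<tau> = (map_matrix complex_of_real (f \<tau>) :: complex^'m^'p)" for \<tau>
  have F: "F = laplace h"
    unfolding F_def h_def[abs_def] ..
  have Z: "has_stoch_integral M (W \<Gamma>) (\<lambda>\<tau>. if \<tau> \<le> t then h (t - \<tau>) else 0) (Z \<Gamma> t)"
    using "output"[OF cls] unfolding system_output_def h_def by blast
  obtain \<Phi> where \<Phi> [measurable]: "\<Phi> \<in> borel_measurable borel" and \<Phi>_eq: "AE w in lborel. Fhat w = \<Phi> w"
  proof (rule boundary_value_measurable[OF Fhat])
    \<comment> \<open>The measurability of the time-reversed impulse response is taken from the
      stochastic integral that defines the output at time \<open>t\<close>.\<close>
    show "(\<lambda>w. F (Complex x w)) \<in> borel_measurable borel" if "0 < x" for x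
      unfolding F by (rule borel_measurable_laplace[of t h x])
        (use Z that in \<open>simp_all add: has_stoch_integral_def\<close>)
  qed blast
  have \<Phi>lim: "AE w in lborel. (\<lambda>n. laplace h (Complex (1 / real (Suc n)) w)) \<longlonglongrightarrow> \<Phi> w"
    using \<Phi>_eq boundary_value_sequence[OF Fhat] unfolding F by eventually_elim simp
  let ?E = "\<integral>\<^sup>+x. ennreal ((norm (Z \<Gamma> t x))\<^sup>2) \<partial>M"
  \<comment> \<open>The expectation is a Bochner integral, equal to 0 if the squared norm is not
    integrable, so it lies below the nonnegative integral in any case.\<close>
  have "ereal (prob_space.expectation M (\<lambda>x. (norm (Z \<Gamma> t x))\<^sup>2)) \<le> enn2ereal ?E"
  proof (cases "integrable M (\<lambda>x. (norm (Z \<Gamma> t x))\<^sup>2)")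
    case True
    then show ?thesis
      by (simp add: nn_integral_eq_integral integral_nonneg)
  qed (simp add: not_integrable_integral_eq flip: zero_ereal_def)
  also have "\<dots> \<le> enn2ereal (ennreal (1 / (2 * pi)) * (\<integral>\<^sup>+w. ennreal ((norm (\<Phi> w ** G w))\<^sup>2) \<partial>lborel))"
    using output_norm_sq_le[OF wiener \<Gamma> K G GK Glim \<Phi> \<Phi>lim input[OF cls] Z]
    by (simp only: less_eq_ennreal.rep_eq)
  also have "\<dots> \<le> ereal (1 / \<sigma>) * (cov_functional (convex_conj \<psi>) (\<lambda>\<omega>. sqrt \<sigma> *\<^sub>R Fhat \<omega>) + ereal d)"
    by (rule norm_sq_integral_le_cov_functional[OF psi_nonneg cvx der G \<Phi> G_eq \<Phi>_eq det cov d \<sigma>])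
  finally show "ereal (prob_space.expectation M (\<lambda>x. (norm (Z \<Gamma> t x))\<^sup>2)) \<le>
      ereal (1 / \<sigma>) * (cov_functional (convex_conj \<psi>) (\<lambda>\<omega>. sqrt \<sigma> *\<^sub>R Fhat \<omega>) + ereal d)" .
qed

end
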